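(* Let $S\triangleleft\ell^\infty$ be a symmetric ideal. The map $HC_0(\Gamma^\infty:I_S)\to HC_0(\mathcal B:J_S)$ induced by the inclusion $\Gamma^\infty\subset\mathcal B$ is an isomorphism.
   Context: $\mathcal B=\mathcal B(\ell^2(\mathbb N))$ is the algebra of bounded operators and $\ell^\infty=\ell^\infty(\mathbb N,\mathbb C)$. An ideal $S\triangleleft\ell^\infty$ is symmetric if it is stable under $\alpha\mapsto f_*(\alpha)$ for every partially defined injection $f:\mathbb N\supset\mathrm{dom}f\to\mathbb N$, where $f_*(\alpha)_n=\alpha_m$ if $n=f(m)$, and $0$ if $n\notin\mathrm{ran}f$. $J_S\triangleleft\mathcal B$ is the ideal corresponding to $S$ under Calkin's correspondence: the ideal generated by the diagonal operators $\mathrm{diag}(\alpha)$, $\alpha\in S$ (for proper $S$: the compact operators whose sequence of singular values lies in $S$). $\Gamma^\infty\subset\mathcal B$ is the algebra of complex matrices $(A_{ij})_{i,j\in\mathbb N}$ with bounded entries and a uniform finite bound on the number of nonzero entries in each row and column; $I_S=\{A\in\Gamma^\infty:(A_{ij})\in S(\mathbb N\times\mathbb N)\}$, where $S(\mathbb N\times\mathbb N)$ corresponds to $S$ under any bijection $\mathbb N\cong\mathbb N\times\mathbb N$. For a two-sided ideal $I$ of a unital ring $R$, $HC_0(R:I)=I/[R,I]$, where $[R,I]$ is the additive subgroup spanned by the commutators $ra-ar$, $r\in R$, $a\in I$. *)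

theory Defs
  imports "HOL-Analysis.Analysis" "HOL-Algebra.QuotRing" "HOL-Algebra.Generated_Groups"
    "HOL-Library.Nat_Bijection"
begin

section \<open>The Hilbert space of square summable complex sequences\<close>

typedef ell2 = "{x :: nat \<Rightarrow> complex. summable (\<lambda>n. (cmod (x n))\<^sup>2)}"
  morphisms ell2_nth Abs_ell2
  by (rule exI[of _ "\<lambda>_. 0"]) simp

setup_lifting type_definition_ell2

lemma ell2_eqI: "(\<And>n. ell2_nth x n = ell2_nth y n) \<Longrightarrow> x = y"
  by (simp add: ell2_nth_inject[symmetric] fun_eq_iff)

lemma ell2_summable: "summable (\<lambda>n. (cmod (ell2_nth x n))\<^sup>2)"
  using ell2_nth by auto

lemma square_summable_add:
  assumes "summable (\<lambda>n. (cmod (x n))\<^sup>2)" "summable (\<lambda>n. (cmod (y n))\<^sup>2)"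
  shows "summable (\<lambda>n. (cmod (x n + y n))\<^sup>2)"
proof (rule summable_comparison_test')
  show "summable (\<lambda>n. 2 * (cmod (x n))\<^sup>2 + 2 * (cmod (y n))\<^sup>2)"
    using assms by (intro summable_add summable_mult)
  fix n :: nat
  have "(cmod (x n + y n))\<^sup>2 \<le> (cmod (x n) + cmod (y n))\<^sup>2"
    by (intro power_mono norm_triangle_ineq norm_ge_zero)
  also have "\<dots> \<le> 2 * (cmod (x n))\<^sup>2 + 2 * (cmod (y n))\<^sup>2"
    using sum_squares_bound[of "cmod (x n)" "cmod (y n)"] by (simp add: power2_sum)
  finally show "norm ((cmod (x n + y n))\<^sup>2) \<le> 2 * (cmod (x n))\<^sup>2 + 2 * (cmod (y n))\<^sup>2" by simp
qed

lemma square_summable_cmult: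
  "summable (\<lambda>n. (cmod (x n))\<^sup>2) \<Longrightarrow> summable (\<lambda>n. (cmod (c * x n))\<^sup>2)"
  by (simp add: norm_mult power_mult_distrib summable_mult)

lemma summable_inner:
  assumes "summable (\<lambda>n. (cmod (x n))\<^sup>2)" "summable (\<lambda>n. (cmod (y n))\<^sup>2)"
  shows "summable (\<lambda>n. x n \<bullet> y n)"
proof (rule summable_comparison_test')
  show "summable (\<lambda>n. (cmod (x n))\<^sup>2 + (cmod (y n))\<^sup>2)"
    using assms by (intro summable_add)
  fix n :: nat
  have "\<bar>x n \<bullet> y n\<bar> \<le> cmod (x n) * cmod (y n)" by (rule Cauchy_Schwarz_ineq2)
  also have "\<dots> \<le> (cmod (x n))\<^sup>2 + (cmod (y n))\<^sup>2"
  proof -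
    have "0 \<le> cmod (x n) * cmod (y n)" by simp
    then show ?thesis
      using sum_squares_bound[of "cmod (x n)" "cmod (y n)"] unfolding mult.assoc by linarith
  qed
  finally show "norm (x n \<bullet> y n) \<le> (cmod (x n))\<^sup>2 + (cmod (y n))\<^sup>2" by simp
qed

instantiation ell2 :: real_vector
begin

lift_definition zero_ell2 :: ell2 is "\<lambda>_. 0" by simp
lift_definition plus_ell2 :: "ell2 \<Rightarrow> ell2 \<Rightarrow> ell2" is "\<lambda>x y n. x n + y n"
  by (rule square_summable_add)
lift_definition uminus_ell2 :: "ell2 \<Rightarrow> ell2" is "\<lambda>x n. - x n" by simp
lift_definition minus_ell2 :: "ell2 \<Rightarrow> ell2 \<Rightarrow> ell2" is "\<lambda>x y n. x n - y n"
  using square_summable_add[where y = "\<lambda>n. - y n" for y] by simp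
lift_definition scaleR_ell2 :: "real \<Rightarrow> ell2 \<Rightarrow> ell2" is "\<lambda>r x n. r *\<^sub>R x n"
  by (simp add: power_mult_distrib summable_mult)

instance
  by standard (transfer; simp add: fun_eq_iff algebra_simps)+

end

text \<open>The inner product below is the real part of the complex inner product; it
  induces the usual norm of the Hilbert space.\<close>

instantiation ell2 :: real_inner
begin

definition inner_ell2 :: "ell2 \<Rightarrow> ell2 \<Rightarrow> real"
  where "inner_ell2 x y = (\<Sum>n. ell2_nth x n \<bullet> ell2_nth y n)"
definition norm_ell2 :: "ell2 \<Rightarrow> real"
  where "norm_ell2 x = sqrt (\<Sum>n. (cmod (ell2_nth x n))\<^sup>2)"
definition dist_ell2 :: "ell2 \<Rightarrow> ell2 \<Rightarrow> real"
  where "dist_ell2 x y = norm (x - y)"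
definition sgn_ell2 :: "ell2 \<Rightarrow> ell2"
  where "sgn_ell2 x = x /\<^sub>R norm x"
definition uniformity_ell2 :: "(ell2 \<times> ell2) filter"
  where "uniformity_ell2 = (INF e\<in>{0<..}. principal {(x, y). dist x y < e})"
definition open_ell2 :: "ell2 set \<Rightarrow> bool"
  where "open_ell2 U = (\<forall>x\<in>U. \<forall>\<^sub>F (x', y) in uniformity. x' = x \<longrightarrow> y \<in> U)"

instance
proof
  fix x y z :: ell2 and r :: real
  note s = summable_inner[OF ell2_summable ell2_summable]
  show "dist x y = norm (x - y)" by (rule dist_ell2_def)
  show "sgn x = x /\<^sub>R norm x" by (rule sgn_ell2_def)
  show "uniformity = (INF e\<in>{0<..}. principal {(x :: ell2, y). dist x y < e})"
    by (rule uniformity_ell2_def)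
  show "open U = (\<forall>x\<in>U. \<forall>\<^sub>F (x', y) in uniformity. x' = x \<longrightarrow> y \<in> U)" for U :: "ell2 set"
    by (rule open_ell2_def)
  show "x \<bullet> y = y \<bullet> x" by (simp add: inner_ell2_def inner_commute)
  show "(x + y) \<bullet> z = x \<bullet> z + y \<bullet> z"
    unfolding inner_ell2_def plus_ell2.rep_eq inner_add_left by (rule suminf_add[symmetric, OF s s])
  show "(r *\<^sub>R x) \<bullet> y = r * (x \<bullet> y)"
    unfolding inner_ell2_def scaleR_ell2.rep_eq inner_scaleR_left by (rule suminf_mult[OF s])
  show "0 \<le> x \<bullet> x"
    unfolding inner_ell2_def by (rule suminf_nonneg[OF s]) simp
  show "x \<bullet> x = 0 \<longleftrightarrow> x = 0"
  proof
    assume "x \<bullet> x = 0"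
    then have "\<forall>n. ell2_nth x n \<bullet> ell2_nth x n = 0"
      unfolding inner_ell2_def using suminf_eq_zero_iff[OF s] by simp
    then show "x = 0" by (intro ell2_eqI) (simp add: zero_ell2.rep_eq)
  qed (simp add: inner_ell2_def zero_ell2.rep_eq)
  show "norm x = sqrt (x \<bullet> x)"
    by (simp add: norm_ell2_def inner_ell2_def dot_square_norm)
qed

end

lift_definition scaleC_ell2 :: "complex \<Rightarrow> ell2 \<Rightarrow> ell2" (infixr \<open>*\<^sub>C\<close> 75)
  is "\<lambda>c x n. c * x n"
  by (rule square_summable_cmult)


section \<open>The rings involved\<close>

definition linf :: "(nat \<Rightarrow> complex) ring"
  where "linf = \<lparr>carrier = {\<alpha>. bounded (range \<alpha>)},
    monoid.mult = (\<lambda>\<alpha> \<beta> n. \<alpha> n * \<beta> n), one = (\<lambda>_. 1),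
    zero = (\<lambda>_. 0), add = (\<lambda>\<alpha> \<beta> n. \<alpha> n + \<beta> n)\<rparr>"

definition bounded_ops :: "(ell2 \<Rightarrow> ell2) ring"  (\<open>\<B>\<close>)
  where "\<B> = \<lparr>carrier = {T. bounded_linear T \<and> (\<forall>c x. T (c *\<^sub>C x) = c *\<^sub>C T x)},
    monoid.mult = (\<circ>), one = id,
    zero = (\<lambda>_. 0), add = (\<lambda>T U x. T x + U x)\<rparr>"

type_synonym cmatrix = "nat \<Rightarrow> nat \<Rightarrow> complex"

definition Gamma_carrier :: "cmatrix set"
  where "Gamma_carrier = {A.
    (\<exists>C. \<forall>i j. cmod (A i j) \<le> C) \<and>
    (\<exists>N. (\<forall>i. finite {j. A i j \<noteq> 0} \<and> card {j. A i j \<noteq> 0} \<le> N) \<and>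
         (\<forall>j. finite {i. A i j \<noteq> 0} \<and> card {i. A i j \<noteq> 0} \<le> N))}"

text \<open>Rows are finitely supported, so the usual matrix product is given by finite sums.\<close>

definition Gamma_inf :: "cmatrix ring"  (\<open>\<Gamma>\<^sup>\<infinity>\<close>)
  where "\<Gamma>\<^sup>\<infinity> = \<lparr>carrier = Gamma_carrier,
    monoid.mult = (\<lambda>A B i j. \<Sum>k | A i k \<noteq> 0. A i k * B k j),
    one = (\<lambda>i j. if i = j then 1 else 0),
    zero = (\<lambda>_ _. 0), add = (\<lambda>A B i j. A i j + B i j)\<rparr>"

text \<open>The inclusion of \<open>\<Gamma>\<^sup>\<infinity>\<close> into \<open>\<B>\<close>: a matrix acts by matrix-vector multiplication.
  The result is square summable for matrices in \<open>\<Gamma>\<^sup>\<infinity>\<close>, see \<open>ell2_nth_matrix_op\<close> below.\<close>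

definition matrix_op :: "cmatrix \<Rightarrow> ell2 \<Rightarrow> ell2"
  where "matrix_op A x = Abs_ell2 (\<lambda>i. \<Sum>j | A i j \<noteq> 0. A i j * ell2_nth x j)"

definition diag_op :: "(nat \<Rightarrow> complex) \<Rightarrow> ell2 \<Rightarrow> ell2"
  where "diag_op \<alpha> x = Abs_ell2 (\<lambda>n. \<alpha> n * ell2_nth x n)"


section \<open>Symmetric ideals and the associated ideals\<close>

definition pushforward :: "nat set \<Rightarrow> (nat \<Rightarrow> nat) \<Rightarrow> (nat \<Rightarrow> complex) \<Rightarrow> nat \<Rightarrow> complex"
  where "pushforward D f \<alpha> = (\<lambda>n. if n \<in> f ` D then \<alpha> (inv_into D f n) else 0)"

definition symmetric_ideal :: "(nat \<Rightarrow> complex) set \<Rightarrow> bool"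
  where "symmetric_ideal S \<longleftrightarrow> ideal S linf \<and>
    (\<forall>D f. inj_on f D \<longrightarrow> (\<forall>\<alpha>\<in>S. pushforward D f \<alpha> \<in> S))"

definition J_ideal :: "(nat \<Rightarrow> complex) set \<Rightarrow> (ell2 \<Rightarrow> ell2) set"
  where "J_ideal S = Idl\<^bsub>\<B>\<^esub> (diag_op ` S)"

text \<open>The bijection \<open>prod_decode\<close> is an arbitrary choice, see \<open>I_ideal_bij\<close> below.\<close>

definition I_ideal :: "(nat \<Rightarrow> complex) set \<Rightarrow> cmatrix set"
  where "I_ideal S = {A \<in> carrier \<Gamma>\<^sup>\<infinity>. (\<lambda>n. case_prod A (prod_decode n)) \<in> S}"


section \<open>Relative \<open>HC\<^sub>0\<close>\<close>

definition commutator_subgroup :: "('a, 'b) ring_scheme \<Rightarrow> 'a set \<Rightarrow> 'a set"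
  where "commutator_subgroup R I =
    generate (add_monoid R) {r \<otimes>\<^bsub>R\<^esub> a \<ominus>\<^bsub>R\<^esub> a \<otimes>\<^bsub>R\<^esub> r | r a. r \<in> carrier R \<and> a \<in> I}"

definition HC0 :: "('a, 'b) ring_scheme \<Rightarrow> 'a set \<Rightarrow> 'a set monoid"
  where "HC0 R I = (R\<lparr>carrier := I\<rparr>) A_Mod (commutator_subgroup R I)"

text \<open>The map on \<open>HC\<^sub>0\<close> induced by a ring homomorphism \<open>h\<close> from \<open>R\<close> to \<open>R'\<close> that carries the
  ideal \<open>I\<close> into \<open>I'\<close>: the class of \<open>a\<close> is sent to the class of \<open>h a\<close>.\<close>

definition HC0_map :: "('c, 'd) ring_scheme \<Rightarrow> 'c set \<Rightarrow> ('a \<Rightarrow> 'c) \<Rightarrow> 'a set \<Rightarrow> 'c set"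
  where "HC0_map R' I' h = (\<lambda>X. the_elem ((\<lambda>a. commutator_subgroup R' I' +>\<^bsub>R'\<^esub> h a) ` X))"


section \<open>Well-definedness\<close>

lemma cring_linf: "cring linf"
proof (rule cringI)
  show "abelian_group linf"
  proof (rule abelian_groupI)
    fix x assume "x \<in> carrier linf"
    then show "\<exists>y\<in>carrier linf. y \<oplus>\<^bsub>linf\<^esub> x = \<zero>\<^bsub>linf\<^esub>"
      by (intro bexI[of _ "\<lambda>n. - x n"]) (auto simp: linf_def bounded_iff)
  qed (auto simp: linf_def fun_eq_iff intro: bounded_plus_comp)
  show "comm_monoid linf"
  proof (rule comm_monoidI)
    fix x y assume "x \<in> carrier linf" "y \<in> carrier linf"
    then obtain a b where "\<And>n. cmod (x n) \<le> a" "\<And>n. cmod (y n) \<le> b"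
      by (auto simp: linf_def bounded_iff)
    then have "cmod (x n * y n) \<le> a * b" for n
      unfolding norm_mult by (meson mult_mono norm_ge_zero order_trans)
    then show "x \<otimes>\<^bsub>linf\<^esub> y \<in> carrier linf"
      by (auto simp: linf_def bounded_iff)
  qed (auto simp: linf_def fun_eq_iff)
qed (auto simp: linf_def fun_eq_iff algebra_simps)

lemma ring_bounded_ops: "ring \<B>"
proof (rule ringI)
  have ad: "c *\<^sub>C (x + y) = c *\<^sub>C x + c *\<^sub>C y" for c x y by transfer (simp add: algebra_simps)
  have mn: "c *\<^sub>C (- x) = - (c *\<^sub>C x)" for c x by transfer simp
  have z: "c *\<^sub>C 0 = 0" for c by transfer simp
  show "abelian_group \<B>"
  proof (rule abelian_groupI)
    fix x assume "x \<in> carrier \<B>"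
    then show "\<exists>y\<in>carrier \<B>. y \<oplus>\<^bsub>\<B>\<^esub> x = \<zero>\<^bsub>\<B>\<^esub>"
      by (intro bexI[of _ "\<lambda>n. - x n"]) (auto simp: bounded_ops_def bounded_linear_minus mn)
  qed (auto simp: bounded_ops_def fun_eq_iff bounded_linear_add bounded_linear_zero ad z add_ac)
  show "monoid \<B>"
    by (rule monoidI) (auto simp: bounded_ops_def bounded_linear_compose comp_def bounded_linear_ident id_def)
qed (auto simp: bounded_ops_def fun_eq_iff linear_simps)

lemma ell2_nth_diag_op:
  assumes "\<alpha> \<in> carrier linf"
  shows "ell2_nth (diag_op \<alpha> x) n = \<alpha> n * ell2_nth x n"
proof -
  obtain C where C: "\<And>n. cmod (\<alpha> n) \<le> C"
    using assms by (auto simp: linf_def bounded_iff)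
  have "summable (\<lambda>n. (cmod (\<alpha> n * ell2_nth x n))\<^sup>2)"
  proof (rule summable_comparison_test')
    show "summable (\<lambda>n. C\<^sup>2 * (cmod (ell2_nth x n))\<^sup>2)"
      by (intro summable_mult ell2_summable)
    show "norm ((cmod (\<alpha> n * ell2_nth x n))\<^sup>2) \<le> C\<^sup>2 * (cmod (ell2_nth x n))\<^sup>2" for n
      using C[of n] by (simp add: norm_mult power_mult_distrib mult_right_mono power_mono)
  qed
  then show ?thesis by (simp add: diag_op_def Abs_ell2_inverse)
qed

lemma ell2_nth_matrix_op:
  assumes "A \<in> carrier \<Gamma>\<^sup>\<infinity>"
  shows "ell2_nth (matrix_op A x) i = (\<Sum>j | A i j \<noteq> 0. A i j * ell2_nth x j)"
proof -
  obtain C N where C: "\<And>i j. cmod (A i j) \<le> C"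
    and fin: "\<And>i. finite {j. A i j \<noteq> 0}"
    and row: "\<And>i. card {j. A i j \<noteq> 0} \<le> N"
    and col: "\<And>j. finite {i. A i j \<noteq> 0} \<and> card {i. A i j \<noteq> 0} \<le> N"
    using assms unfolding Gamma_inf_def Gamma_carrier_def partial_object.simps mem_Collect_eq
    by blast
  define u where "u j = (cmod (ell2_nth x j))\<^sup>2" for j
  have u: "summable u" "\<And>j. 0 \<le> u j"
    using ell2_summable[of x] by (simp_all add: u_def[abs_def])
  have entry: "(cmod (\<Sum>j | A i j \<noteq> 0. A i j * ell2_nth x j))\<^sup>2
      \<le> N * C\<^sup>2 * (\<Sum>j | A i j \<noteq> 0. u j)" for i
  proof -
    have "(cmod (\<Sum>j | A i j \<noteq> 0. A i j * ell2_nth x j))\<^sup>2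
        \<le> (\<Sum>j | A i j \<noteq> 0. cmod (A i j * ell2_nth x j))\<^sup>2"
      by (intro power_mono norm_sum norm_ge_zero)
    also have "\<dots> \<le> (\<Sum>j | A i j \<noteq> 0. (cmod (A i j * ell2_nth x j))\<^sup>2) * card {j. A i j \<noteq> 0}"
      by (rule sum_squared_le_sum_of_squares)
    also have "\<dots> \<le> (\<Sum>j | A i j \<noteq> 0. C\<^sup>2 * u j) * N"
    proof (intro mult_mono sum_mono)
      show "(cmod (A i j * ell2_nth x j))\<^sup>2 \<le> C\<^sup>2 * u j" for j
        using C[of i j] by (simp add: u_def norm_mult power_mult_distrib mult_right_mono power_mono)
    qed (use row u in \<open>auto intro: sum_nonneg\<close>)
    finally show ?thesis by (simp only: sum_distrib_left sum_distrib_right mult_ac)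
  qed
  have partial: "(\<Sum>i<m. \<Sum>j | A i j \<noteq> 0. u j) \<le> N * suminf u" for m
  proof -
    define U where "U = (\<Union>i<m. {j. A i j \<noteq> 0})"
    have U: "finite U" using fin by (simp add: U_def)
    have "(\<Sum>i<m. \<Sum>j | A i j \<noteq> 0. u j) = (\<Sum>i<m. \<Sum>j\<in>U. if A i j \<noteq> 0 then u j else 0)"
    proof (rule sum.cong[OF refl])
      fix i assume "i \<in> {..<m}"
      then have "{j. A i j \<noteq> 0} = {j \<in> U. A i j \<noteq> 0}" by (auto simp: U_def)
      then show "(\<Sum>j | A i j \<noteq> 0. u j) = (\<Sum>j\<in>U. if A i j \<noteq> 0 then u j else 0)"
        using sum.inter_filter[OF U, of u "\<lambda>j. A i j \<noteq> 0"] by simp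
    qed
    also have "\<dots> = (\<Sum>j\<in>U. \<Sum>i<m. if A i j \<noteq> 0 then u j else 0)" by (rule sum.swap)
    also have "\<dots> = (\<Sum>j\<in>U. real (card {i\<in>{..<m}. A i j \<noteq> 0}) * u j)"
      by (simp add: sum.inter_filter[symmetric])
    also have "\<dots> \<le> (\<Sum>j\<in>U. N * u j)"
    proof (intro sum_mono mult_right_mono)
      fix j
      have "card {i\<in>{..<m}. A i j \<noteq> 0} \<le> card {i. A i j \<noteq> 0}"
        using col[of j] by (intro card_mono) auto
      then show "real (card {i\<in>{..<m}. A i j \<noteq> 0}) \<le> real N" using col[of j] by simp
    qed (rule u)
    also have "\<dots> \<le> N * suminf u"
      using sum_le_suminf[OF u(1) U] u(2) by (simp add: sum_distrib_left[symmetric] mult_left_mono)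
    finally show ?thesis .
  qed
  have "summable (\<lambda>i. (cmod (\<Sum>j | A i j \<noteq> 0. A i j * ell2_nth x j))\<^sup>2)"
  proof (rule bounded_imp_summable)
    show "(\<Sum>i\<le>m. (cmod (\<Sum>j | A i j \<noteq> 0. A i j * ell2_nth x j))\<^sup>2)
        \<le> N * C\<^sup>2 * (N * suminf u)" for m
    proof -
      have "(\<Sum>i\<le>m. (cmod (\<Sum>j | A i j \<noteq> 0. A i j * ell2_nth x j))\<^sup>2)
          \<le> (\<Sum>i\<le>m. N * C\<^sup>2 * (\<Sum>j | A i j \<noteq> 0. u j))"
        by (intro sum_mono entry)
      also have "\<dots> = N * C\<^sup>2 * (\<Sum>i<Suc m. \<Sum>j | A i j \<noteq> 0. u j)"
        by (simp add: sum_distrib_left lessThan_Suc_atMost)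
      also have "\<dots> \<le> N * C\<^sup>2 * (N * suminf u)"
        by (intro mult_left_mono partial) simp
      finally show ?thesis .
    qed
  qed simp
  then show ?thesis by (simp add: matrix_op_def Abs_ell2_inverse)
qed

lemma pushforward_apply: "inj_on f D \<Longrightarrow> m \<in> D \<Longrightarrow> pushforward D f \<alpha> (f m) = \<alpha> m"
  by (simp add: pushforward_def)

lemma pushforward_outside: "n \<notin> f ` D \<Longrightarrow> pushforward D f \<alpha> n = 0"
  by (simp add: pushforward_def)

lemma symmetric_ideal_bij:
  assumes "symmetric_ideal S" "bij g"
  shows "\<alpha> \<circ> g \<in> S \<longleftrightarrow> \<alpha> \<in> S"
proof -
  have comp: "\<beta> \<circ> h \<in> S" if "\<beta> \<in> S" "bij h" for \<beta> h
  proof -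
    have "pushforward UNIV (inv_into UNIV h) \<beta> = \<beta> \<circ> h"
    proof
      fix n
      have "pushforward UNIV (inv_into UNIV h) \<beta> (inv_into UNIV h (h n)) = \<beta> (h n)"
        using that by (intro pushforward_apply) (auto simp: bij_imp_bij_inv bij_is_inj)
      then show "pushforward UNIV (inv_into UNIV h) \<beta> n = (\<beta> \<circ> h) n"
        using that by (simp add: bij_is_inj)
    qed
    moreover have "inj (inv_into UNIV h)" using that by (simp add: bij_imp_bij_inv bij_is_inj)
    moreover have "\<forall>D f. inj_on f D \<longrightarrow> (\<forall>\<alpha>\<in>S. pushforward D f \<alpha> \<in> S)"
      using assms(1) by (simp add: symmetric_ideal_def)
    ultimately show ?thesis using that(1) by fastforce
  qed
  show ?thesis
  proof
    assume "\<alpha> \<circ> g \<in> S"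
    from comp[OF this bij_imp_bij_inv[OF assms(2)]] show "\<alpha> \<in> S"
      using assms(2) by (simp add: comp_assoc bij_is_surj surj_iff[THEN iffD1])
  qed (rule comp[OF _ assms(2)])
qed

lemma I_ideal_bij:
  assumes "symmetric_ideal S" "bij (g :: nat \<Rightarrow> nat \<times> nat)"
  shows "I_ideal S = {A \<in> carrier \<Gamma>\<^sup>\<infinity>. (\<lambda>n. case_prod A (g n)) \<in> S}"
proof -
  have "bij (prod_encode \<circ> g)"
    using assms(2) by (intro bij_comp bij_prod_encode)
  from symmetric_ideal_bij[OF assms(1) this, of "case_prod A \<circ> prod_decode" for A]
  show ?thesis by (simp add: I_ideal_def comp_def)
qed

end

theory Submission
  imports Defs
begin

text \<open>
  Modulo \<open>[\<Gamma>\<^sup>\<infinity>, I\<^sub>S]\<close> every matrix of \<open>I\<^sub>S\<close> is equivalent to its diagonal: colour the graph of nonzero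
  entries with finitely many colours and take commutators with the colour projections. Modulo
  \<open>[\<B>, J\<^sub>S]\<close> every operator of \<open>J\<^sub>S\<close> is equivalent to a diagonal one with entries in \<open>S\<close>: if \<open>S\<close> consists
  of null sequences, diagonalise the compact real and imaginary parts; otherwise \<open>S\<close> is all of
  \<open>\<ell>\<^sup>\<infinity>\<close> and \<open>\<B> = [\<B>, \<B>]\<close> by an infinite repetition argument. It remains to see that a diagonal
  operator in \<open>[\<B>, J\<^sub>S]\<close> already comes from \<open>[\<Gamma>\<^sup>\<infinity>, I\<^sub>S]\<close>.

  After a rearrangement, an identity \<open>diag \<beta> = \<Sum>[Y, T]\<close> with \<open>T \<in> J\<^sub>S\<close> can be written as
  \<open>\<Sum> R D\<^sub>a L = 0\<close> with one decreasing sequence \<open>a\<close> of \<open>S\<close> and \<open>\<beta>\<^sub>j = a\<^sub>j \<Sum> (L R)\<^sub>j\<^sub>j\<close>. Cutting \<open>a\<close> at \<open>n\<close>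
  gives an operator of rank \<open>O(n)\<close> and norm \<open>O(a\<^sub>n)\<close> with trace \<open>\<Sum>\<^sub>j\<^sub><\<^sub>n \<beta>\<^sub>j\<close>, so that
  \<open>\<bar>\<Sum>\<^sub>j\<^sub><\<^sub>n \<beta>\<^sub>j\<bar> = O(n a\<^sub>n)\<close>. Conversely, this estimate allows one to write \<open>\<beta>\<close> as a finite sum of
  sequences \<open>y - f\<^sub>* y\<close> with \<open>y \<in> S\<close> and \<open>f\<close> a partial injection, and such a difference is a
  commutator in \<open>\<Gamma>\<^sup>\<infinity>\<close>. Sums over dyadic blocks are pushed down a binary tree; what remains has
  vanishing sums over the blocks, hence bounded partial sums after a rearrangement.
\<close>

section \<open>Bounded operators on the sequence space\<close>

text \<open>Operators in J_S need not have a trace, so membership of diag \<beta> in [\<B>, J_S]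
  cannot be tested by a single number. The substitute is the sequence of formal trace terms of a
  factorisation. Passing from Y T to T Y moves Y from one factor to the other and leaves every term
  unchanged, so a sum of commutators has a factorisation with all terms zero, whereas diag \<beta>
  has an obvious one with terms \<beta>, rearranged. The two may be compared only over the same
  sequence a, and they differ by a factorisation of the zero operator. Truncation replaces its
  infinite formal trace by honest finite ones. The rank O(n) arises because each of the finitely
  many pairs (R, L) contributes n coordinates.

  Constant factors in ranks and indices turn up throughout. They are harmless because S is stable
  under repeating every entry k times.\<close>

lemmas ell2_rep_eqs = scaleC_ell2.rep_eq plus_ell2.rep_eq minus_ell2.rep_eq uminus_ell2.rep_eq
  zero_ell2.rep_eq scaleR_ell2.rep_eq

lemma scaleC_add_right: "c *\<^sub>C (x + y) = c *\<^sub>C x + c *\<^sub>C y"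
  and scaleC_diff_right: "c *\<^sub>C (x - y) = c *\<^sub>C x - c *\<^sub>C y"
  and scaleC_add_left: "(c + d) *\<^sub>C x = c *\<^sub>C x + d *\<^sub>C x"
  and scaleC_scaleC [simp]: "c *\<^sub>C d *\<^sub>C x = (c * d) *\<^sub>C x"
  and scaleC_zero_right [simp]: "c *\<^sub>C 0 = 0"
  and scaleC_zero_left [simp]: "0 *\<^sub>C x = 0"
  and scaleC_one [simp]: "1 *\<^sub>C x = x"
  and scaleC_minus_right: "c *\<^sub>C (- x) = - (c *\<^sub>C x)"
  and scaleC_minus_left: "(- c) *\<^sub>C x = - (c *\<^sub>C x)"
  and scaleC_of_real: "of_real r *\<^sub>C x = r *\<^sub>R x"
  by (rule ell2_eqI; simp add: ell2_rep_eqs algebra_simps scaleR_conv_of_real)+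

lemma norm_ell2_sq: "(norm x)\<^sup>2 = (\<Sum>n. (cmod (ell2_nth x n))\<^sup>2)"
  unfolding norm_ell2_def by (simp add: suminf_nonneg ell2_summable)

lemma norm_scaleC [simp]: "norm (c *\<^sub>C x) = cmod c * norm x"
proof -
  have "(norm (c *\<^sub>C x))\<^sup>2 = (cmod c * norm x)\<^sup>2"
    unfolding power_mult_distrib norm_ell2_sq
    by (simp add: ell2_rep_eqs norm_mult power_mult_distrib suminf_mult ell2_summable)
  then show ?thesis by simp
qed

lemma sum_le_norm_ell2: "finite F \<Longrightarrow> (\<Sum>n\<in>F. (cmod (ell2_nth x n))\<^sup>2) \<le> (norm x)\<^sup>2"
  unfolding norm_ell2_sq by (rule sum_le_suminf) (auto simp: ell2_summable)

lemma ell2_nth_le_norm: "cmod (ell2_nth x n) \<le> norm x"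
  by (rule power2_le_imp_le) (use sum_le_norm_ell2[of "{n}" x] in simp_all)

text \<open>A uniform bound on finite partial sums yields both square summability and the norm
  estimate. Adjoints, weak limits, coefficient operators and infinite repetitions are all
  constructed through it.\<close>

lemma Abs_ell2_bounded:
  assumes "\<And>F. finite F \<Longrightarrow> (\<Sum>n\<in>F. (cmod (f n))\<^sup>2) \<le> B\<^sup>2" "B \<ge> 0"
  shows "ell2_nth (Abs_ell2 f) = f" "norm (Abs_ell2 f) \<le> B"
proof -
  have s: "summable (\<lambda>n. (cmod (f n))\<^sup>2)"
    by (rule bounded_imp_summable[where B = "B\<^sup>2"]) (use assms(1) in auto)
  then show *: "ell2_nth (Abs_ell2 f) = f" by (simp add: Abs_ell2_inverse)
  have "(norm (Abs_ell2 f))\<^sup>2 \<le> B\<^sup>2"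
    unfolding norm_ell2_sq * by (rule suminf_le_const[OF s]) (use assms(1) in auto)
  then show "norm (Abs_ell2 f) \<le> B" using assms(2) by (rule power2_le_imp_le)
qed

lemma norm_ell2_le:
  assumes "\<And>F. finite F \<Longrightarrow> (\<Sum>n\<in>F. (cmod (ell2_nth x n))\<^sup>2) \<le> B\<^sup>2" "B \<ge> 0"
  shows "norm x \<le> B"
  using Abs_ell2_bounded(2)[OF assms] by (simp add: ell2_nth_inverse)

text \<open>The inner product of the type class is only the real part of the Hermitian form. Since
  Im w = Re (-i w) and the form is conjugate linear in \<open>x\<close>, its imaginary part is the
  pairing of i x with \<open>y\<close>.\<close>

definition cinner :: "ell2 \<Rightarrow> ell2 \<Rightarrow> complex"
  where "cinner x y = Complex (x \<bullet> y) ((\<i> *\<^sub>C x) \<bullet> y)"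

lemma inner_scaleC_i: "x \<bullet> (\<i> *\<^sub>C y) = - ((\<i> *\<^sub>C x) \<bullet> y)" "(\<i> *\<^sub>C x) \<bullet> (\<i> *\<^sub>C y) = x \<bullet> y"
proof -
  show "(\<i> *\<^sub>C x) \<bullet> (\<i> *\<^sub>C y) = x \<bullet> y" for x y
    by (simp add: inner_ell2_def ell2_rep_eqs inner_complex_def add.commute)
  from this[of "\<i> *\<^sub>C x" y] show "x \<bullet> (\<i> *\<^sub>C y) = - ((\<i> *\<^sub>C x) \<bullet> y)"
    by (simp add: scaleC_minus_left inner_minus_left)
qed

lemma scaleC_Complex: "c *\<^sub>C x = Re c *\<^sub>R x + Im c *\<^sub>R (\<i> *\<^sub>C x)"
  by (rule ell2_eqI) (simp add: ell2_rep_eqs complex_eq_iff)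

lemma cinner_add_left: "cinner (x + y) z = cinner x z + cinner y z"
  and cinner_add_right: "cinner x (y + z) = cinner x y + cinner x z"
  and cinner_diff_left: "cinner (x - y) z = cinner x z - cinner y z"
  and cinner_diff_right: "cinner x (y - z) = cinner x y - cinner x z"
  and cinner_zero [simp]: "cinner 0 x = 0" "cinner x 0 = 0"
  by (simp_all add: cinner_def scaleC_add_right scaleC_diff_right inner_simps complex_eq_iff)

lemma cinner_scaleC_right [simp]: "cinner x (c *\<^sub>C y) = c * cinner x y"
  by (subst scaleC_Complex) (simp add: cinner_def inner_simps inner_scaleC_i complex_eq_iff scaleC_minus_left)

lemma cnj_cinner [simp]: "cnj (cinner x y) = cinner y x"
  by (simp add: cinner_def complex_eq_iff inner_commute[of y] inner_scaleC_i)
    (simp add: inner_commute[of "\<i> *\<^sub>C y"] inner_scaleC_i)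

lemma cinner_scaleC_left [simp]: "cinner (c *\<^sub>C x) y = cnj c * cinner x y"
  by (metis cinner_scaleC_right cnj_cinner complex_cnj_mult)

lemma cinner_sum_right: "cinner x (sum f F) = (\<Sum>n\<in>F. cinner x (f n))"
  by (induction F rule: infinite_finite_induct) (auto simp: cinner_add_right)

lemma cinner_sum_left: "cinner (sum f F) x = (\<Sum>n\<in>F. cinner (f n) x)"
  by (induction F rule: infinite_finite_induct) (auto simp: cinner_add_left)

lemma cinner_self: "cinner x x = of_real ((norm x)\<^sup>2)"
proof -
  have "Im (cinner x x) = 0" using arg_cong[OF cnj_cinner[of x x], of Im] by (simp del: cnj_cinner)
  then show ?thesis by (simp add: complex_eq_iff) (simp add: cinner_def dot_square_norm)
qed

lemma Re_cinner: "Re (cinner x y) = x \<bullet> y"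
  by (simp add: cinner_def)

lemma norm_cinner: "cmod (cinner x y) \<le> norm x * norm y"
proof (cases "cinner x y = 0")
  case False
  define c where "c = cinner x y"
  \<comment> \<open>Multiplying \<open>y\<close> by the conjugate of \<open>c\<close> makes the
    value real and nonnegative, so that the real Cauchy-Schwarz inequality applies.\<close>
  have "(cmod c)\<^sup>2 = Re (cinner x (cnj c *\<^sub>C y))"
    unfolding cinner_scaleC_right c_def[symmetric] cmod_power2 by (simp add: power2_eq_square)
  also have "\<dots> \<le> norm x * norm (cnj c *\<^sub>C y)"
    unfolding Re_cinner by (rule norm_cauchy_schwarz)
  finally have "cmod c * cmod c \<le> cmod c * (norm x * norm y)" by (simp add: power2_eq_square mult_ac)
  then show ?thesis using False by (simp add: c_def)
qed simp

lemma cinner_eqI: "(\<And>z. cinner z x = cinner z y) \<Longrightarrow> x = y"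
  by (metis Re_cinner inner_commute vector_eq_rdot)

lemma bounded_linear_cinner_right: "bounded_linear (cinner x)"
  by (rule bounded_linear_intro[where K = "norm x"])
    (auto simp: cinner_add_right norm_cinner mult.commute[of _ "norm x"] scaleR_conv_of_real
      simp flip: scaleC_of_real)

section \<open>The standard orthonormal basis\<close>

lift_definition unit_vec :: "nat \<Rightarrow> ell2" is "\<lambda>n m. if m = n then 1 else 0"
  by (rule summable_finite[where N = "{n}" for n]) auto

lemma ell2_nth_sum: "ell2_nth (sum f F) n = (\<Sum>k\<in>F. ell2_nth (f k) n)"
  by (induction F rule: infinite_finite_induct) (auto simp: ell2_rep_eqs)

lemma cinner_unit_vec: "cinner (unit_vec n) x = ell2_nth x n"
proof -
  have 1: "unit_vec n \<bullet> x = Re (ell2_nth x n)" for x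
  proof -
    have "unit_vec n \<bullet> x = (\<Sum>m\<in>{n}. ell2_nth (unit_vec n) m \<bullet> ell2_nth x m)"
      unfolding inner_ell2_def by (rule suminf_finite) (auto simp: unit_vec.rep_eq)
    then show ?thesis by (simp add: unit_vec.rep_eq inner_complex_def)
  qed
  have "cinner (unit_vec n) x = Complex (unit_vec n \<bullet> x) (- (unit_vec n \<bullet> (\<i> *\<^sub>C x)))"
    by (simp add: cinner_def inner_scaleC_i)
  then show ?thesis by (simp add: 1 ell2_rep_eqs complex_eq_iff)
qed

lemma norm_unit_vec [simp]: "norm (unit_vec n) = 1"
proof -
  have "of_real ((norm (unit_vec n))\<^sup>2) = (1 :: complex)"
    unfolding cinner_self[symmetric] cinner_unit_vec by (simp add: unit_vec.rep_eq)
  then have "(norm (unit_vec n))\<^sup>2 = 1" by (simp only: of_real_eq_1_iff)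
  then show ?thesis using norm_ge_zero[of "unit_vec n"] unfolding power2_eq_1_iff by linarith
qed

lemma unit_vec_sums: "(\<lambda>n. ell2_nth x n *\<^sub>C unit_vec n) sums x"
  unfolding sums_def
proof (subst tendsto_dist_iff, rule tendsto_sandwich[OF _ _ tendsto_const])
  \<comment> \<open>The squared norm of the tail from \<open>n\<close> on, which dominates the
    squared distance to the partial sum.\<close>
  define t where "t n = (norm x)\<^sup>2 - (\<Sum>k<n. (cmod (ell2_nth x k))\<^sup>2)" for n
  have "t \<longlonglongrightarrow> (norm x)\<^sup>2 - (norm x)\<^sup>2" unfolding t_def norm_ell2_sq
    by (intro tendsto_diff tendsto_const summable_LIMSEQ ell2_summable)
  from tendsto_real_sqrt[OF this] show "(\<lambda>n. sqrt (t n)) \<longlonglongrightarrow> 0" by simp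
  show "\<forall>\<^sub>F n in sequentially. dist (\<Sum>k<n. ell2_nth x k *\<^sub>C unit_vec k) x \<le> sqrt (t n)"
  proof (intro always_eventually allI)
    fix n
    define s where "s = (\<Sum>k<n. ell2_nth x k *\<^sub>C unit_vec k)"
    have s: "ell2_nth s k = (if k < n then ell2_nth x k else 0)" for k
    proof -
      have "ell2_nth s k = (\<Sum>j<n. if j = k then ell2_nth x j else 0)"
        unfolding s_def ell2_nth_sum by (intro sum.cong) (auto simp: ell2_rep_eqs unit_vec.rep_eq)
      then show ?thesis by simp
    qed
    have t0: "t n \<ge> 0" unfolding t_def using sum_le_norm_ell2[of "{..<n}" x] by simp
    have "norm (s - x) \<le> sqrt (t n)"
    proof (rule norm_ell2_le)
      fix F :: "nat set" assume F: "finite F"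
      have "(\<Sum>k\<in>F. (cmod (ell2_nth (s - x) k))\<^sup>2) = (\<Sum>k\<in>F - {..<n}. (cmod (ell2_nth x k))\<^sup>2)"
        by (rule sum.mono_neutral_cong_right) (auto simp: F ell2_rep_eqs s)
      moreover have "(\<Sum>k\<in>F - {..<n}. (cmod (ell2_nth x k))\<^sup>2) + (\<Sum>k<n. (cmod (ell2_nth x k))\<^sup>2)
          = (\<Sum>k\<in>(F - {..<n}) \<union> {..<n}. (cmod (ell2_nth x k))\<^sup>2)"
        by (rule sum.union_disjoint[symmetric]) (auto simp: F)
      moreover have "\<dots> \<le> (norm x)\<^sup>2" by (rule sum_le_norm_ell2) (auto simp: F)
      ultimately show "(\<Sum>k\<in>F. (cmod (ell2_nth (s - x) k))\<^sup>2) \<le> (sqrt (t n))\<^sup>2"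
        using t0 by (simp add: t_def)
    qed (use t0 in simp)
    then show "dist (\<Sum>k<n. ell2_nth x k *\<^sub>C unit_vec k) x \<le> sqrt (t n)"
      by (simp add: s_def dist_norm)
  qed
qed auto

section \<open>The ring of bounded operators\<close>

lemma B_iff: "T \<in> carrier \<B> \<longleftrightarrow> bounded_linear T \<and> (\<forall>c x. T (c *\<^sub>C x) = c *\<^sub>C T x)"
  by (simp add: bounded_ops_def)

lemma B_ops [simp]: "T \<otimes>\<^bsub>\<B>\<^esub> U = T \<circ> U" "T \<oplus>\<^bsub>\<B>\<^esub> U = (\<lambda>x. T x + U x)" "\<one>\<^bsub>\<B>\<^esub> = id" "\<zero>\<^bsub>\<B>\<^esub> = (\<lambda>_. 0)"
  by (simp_all add: bounded_ops_def)

lemma B_bounded_linear: "T \<in> carrier \<B> \<Longrightarrow> bounded_linear T"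
  and B_scaleC: "T \<in> carrier \<B> \<Longrightarrow> T (c *\<^sub>C x) = c *\<^sub>C T x"
  and B_add: "T \<in> carrier \<B> \<Longrightarrow> T (x + y) = T x + T y"
  and B_diff: "T \<in> carrier \<B> \<Longrightarrow> T (x - y) = T x - T y"
  and B_minus: "T \<in> carrier \<B> \<Longrightarrow> T (- x) = - T x"
  and B_zero: "T \<in> carrier \<B> \<Longrightarrow> T 0 = 0"
  and B_sum: "T \<in> carrier \<B> \<Longrightarrow> T (sum f F) = (\<Sum>k\<in>F. T (f k))"
  using linear_sum[of T f F] by (auto simp: B_iff linear_simps bounded_linear.linear)

lemma B_comp: "T \<in> carrier \<B> \<Longrightarrow> U \<in> carrier \<B> \<Longrightarrow> T \<circ> U \<in> carrier \<B>"
  by (auto simp: B_iff bounded_linear_compose comp_def)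

lemma B_plus: "T \<in> carrier \<B> \<Longrightarrow> U \<in> carrier \<B> \<Longrightarrow> (\<lambda>x. T x + U x) \<in> carrier \<B>"
  by (auto simp: B_iff bounded_linear_add scaleC_add_right)

lemma B_uminus: "T \<in> carrier \<B> \<Longrightarrow> (\<lambda>x. - T x) \<in> carrier \<B>"
  by (auto simp: B_iff bounded_linear_minus scaleC_minus_right)

lemma B_scale: "T \<in> carrier \<B> \<Longrightarrow> (\<lambda>x. c *\<^sub>C T x) \<in> carrier \<B>"
proof -
  have "bounded_linear (\<lambda>x. c *\<^sub>C x)"
    by (rule bounded_linear_intro[where K = "cmod c"])
      (auto simp: scaleC_add_right mult.commute simp flip: scaleC_of_real)
  from bounded_linear_compose[OF this] show "T \<in> carrier \<B> \<Longrightarrow> ?thesis" by (auto simp: B_iff mult.commute)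
qed

lemma B_id: "id \<in> carrier \<B>" "(\<lambda>x. x) \<in> carrier \<B>"
  by (auto simp: B_iff bounded_linear_ident id_def)

lemma B_zero_op: "(\<lambda>x. 0) \<in> carrier \<B>"
  by (auto simp: B_iff)

lemma B_a_inv: assumes "T \<in> carrier \<B>" shows "\<ominus>\<^bsub>\<B>\<^esub> T = (\<lambda>x. - T x)"
proof -
  interpret ring \<B> by (rule ring_bounded_ops)
  show ?thesis by (rule minus_equality) (use assms in \<open>auto simp: B_uminus\<close>)
qed

lemma B_a_minus:
  assumes "T \<in> carrier \<B>" "U \<in> carrier \<B>" shows "T \<ominus>\<^bsub>\<B>\<^esub> U = (\<lambda>x. T x - U x)"
  using assms by (simp add: a_minus_def B_a_inv)

lemma B_minus_op: "T \<in> carrier \<B> \<Longrightarrow> U \<in> carrier \<B> \<Longrightarrow> (\<lambda>x. T x - U x) \<in> carrier \<B>"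
  using B_plus[OF _ B_uminus, of T U] by simp

lemma B_intro:
  assumes "\<And>x y. T (x + y) = T x + T y" "\<And>c x. T (c *\<^sub>C x) = c *\<^sub>C T x"
    "\<And>x. norm (T x) \<le> K * norm x"
  shows "T \<in> carrier \<B>"
  unfolding B_iff
  by (intro conjI allI assms(2) bounded_linear_intro[where K = K] assms(1))
    (simp_all add: assms(2,3) mult.commute[of _ K] flip: scaleC_of_real)

lemma B_bound: assumes "T \<in> carrier \<B>" obtains K where "K > 0" "\<And>x. norm (T x) \<le> K * norm x"
proof -
  obtain K where "K > 0" "\<And>x. norm (T x) \<le> norm x * K"
    using bounded_linear.pos_bounded[OF B_bounded_linear[OF assms]] by blast
  then show thesis using that[of K] by (simp add: mult.commute)
qed

lemma B_eqI:
  assumes "T \<in> carrier \<B>" "U \<in> carrier \<B>" "\<And>n. T (unit_vec n) = U (unit_vec n)"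
  shows "T = U"
proof
  fix x
  have "(\<lambda>n. V (ell2_nth x n *\<^sub>C unit_vec n)) sums V x" if "V \<in> carrier \<B>" for V
    using bounded_linear.sums[OF B_bounded_linear[OF that] unit_vec_sums] .
  from this[OF assms(1)] this[OF assms(2)] show "T x = U x"
    unfolding B_scaleC[OF assms(1)] B_scaleC[OF assms(2)] assms(3) by (rule sums_unique2)
qed

text \<open>The entries are forced: coordinate n of the adjoint at \<open>y\<close> is its pairing
  with \<open>unit_vec n\<close>.\<close>

definition adj :: "(ell2 \<Rightarrow> ell2) \<Rightarrow> ell2 \<Rightarrow> ell2"
  where "adj T y = Abs_ell2 (\<lambda>n. cinner (T (unit_vec n)) y)"

lemma
  assumes T: "T \<in> carrier \<B>"
  shows adj_in_B: "adj T \<in> carrier \<B>"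
    and cinner_adj: "cinner x (adj T y) = cinner (T x) y"
proof -
  obtain K where K: "K > 0" "\<And>x. norm (T x) \<le> K * norm x" using B_bound[OF T] by blast
  have b: "(\<Sum>n\<in>F. (cmod (cinner (T (unit_vec n)) y))\<^sup>2) \<le> (K * norm y)\<^sup>2" if F: "finite F" for F y
  proof -
    define c where "c n = cinner (T (unit_vec n)) y" for n
    \<comment> \<open>Test vector: the partial sum to be estimated is both the squared norm of
      \<open>z\<close> and \<open>cinner (T z) y\<close>, which is at most
      \<open>K * norm z * norm y\<close>.\<close>
    define z where "z = (\<Sum>n\<in>F. c n *\<^sub>C unit_vec n)"
    define s where "s = (\<Sum>n\<in>F. (cmod (c n))\<^sup>2)"
    have s0: "s \<ge> 0" by (simp add: s_def sum_nonneg)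
    have cc: "cnj (c n) * c n = of_real ((cmod (c n))\<^sup>2)" for n
      by (simp only: complex_norm_square mult.commute)
    have "cinner z z = (\<Sum>n\<in>F. cnj (c n) * ell2_nth z n)"
      by (subst z_def) (simp add: cinner_sum_left cinner_unit_vec)
    also have "\<dots> = (\<Sum>n\<in>F. cnj (c n) * c n)"
    proof (rule sum.cong[OF refl])
      fix n assume "n \<in> F"
      have "ell2_nth z n = (\<Sum>k\<in>F. if k = n then c k else 0)"
        unfolding z_def ell2_nth_sum by (intro sum.cong) (auto simp: ell2_rep_eqs unit_vec.rep_eq)
      then show "cnj (c n) * ell2_nth z n = cnj (c n) * c n" using F \<open>n \<in> F\<close> by simp
    qed
    finally have "of_real ((norm z)\<^sup>2) = complex_of_real s"
      unfolding s_def cinner_self cc of_real_sum .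
    then have nz: "(norm z)\<^sup>2 = s" by (simp only: of_real_eq_iff)
    have "cinner (T z) y = (\<Sum>n\<in>F. cnj (c n) * c n)"
      unfolding z_def B_sum[OF T] cinner_sum_left B_scaleC[OF T] cinner_scaleC_left c_def ..
    also have "\<dots> = of_real s" unfolding s_def cc of_real_sum ..
    finally have "s = cmod (cinner (T z) y)" using s0 by simp
    also have "\<dots> \<le> norm (T z) * norm y" by (rule norm_cinner)
    also have "\<dots> \<le> K * norm z * norm y" by (intro mult_right_mono K) auto
    finally have "norm z * norm z \<le> norm z * (K * norm y)" using nz by (simp add: power2_eq_square mult_ac)
    then have "norm z \<le> K * norm y" using K(1) by (cases "norm z = 0") auto
    then have "(norm z)\<^sup>2 \<le> (K * norm y)\<^sup>2" by (intro power_mono) auto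
    then show ?thesis unfolding nz by (simp add: s_def c_def)
  qed
  have nn: "K * norm y \<ge> 0" for y :: ell2 using K(1) by simp
  note n = Abs_ell2_bounded[OF b nn]
  have nth: "ell2_nth (adj T y) = (\<lambda>n. cinner (T (unit_vec n)) y)" for y
    unfolding adj_def by (rule n)
  show A: "adj T \<in> carrier \<B>"
  proof (rule B_intro[where K = K])
    show "norm (adj T y) \<le> K * norm y" for y unfolding adj_def by (rule n)
  qed (rule ell2_eqI; simp add: ell2_rep_eqs nth cinner_add_right)+
  have L: "(\<lambda>n. cinner v (V (ell2_nth x n *\<^sub>C unit_vec n))) sums cinner v (V x)"
    if "V \<in> carrier \<B>" for V v x
    using bounded_linear.sums[OF bounded_linear_compose[OF bounded_linear_cinner_right B_bounded_linear[OF that]] unit_vec_sums] .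
  have "(\<lambda>n. cnj (cinner (adj T y) (ell2_nth x n *\<^sub>C unit_vec n))) sums cinner x (adj T y)"
    using L[OF B_id(2), of "adj T y" x, THEN sums_cnj[THEN iffD2]] by simp
  moreover have "(\<lambda>n. cnj (cinner y (T (ell2_nth x n *\<^sub>C unit_vec n)))) sums cinner (T x) y"
    using L[OF T, of y x, THEN sums_cnj[THEN iffD2]] by simp
  moreover have "cnj (cinner (adj T y) (ell2_nth x n *\<^sub>C unit_vec n))
      = cnj (cinner y (T (ell2_nth x n *\<^sub>C unit_vec n)))" for n
    by (simp add: B_scaleC[OF T] cinner_unit_vec nth)
  ultimately show "cinner x (adj T y) = cinner (T x) y" by (simp only: sums_unique2)
qed

section \<open>Symmetric ideals of bounded sequences\<close>

lemma linf_simps [simp]: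
  "\<alpha> \<otimes>\<^bsub>linf\<^esub> \<beta> = (\<lambda>n. \<alpha> n * \<beta> n)" "\<alpha> \<oplus>\<^bsub>linf\<^esub> \<beta> = (\<lambda>n. \<alpha> n + \<beta> n)" "\<zero>\<^bsub>linf\<^esub> = (\<lambda>_. 0)"
  by (simp_all add: linf_def)

lemma linf_iff: "\<alpha> \<in> carrier linf \<longleftrightarrow> (\<exists>C. \<forall>n. cmod (\<alpha> n) \<le> C)"
  by (auto simp: linf_def bounded_iff)

locale symmetric_seq_ideal =
  fixes S assumes symmetric: "symmetric_ideal S"
begin

lemma ideal: "ideal S linf"
  using symmetric by (simp add: symmetric_ideal_def)

lemma S_linf: "\<alpha> \<in> S \<Longrightarrow> \<alpha> \<in> carrier linf"
  using ideal by (meson additive_subgroup.a_Hcarr ideal.axioms(1))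

lemma S_bounded: assumes "\<alpha> \<in> S" obtains C where "\<And>n. cmod (\<alpha> n) \<le> C"
  using S_linf[OF assms] by (auto simp: linf_iff)

lemma S_zero: "(\<lambda>_. 0) \<in> S"
  using additive_subgroup.zero_closed[OF ideal.axioms(1)[OF ideal]] by simp

lemma S_add: "\<alpha> \<in> S \<Longrightarrow> \<beta> \<in> S \<Longrightarrow> (\<lambda>n. \<alpha> n + \<beta> n) \<in> S"
  using additive_subgroup.a_closed[OF ideal.axioms(1)[OF ideal], of \<alpha> \<beta>] by simp

lemma S_mult: "\<alpha> \<in> S \<Longrightarrow> \<beta> \<in> carrier linf \<Longrightarrow> (\<lambda>n. \<beta> n * \<alpha> n) \<in> S"
  using ideal.I_l_closed[OF ideal, of \<alpha> \<beta>] by simp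

lemma S_cmult: "\<alpha> \<in> S \<Longrightarrow> (\<lambda>n. c * \<alpha> n) \<in> S"
  by (rule S_mult) (auto simp: linf_iff)

lemma S_diff: "\<alpha> \<in> S \<Longrightarrow> \<beta> \<in> S \<Longrightarrow> (\<lambda>n. \<alpha> n - \<beta> n) \<in> S"
  using S_add[OF _ S_cmult[of \<beta> "-1"], of \<alpha>] by simp

lemma S_sum: "(\<And>k. k \<in> K \<Longrightarrow> f k \<in> S) \<Longrightarrow> (\<lambda>n. \<Sum>k\<in>K. f k n) \<in> S"
  by (induction K rule: infinite_finite_induct) (auto intro: S_add S_zero)

text \<open>The quotient of \<beta> by \<alpha> is a bounded multiplier: where \<alpha> vanishes, so
  does \<beta>, in accordance with x / 0 = 0.\<close>

lemma S_dominated: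
  assumes "\<alpha> \<in> S" "\<And>n. cmod (\<beta> n) \<le> C * cmod (\<alpha> n)"
  shows "\<beta> \<in> S"
proof -
  have "cmod (\<beta> n / \<alpha> n) \<le> \<bar>C\<bar>" for n
  proof (cases "\<alpha> n = 0")
    case False
    have "C * cmod (\<alpha> n) \<le> \<bar>C\<bar> * cmod (\<alpha> n)" by (intro mult_right_mono) auto
    with assms(2)[of n] have "cmod (\<beta> n) \<le> \<bar>C\<bar> * cmod (\<alpha> n)" by (rule order_trans)
    then show ?thesis using False by (simp add: norm_divide divide_le_eq)
  qed simp
  then have "(\<lambda>n. (\<beta> n / \<alpha> n) * \<alpha> n) \<in> S" by (intro S_mult assms) (auto simp: linf_iff)
  moreover have "\<beta> n / \<alpha> n * \<alpha> n = \<beta> n" for n using assms(2)[of n] by (cases "\<alpha> n = 0") auto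
  ultimately show ?thesis by simp
qed

lemma S_pushforward: "\<alpha> \<in> S \<Longrightarrow> inj_on f D \<Longrightarrow> pushforward D f \<alpha> \<in> S"
  using symmetric by (simp add: symmetric_ideal_def)

text \<open>Pulling back along an injection is pushing forward along its inverse.\<close>

lemma S_reindex:
  assumes "\<alpha> \<in> S" "inj_on \<phi> X"
  shows "(\<lambda>n. if n \<in> X then \<alpha> (\<phi> n) else 0) \<in> S"
proof -
  have i: "inj_on (inv_into X \<phi>) (\<phi> ` X)" by (rule inj_on_inv_into) auto
  have "pushforward (\<phi> ` X) (inv_into X \<phi>) \<alpha> n = (if n \<in> X then \<alpha> (\<phi> n) else 0)" for n
  proof (cases "n \<in> X")
    case True
    then show ?thesis using pushforward_apply[OF i, of "\<phi> n" \<alpha>] assms(2) by simp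
  next
    case False
    then show ?thesis using assms(2) by (auto simp: pushforward_def)
  qed
  then show ?thesis using S_pushforward[OF assms(1) i] by presburger
qed

text \<open>On each residue class modulo k the map n div k is injective, so the repetition is a sum
  of k pullbacks. This is what absorbs constant factors in indices.\<close>

lemma S_div:
  assumes "\<alpha> \<in> S" "k > 0" shows "(\<lambda>n. \<alpha> (n div k)) \<in> S"
proof -
  have "(\<lambda>n. if n \<in> {n. n mod k = r} then \<alpha> (n div k) else 0) \<in> S" for r
    by (rule S_reindex[OF assms(1)]) (auto simp: inj_on_def, metis div_mult_mod_eq)
  from S_sum[of "{..<k}" "\<lambda>r n. if n \<in> {n. n mod k = r} then \<alpha> (n div k) else 0", OF this]
  show ?thesis using assms(2) by simp
qed

end

text \<open>The sequences that die when \<open>S\<close> is divided by the action of partial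
  injections. As \<alpha> vanishes off \<open>D\<close>, the pushforward moves entries without
  losing any. In the end, \<beta> in \<open>S\<close> belongs to this set exactly when
  \<open>diag_op \<beta>\<close> lies in [\<B>, J_S].\<close>

inductive_set null_seqs :: "(nat \<Rightarrow> complex) set \<Rightarrow> (nat \<Rightarrow> complex) set" for S where
  zero: "(\<lambda>_. 0) \<in> null_seqs S"
| add: "\<alpha> \<in> null_seqs S \<Longrightarrow> \<beta> \<in> null_seqs S \<Longrightarrow> (\<lambda>n. \<alpha> n + \<beta> n) \<in> null_seqs S"
| move: "\<alpha> \<in> S \<Longrightarrow> inj_on f D \<Longrightarrow> (\<And>n. n \<notin> D \<Longrightarrow> \<alpha> n = 0) \<Longrightarrow>
    (\<lambda>n. \<alpha> n - pushforward D f \<alpha> n) \<in> null_seqs S"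

text \<open>Greedy choice: as long as the remaining numbers sum to minus the current partial sum,
  one of them does not have the sign of the partial sum.\<close>

lemma bounded_rearrangement:
  fixes x :: "'a \<Rightarrow> real"
  assumes "finite E" "\<bar>s\<bar> \<le> B" "s + sum x E = 0" "\<And>e. e \<in> E \<Longrightarrow> \<bar>x e\<bar> \<le> B"
  shows "\<exists>xs. distinct xs \<and> set xs = E \<and> (\<forall>j. \<bar>s + sum_list (map x (take j xs))\<bar> \<le> B)"
  using assms
proof (induction "card E" arbitrary: E s)
  case 0
  then show ?case by auto
next
  case (Suc n)
  have ne: "E \<noteq> {}" using Suc.hyps by auto
  obtain e where e: "e \<in> E" "s \<le> 0 \<and> x e \<ge> 0 \<or> s \<ge> 0 \<and> x e \<le> 0"
  proof (cases "s \<le> 0")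
    case True
    have "\<exists>e\<in>E. x e \<ge> 0"
    proof (rule ccontr)
      assume "\<not> ?thesis"
      then have "0 < (\<Sum>e\<in>E. - x e)" using ne Suc.prems by (intro sum_pos) (auto simp: not_le)
      then have "sum x E < 0" by (simp add: sum_negf)
      then show False using True Suc.prems by linarith
    qed
    then show ?thesis using that True by auto
  next
    case False
    have "\<exists>e\<in>E. x e \<le> 0"
    proof (rule ccontr)
      assume "\<not> ?thesis"
      then have "sum x E > 0" using ne Suc.prems by (intro sum_pos) (auto simp: not_le)
      then show False using False Suc.prems by linarith
    qed
    then show ?thesis using that False by auto
  qed
  have s': "\<bar>s + x e\<bar> \<le> B" using e Suc.prems(2) Suc.prems(4)[OF e(1)] by linarith
  have "s + x e + sum x (E - {e}) = 0"
    using sum.remove[OF Suc.prems(1) e(1), of x] Suc.prems(3) by simp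
  moreover have "n = card (E - {e})" using Suc.hyps(2) Suc.prems(1) e(1) by simp
  ultimately obtain xs where
    xs: "distinct xs" "set xs = E - {e}" "\<And>j. \<bar>s + x e + sum_list (map x (take j xs))\<bar> \<le> B"
    using Suc.hyps(1)[of "E - {e}" "s + x e"] s' Suc.prems by auto
  have "\<bar>s + sum_list (map x (take j (e # xs)))\<bar> \<le> B" for j
    using xs(3)[of "j - 1"] Suc.prems(2) by (cases j) (auto simp: add.assoc)
  with xs e show ?case by (intro exI[of _ "e # xs"]) auto
qed

lemma block_index_eq:
  fixes m blk :: "nat \<Rightarrow> nat"
  assumes "mono m" "\<And>n. m (blk n) \<le> n" "\<And>n. n < m (Suc (blk n))" "m k \<le> n" "n < m (Suc k)"
  shows "blk n = k"
proof (rule antisym; rule ccontr)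
  assume "\<not> blk n \<le> k"
  then have "m (Suc k) \<le> m (blk n)" by (intro monoD[OF assms(1)]) auto
  then show False using assms(2)[of n] assms(5) by linarith
next
  assume "\<not> k \<le> blk n"
  then have "m (Suc (blk n)) \<le> m k" by (intro monoD[OF assms(1)]) auto
  then show False using assms(3)[of n] assms(4) by linarith
qed

section \<open>Sequences with small averages\<close>

context symmetric_seq_ideal
begin

lemma null_cmult: "\<alpha> \<in> null_seqs S \<Longrightarrow> (\<lambda>n. c * \<alpha> n) \<in> null_seqs S"
proof (induction rule: null_seqs.induct)
  case (move \<alpha> f D)
  have "(\<lambda>n. c * \<alpha> n - pushforward D f (\<lambda>n. c * \<alpha> n) n) \<in> null_seqs S"
    by (rule null_seqs.move) (use move in \<open>auto intro: S_cmult\<close>)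
  moreover have "pushforward D f (\<lambda>n. c * \<alpha> n) n = c * pushforward D f \<alpha> n" for n
    by (simp add: pushforward_def)
  ultimately show ?case by (simp add: right_diff_distrib)
qed (auto simp: distrib_left intro: null_seqs.intros)

text \<open>Write \<alpha> as (\<alpha> - f_* \<alpha>) + f_* \<alpha>. Thus the question may be
  decided after a rearrangement.\<close>

lemma null_if_pushforward_null:
  assumes "\<alpha> \<in> S" "inj_on f D" "\<And>n. n \<notin> D \<Longrightarrow> \<alpha> n = 0" "pushforward D f \<alpha> \<in> null_seqs S"
  shows "\<alpha> \<in> null_seqs S"
  using null_seqs.add[OF null_seqs.move[OF assms(1-3)] assms(4)] by simp

text \<open>A permutation \<pi> reorders each block so that partial sums stay within the bound of
  the block. The partial sums of x o \<pi> then give an element of \<open>S\<close>, and x o \<pi>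
  is its difference with its shift by one place.\<close>

lemma null_of_zero_block_sums:
  fixes x c :: "nat \<Rightarrow> real" and m blk :: "nat \<Rightarrow> nat"
  assumes m: "m 0 = 0" "mono m" and blk: "\<And>n. m (blk n) \<le> n" "\<And>n. n < m (Suc (blk n))"
    and x0: "\<And>k. sum x {m k..<m (Suc k)} = 0" and xc: "\<And>n. \<bar>x n\<bar> \<le> c (blk n)"
    and S: "(\<lambda>n. complex_of_real (c (blk n))) \<in> S"
  shows "(\<lambda>n. complex_of_real (x n)) \<in> null_seqs S"
proof -
  note blk_eq = block_index_eq[OF m(2) blk]
  \<comment> \<open>An empty block puts no sign condition on \<open>c k\<close>, hence the absolute
    value.\<close>
  have "\<exists>xs. distinct xs \<and> set xs = {m k..<m (Suc k)} \<and> (\<forall>j. \<bar>sum_list (map x (take j xs))\<bar> \<le> \<bar>c k\<bar>)" for k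
  proof -
    have "\<bar>x n\<bar> \<le> \<bar>c k\<bar>" if "n \<in> {m k..<m (Suc k)}" for n
      using xc[of n] blk_eq[of k n] that by auto
    from bounded_rearrangement[of "{m k..<m (Suc k)}" 0 "\<bar>c k\<bar>" x, OF _ _ _ this]
    show ?thesis using x0[of k] by simp
  qed
  then obtain xs where xs: "\<And>k. distinct (xs k)" "\<And>k. set (xs k) = {m k..<m (Suc k)}"
    and small: "\<And>j k. \<bar>sum_list (map x (take j (xs k)))\<bar> \<le> \<bar>c k\<bar>" by metis
  have len: "length (xs k) = m (Suc k) - m k" for k
    using distinct_card[OF xs(1)[of k]] xs(2)[of k] by simp
  define \<pi> where "\<pi> n = xs (blk n) ! (n - m (blk n))" for n
  have lt: "n - m (blk n) < length (xs (blk n))" for n using blk[of n] len by auto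
  have \<pi>_in: "\<pi> n \<in> {m (blk n)..<m (Suc (blk n))}" for n
    using nth_mem[OF lt[of n]] unfolding \<pi>_def xs(2) .
  have blk_\<pi>: "blk (\<pi> n) = blk n" for n using blk_eq \<pi>_in[of n] by auto
  have "inj \<pi>"
  proof (rule injI)
    fix n n' assume eq: "\<pi> n = \<pi> n'"
    then have b: "blk n = blk n'" using blk_\<pi> by metis
    have "n - m (blk n) = n' - m (blk n')"
      using eq lt[of n] lt[of n'] nth_eq_iff_index_eq[OF xs(1)[of "blk n"]] unfolding \<pi>_def b by metis
    then show "n = n'" using blk(1)[of n] blk(1)[of n'] b by simp
  qed
  have surj: "\<exists>n. p = \<pi> n" for p
  proof -
    have "p \<in> set (xs (blk p))" using blk[of p] xs(2) by simp
    then obtain j where j: "j < length (xs (blk p))" "xs (blk p) ! j = p" by (auto simp: in_set_conv_nth)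
    have "blk (m (blk p) + j) = blk p" by (rule blk_eq) (use j len in auto)
    then have "p = \<pi> (m (blk p) + j)" using j by (simp add: \<pi>_def)
    then show ?thesis ..
  qed
  define y where "y n = (\<Sum>i<n. x (\<pi> i))" for n
  have yk: "y (m k + j) = y (m k) + sum_list (map x (take j (xs k)))" if "j \<le> length (xs k)" for j k
    using that
  proof (induction j)
    case (Suc j)
    have "blk (m k + j) = k" by (rule blk_eq) (use Suc len in auto)
    then have "\<pi> (m k + j) = xs k ! j" by (simp add: \<pi>_def)
    then show ?case using Suc by (simp add: y_def take_Suc_conv_app_nth)
  qed simp
  have y0: "y (m k) = 0" for k
  proof (induction k)
    case (Suc k)
    have mk: "m k \<le> m (Suc k)" using m by (intro monoD[OF m(2)]) auto
    have "y (m (Suc k)) = sum_list (map x (xs k))" using yk[of "length (xs k)" k] Suc mk len[of k] by simp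
    also have "\<dots> = 0" using sum_list_distinct_conv_sum_set[OF xs(1)[of k], of x] x0[of k] xs(2)[of k] by simp
    finally show ?case .
  qed (simp add: m y_def)
  have ysmall: "\<bar>y (Suc n)\<bar> \<le> \<bar>c (blk n)\<bar>" for n
    using yk[of "Suc n - m (blk n)" "blk n"] y0[of "blk n"] small[of "Suc n - m (blk n)" "blk n"] lt[of n] blk[of n]
    by simp
  \<comment> \<open>With this offset the shift of \<open>z\<close> is \<open>y\<close> itself: the
    value \<open>y 0 = 0\<close> agrees with the default of the pushforward outside the range of
    \<open>Suc\<close>.\<close>
  define z where "z n = complex_of_real (y (Suc n))" for n
  have zS: "z \<in> S" by (rule S_dominated[OF S, of _ 1]) (simp add: z_def ysmall)
  have push: "pushforward UNIV Suc z n = complex_of_real (y n)" for n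
  proof (cases n)
    case 0 then show ?thesis by (simp add: pushforward_outside image_iff y_def)
  next
    case (Suc k) then show ?thesis by (simp add: pushforward_apply z_def)
  qed
  have "(\<lambda>n. z n - pushforward UNIV Suc z n) \<in> null_seqs S" by (rule null_seqs.move[OF zS]) auto
  then have n: "(\<lambda>n. complex_of_real (x (\<pi> n))) \<in> null_seqs S" unfolding push z_def by (simp add: y_def)
  have xS: "(\<lambda>n. complex_of_real (x n)) \<in> S"
  proof (rule S_dominated[OF S, of _ 1])
    show "cmod (complex_of_real (x n)) \<le> 1 * cmod (complex_of_real (c (blk n)))" for n using xc[of n] by simp
  qed
  \<comment> \<open>x o \<pi> is the pushforward of x under the inverse of \<pi>, so the reordering
    can be undone.\<close>
  have "inj (inv_into UNIV \<pi>)" using surj by (intro surj_imp_inj_inv) (auto simp: surj_def)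
  moreover have "pushforward UNIV (inv_into UNIV \<pi>) (\<lambda>n. complex_of_real (x n))
      = (\<lambda>n. complex_of_real (x (\<pi> n)))"
    using pushforward_apply[OF calculation, of "\<pi> n" "\<lambda>n. complex_of_real (x n)" for n] \<open>inj \<pi>\<close>
    by (simp add: fun_eq_iff)
  ultimately show ?thesis
    using n null_if_pushforward_null[OF xS, of "inv_into UNIV \<pi>" UNIV] by simp
qed

text \<open>The binary tree has root 0 and children 2n+1, 2n+2 of n; its levels are the dyadic
  blocks. The block averages of \<open>b\<close> are v - w, and w at a child is half of v at the
  parent. Hence v - w is the sum of v/2 - p 1 and v/2 - p 2, two generators of
  \<open>null_seqs\<close>; the hypothesis on averages is what puts v into \<open>S\<close>.\<close>

lemma null_of_small_averages_real:
  fixes a b :: "nat \<Rightarrow> real"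
  assumes a: "decseq a" "\<And>n. a n \<ge> 0" "(\<lambda>n. complex_of_real (a n)) \<in> S"
    and b: "\<And>n. \<bar>b n\<bar> \<le> a n" "\<And>n. \<bar>\<Sum>i<n. b i\<bar> \<le> C * real n * a n"
  shows "(\<lambda>n. complex_of_real (b n)) \<in> null_seqs S"
proof -
  \<comment> \<open>Level k of the tree starts at 2^k - 1 and has 2^k vertices; with this offset the
    root is 0.\<close>
  define m where "m k = (2::nat) ^ k - 1" for k
  have m1: "m k + 1 = 2 ^ k" for k by (simp add: m_def)
  have m_mono: "mono m" unfolding m_def by (intro monoI diff_le_mono power_increasing) auto
  have "\<exists>k. m k \<le> n \<and> n < m (Suc k)" for n
    using ex_power_ivl1[of 2 "Suc n"] m1 by (metis Suc_eq_plus1 Suc_le_mono Suc_less_eq le_refl le_add2)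
  then obtain blk where blk: "\<And>n. m (blk n) \<le> n" "\<And>n. n < m (Suc (blk n))" by metis
  note blk_eq = block_index_eq[OF m_mono blk]
  have mS: "m (Suc k) = 2 * m k + 1" for k using m1[of k] m1[of "Suc k"] by simp
  define T where "T k = (\<Sum>i<m k. b i)" for k
  \<comment> \<open>On block k, \<open>v\<close> spreads the total up to the end of the block evenly
    over its 2^k indices, and \<open>w\<close> does so with the total up to its start.\<close>
  define v where "v n = T (Suc (blk n)) / 2 ^ blk n" for n
  define w where "w n = T (blk n) / 2 ^ blk n" for n
  have C: "\<bar>T k\<bar> \<le> \<bar>C\<bar> * 2 ^ k * a (m k)" for k
  proof -
    have "\<bar>T k\<bar> \<le> C * real (m k) * a (m k)" unfolding T_def by (rule b)
    also have "\<dots> \<le> \<bar>C\<bar> * 2 ^ k * a (m k)"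
    proof (intro mult_right_mono mult_mono a)
      have "real (m k) + 1 = 2 ^ k" using m1[of k] by (metis of_nat_1 of_nat_add of_nat_numeral of_nat_power)
      then show "real (m k) \<le> 2 ^ k" by linarith
    qed auto
    finally show ?thesis .
  qed
  have v_le: "\<bar>v n\<bar> \<le> 2 * \<bar>C\<bar> * a (m (Suc (blk n)))" for n
    using C[of "Suc (blk n)"] by (simp add: v_def abs_divide field_simps)
  have w_le: "\<bar>w n\<bar> \<le> \<bar>C\<bar> * a (m (blk n))" for n
    using C[of "blk n"] by (simp add: w_def abs_divide field_simps)
  have w_Suc: "w (Suc n) = v (n div 2) / 2" for n
  proof -
    obtain k where k: "blk (Suc n) = Suc k"
    proof (cases "blk (Suc n)")
      case 0 then show ?thesis using blk(2)[of "Suc n"] by (simp add: m_def)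
    qed
    have "blk (n div 2) = k"
    proof (rule blk_eq)
      show "m k \<le> n div 2" using blk(1)[of "Suc n"] unfolding k mS by simp
      show "n div 2 < m (Suc k)" using blk(2)[of "Suc n"] unfolding k mS by simp
    qed
    then show ?thesis using k by (simp add: w_def v_def)
  qed
  have w_0: "w 0 = 0"
    using blk(1)[of 0] by (simp add: w_def T_def)
  have vS: "(\<lambda>n. complex_of_real (v n / 2)) \<in> S"
  proof (rule S_dominated[OF a(3), of _ "\<bar>C\<bar>"])
    fix n
    \<comment> \<open>The sum in \<open>v\<close> is estimated at the end of the block, which lies
      beyond n; so \<open>a n\<close> itself dominates.\<close>
    have "a (m (Suc (blk n))) \<le> a n" using blk(2)[of n] by (intro decseqD[OF a(1)]) auto
    then have "2 * \<bar>C\<bar> * a (m (Suc (blk n))) \<le> 2 * \<bar>C\<bar> * a n" by (intro mult_left_mono) auto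
    then show "cmod (complex_of_real (v n / 2)) \<le> \<bar>C\<bar> * cmod (complex_of_real (a n))"
      using v_le[of n] a(2)[of n] by (simp del: of_real_divide)
  qed
  define p where "p j n = pushforward UNIV (\<lambda>n. 2 * n + j) (\<lambda>n. complex_of_real (v n / 2)) n" for j n
  have "(\<lambda>n. complex_of_real (v n / 2) - p j n) \<in> null_seqs S" for j
    unfolding p_def by (rule null_seqs.move[OF vS]) (auto simp: inj_on_def)
  from null_seqs.add[OF this[of 1] this[of 2]]
  have "(\<lambda>n. complex_of_real (v n) - (p 1 n + p 2 n)) \<in> null_seqs S" by (simp add: algebra_simps)
  moreover have "p 1 n + p 2 n = complex_of_real (w n)" for n
  proof -
    consider "n = 0" | k where "n = 2 * k + 1" | k where "n = 2 * k + 2"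
      by (metis Suc_eq_plus1 add_2_eq_Suc' evenE mult_Suc_right not0_implies_Suc oddE add.commute)
    then show ?thesis
    proof cases
      case 1
      have "p 1 0 = 0" "p 2 0 = 0" unfolding p_def by (rule pushforward_outside; auto)+
      then show ?thesis by (simp add: 1 w_0)
    next
      case (2 k)
      have "p 1 n = complex_of_real (v k / 2)" unfolding p_def 2 by (rule pushforward_apply) (auto simp: inj_on_def)
      moreover have "p 2 n = 0" unfolding p_def 2 by (rule pushforward_outside) (auto, presburger)
      moreover have "w n = v k / 2" using w_Suc[of "2 * k"] by (simp add: 2)
      ultimately show ?thesis by (simp only: add_0_right)
    next
      case (3 k)
      have "p 2 n = complex_of_real (v k / 2)" unfolding p_def 3 by (rule pushforward_apply) (auto simp: inj_on_def)
      moreover have "p 1 n = 0" unfolding p_def 3 by (rule pushforward_outside) (auto, presburger)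
      moreover have "w n = v k / 2" using w_Suc[of "2 * k + 1"] by (simp add: 3)
      ultimately show ?thesis by (simp only: add_0_left)
    qed
  qed
  ultimately have vw: "(\<lambda>n. complex_of_real (v n - w n)) \<in> null_seqs S" by simp
  \<comment> \<open>The shares 1, 2 |C| and |C| come from \<open>b\<close>, \<open>v\<close> and
    \<open>w\<close>, each estimated by \<open>a\<close> at the start of the block.\<close>
  define c where "c k = (1 + 3 * \<bar>C\<bar>) * a (m k)" for k
  have "(\<lambda>n. complex_of_real (b n - (v n - w n))) \<in> null_seqs S"
  proof (rule null_of_zero_block_sums[of m blk _ c])
    show "m 0 = 0" by (simp add: m_def)
    show "(\<Sum>n = m k..<m (Suc k). b n - (v n - w n)) = 0" for k
    proof -
      have "m k \<le> m (Suc k)" by (simp add: mS)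
      then have bT: "(\<Sum>n = m k..<m (Suc k). b n) = T (Suc k) - T k"
        unfolding T_def lessThan_atLeast0 using sum.atLeastLessThan_concat[of 0 "m k" "m (Suc k)" b] by simp
      have "(\<Sum>n = m k..<m (Suc k). v n - w n) = (\<Sum>n = m k..<m (Suc k). (T (Suc k) - T k) / 2 ^ k)"
        by (intro sum.cong) (auto simp: v_def w_def blk_eq diff_divide_distrib)
      also have "\<dots> = T (Suc k) - T k"
      proof -
        have "m (Suc k) - m k = 2 ^ k" using m1[of k] by (simp add: mS)
        then show ?thesis by simp
      qed
      finally show ?thesis unfolding sum_subtractf using bT by (simp add: sum_subtractf)
    qed
    show "\<bar>b n - (v n - w n)\<bar> \<le> c (blk n)" for n
    proof -
      have "a (m (Suc (blk n))) \<le> a (m (blk n))" "a n \<le> a (m (blk n))"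
        using blk(1)[of n] by (auto intro!: decseqD[OF a(1)] simp: mS)
      then have "\<bar>C\<bar> * a (m (Suc (blk n))) \<le> \<bar>C\<bar> * a (m (blk n))" "\<bar>b n\<bar> \<le> a (m (blk n))"
        using b(1)[of n] by (auto intro: mult_left_mono)
      then show ?thesis using v_le[of n] w_le[of n] unfolding c_def distrib_right by linarith
    qed
    show "(\<lambda>n. complex_of_real (c (blk n))) \<in> S"
    proof (rule S_dominated[OF S_div[OF a(3), of 2], of _ "1 + 3 * \<bar>C\<bar>"])
      show "cmod (complex_of_real (c (blk n))) \<le> (1 + 3 * \<bar>C\<bar>) * cmod (complex_of_real (a (n div 2)))" for n
      proof -
        \<comment> \<open>The next block starts at 2 * m (blk n) + 1, so half of n does not pass the
          start of its own block.\<close>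
        have "n div 2 \<le> m (blk n)" using blk(2)[of n] unfolding mS by simp
        then have "a (m (blk n)) \<le> a (n div 2)" by (rule decseqD[OF a(1)])
        then show ?thesis using a(2) unfolding c_def norm_of_real abs_mult by (simp add: mult_left_mono)
      qed
    qed simp
  qed (use m_mono blk in auto)
  from null_seqs.add[OF this vw] show ?thesis by simp
qed

lemma null_of_small_averages:
  assumes a: "decseq a" "\<And>n. a n \<ge> 0" "(\<lambda>n. complex_of_real (a n)) \<in> S"
    and b: "\<And>n. cmod (b n) \<le> a n" "\<And>n. cmod (\<Sum>i<n. b i) \<le> C * real n * a n"
  shows "b \<in> null_seqs S"
proof -
  have "(\<lambda>n. complex_of_real (Re (b n))) \<in> null_seqs S"
    by (rule null_of_small_averages_real[OF a, of _ C])
      (use b in \<open>auto intro: order_trans[OF abs_Re_le_cmod] simp flip: Re_sum\<close>)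
  moreover have "(\<lambda>n. complex_of_real (Im (b n))) \<in> null_seqs S"
    by (rule null_of_small_averages_real[OF a, of _ C])
      (use b in \<open>auto intro: order_trans[OF abs_Im_le_cmod] simp flip: Im_sum\<close>)
  ultimately have "(\<lambda>n. complex_of_real (Re (b n)) + \<i> * complex_of_real (Im (b n))) \<in> null_seqs S"
    by (intro null_seqs.add null_cmult)
  then show ?thesis by (simp flip: complex_eq)
qed

end

section \<open>Matrices with boundedly many entries in each row and column\<close>

lemma Gamma_carrier_eq [simp]: "carrier \<Gamma>\<^sup>\<infinity> = Gamma_carrier"
  and Gamma_plus: "A \<oplus>\<^bsub>\<Gamma>\<^sup>\<infinity>\<^esub> B = (\<lambda>i j. A i j + B i j)"
  and Gamma_mult: "A \<otimes>\<^bsub>\<Gamma>\<^sup>\<infinity>\<^esub> B = (\<lambda>i j. \<Sum>k | A i k \<noteq> 0. A i k * B k j)"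
  and Gamma_zero: "\<zero>\<^bsub>\<Gamma>\<^sup>\<infinity>\<^esub> = (\<lambda>_ _. 0)"
  and Gamma_one: "\<one>\<^bsub>\<Gamma>\<^sup>\<infinity>\<^esub> = (\<lambda>i j. if i = j then 1 else 0)"
  by (simp_all add: Gamma_inf_def)

lemma Gamma_intro:
  assumes "\<And>i j. cmod (A i j) \<le> C"
    "\<And>i j. A i j \<noteq> 0 \<Longrightarrow> j \<in> R i" "\<And>i. finite (R i)" "\<And>i. card (R i) \<le> N"
    "\<And>i j. A i j \<noteq> 0 \<Longrightarrow> i \<in> Q j" "\<And>j. finite (Q j)" "\<And>j. card (Q j) \<le> M"
  shows "A \<in> Gamma_carrier"
proof -
  have r: "{j. A i j \<noteq> 0} \<subseteq> R i" and q: "{i. A i j \<noteq> 0} \<subseteq> Q j" for i j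
    using assms(2,5) by auto
  have "finite {j. A i j \<noteq> 0} \<and> card {j. A i j \<noteq> 0} \<le> max N M" for i
    using r[of i] assms(3,4)[of i] finite_subset card_mono[OF assms(3) r] by (meson max.coboundedI1 order_trans)
  moreover have "finite {i. A i j \<noteq> 0} \<and> card {i. A i j \<noteq> 0} \<le> max N M" for j
    using q[of j] assms(6,7)[of j] finite_subset card_mono[OF assms(6) q] by (meson max.coboundedI2 order_trans)
  ultimately show ?thesis using assms(1) unfolding Gamma_carrier_def by blast
qed

lemma Gamma_elim:
  assumes "A \<in> Gamma_carrier"
  obtains C N where "C \<ge> 0" "\<And>i j. cmod (A i j) \<le> C"
    "\<And>i. finite {j. A i j \<noteq> 0}" "\<And>i. card {j. A i j \<noteq> 0} \<le> N"
    "\<And>j. finite {i. A i j \<noteq> 0}" "\<And>j. card {i. A i j \<noteq> 0} \<le> N"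
proof -
  obtain C N where C: "\<And>i j. cmod (A i j) \<le> C" and *: "\<And>i. finite {j. A i j \<noteq> 0} \<and> card {j. A i j \<noteq> 0} \<le> N"
    "\<And>j. finite {i. A i j \<noteq> 0} \<and> card {i. A i j \<noteq> 0} \<le> N"
    using assms unfolding Gamma_carrier_def mem_Collect_eq by blast
  have "C \<ge> 0" using C[of 0 0] norm_ge_zero order_trans by blast
  then show thesis using that[of C N] C * by blast
qed

lemma Gamma_dominated:
  assumes "A \<in> Gamma_carrier" "\<And>i j. cmod (B i j) \<le> K * cmod (A i j)"
  shows "B \<in> Gamma_carrier"
  using assms(1)
proof (rule Gamma_elim)
  fix C N
  assume *: "C \<ge> 0" "\<And>i j. cmod (A i j) \<le> C"
    "\<And>i. finite {j. A i j \<noteq> 0}" "\<And>i. card {j. A i j \<noteq> 0} \<le> N"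
    "\<And>j. finite {i. A i j \<noteq> 0}" "\<And>j. card {i. A i j \<noteq> 0} \<le> N"
  have nz: "A i j \<noteq> 0" if "B i j \<noteq> 0" for i j using assms(2)[of i j] that by auto
  show ?thesis
  proof (rule Gamma_intro[where R = "\<lambda>i. {j. A i j \<noteq> 0}" and Q = "\<lambda>j. {i. A i j \<noteq> 0}"])
    show "cmod (B i j) \<le> \<bar>K\<bar> * C" for i j
    proof -
      have "K * cmod (A i j) \<le> \<bar>K\<bar> * C" by (intro mult_mono *) auto
      then show ?thesis using assms(2)[of i j] by linarith
    qed
  qed (use * nz in auto)
qed

lemma Gamma_closed_add:
  assumes "A \<in> Gamma_carrier" "B \<in> Gamma_carrier" shows "(\<lambda>i j. A i j + B i j) \<in> Gamma_carrier"
proof -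
  obtain C N where A: "\<And>i j. cmod (A i j) \<le> C"
    "\<And>i. finite {j. A i j \<noteq> 0}" "\<And>i. card {j. A i j \<noteq> 0} \<le> N"
    "\<And>j. finite {i. A i j \<noteq> 0}" "\<And>j. card {i. A i j \<noteq> 0} \<le> N"
    using assms(1) by (rule Gamma_elim) blast
  obtain C' N' where B: "\<And>i j. cmod (B i j) \<le> C'"
    "\<And>i. finite {j. B i j \<noteq> 0}" "\<And>i. card {j. B i j \<noteq> 0} \<le> N'"
    "\<And>j. finite {i. B i j \<noteq> 0}" "\<And>j. card {i. B i j \<noteq> 0} \<le> N'"
    using assms(2) by (rule Gamma_elim) blast
  show ?thesis
  proof (rule Gamma_intro[where R = "\<lambda>i. {j. A i j \<noteq> 0} \<union> {j. B i j \<noteq> 0}"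
        and Q = "\<lambda>j. {i. A i j \<noteq> 0} \<union> {i. B i j \<noteq> 0}" and N = "N + N'" and M = "N + N'"])
    show "cmod (A i j + B i j) \<le> C + C'" for i j by (intro norm_triangle_mono A B)
    show "card ({j. A i j \<noteq> 0} \<union> {j. B i j \<noteq> 0}) \<le> N + N'" for i
      by (rule order_trans[OF card_Un_le add_mono[OF A(3) B(3)]])
    show "card ({i. A i j \<noteq> 0} \<union> {i. B i j \<noteq> 0}) \<le> N + N'" for j
      by (rule order_trans[OF card_Un_le add_mono[OF A(5) B(5)]])
  qed (use A B in auto)
qed

lemma Gamma_closed_uminus: "A \<in> Gamma_carrier \<Longrightarrow> (\<lambda>i j. - A i j) \<in> Gamma_carrier"
  by (erule Gamma_dominated[where K = 1]) simp

lemma Gamma_closed_diff: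
  "A \<in> Gamma_carrier \<Longrightarrow> B \<in> Gamma_carrier \<Longrightarrow> (\<lambda>i j. A i j - B i j) \<in> Gamma_carrier"
  using Gamma_closed_add[OF _ Gamma_closed_uminus, of A B] by simp

lemma Gamma_closed_zero: "(\<lambda>i j. 0) \<in> Gamma_carrier"
  by (rule Gamma_intro[where R = "\<lambda>_. {}" and Q = "\<lambda>_. {}" and C = 0]) auto

lemma Gamma_closed_mult:
  assumes "A \<in> Gamma_carrier" "B \<in> Gamma_carrier" shows "A \<otimes>\<^bsub>\<Gamma>\<^sup>\<infinity>\<^esub> B \<in> Gamma_carrier"
proof -
  obtain C N where A: "C \<ge> 0" "\<And>i j. cmod (A i j) \<le> C"
    "\<And>i. finite {j. A i j \<noteq> 0}" "\<And>i. card {j. A i j \<noteq> 0} \<le> N"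
    "\<And>j. finite {i. A i j \<noteq> 0}" "\<And>j. card {i. A i j \<noteq> 0} \<le> N"
    using assms(1) by (rule Gamma_elim) blast
  obtain C' N' where B: "C' \<ge> 0" "\<And>i j. cmod (B i j) \<le> C'"
    "\<And>i. finite {j. B i j \<noteq> 0}" "\<And>i. card {j. B i j \<noteq> 0} \<le> N'"
    "\<And>j. finite {i. B i j \<noteq> 0}" "\<And>j. card {i. B i j \<noteq> 0} \<le> N'"
    using assms(2) by (rule Gamma_elim) blast
  have nz: "\<exists>k. A i k \<noteq> 0 \<and> B k j \<noteq> 0" if "(A \<otimes>\<^bsub>\<Gamma>\<^sup>\<infinity>\<^esub> B) i j \<noteq> 0" for i j
  proof (rule ccontr)
    assume "\<not> ?thesis"
    then have "(A \<otimes>\<^bsub>\<Gamma>\<^sup>\<infinity>\<^esub> B) i j = 0" unfolding Gamma_mult by (intro sum.neutral) auto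
    with that show False by simp
  qed
  have UN: "card (\<Union>k\<in>I. F k) \<le> a * b" if "finite I" "card I \<le> a" "\<And>k. card (F k) \<le> b" for I :: "nat set" and F :: "nat \<Rightarrow> nat set" and a b
  proof -
    have "card (\<Union>k\<in>I. F k) \<le> (\<Sum>k\<in>I. card (F k))" by (rule card_UN_le[OF that(1)])
    also have "\<dots> \<le> card I * b" using sum_bounded_above[of I "\<lambda>k. card (F k)" b] that(3) by simp
    also have "\<dots> \<le> a * b" using that by simp
    finally show ?thesis .
  qed
  show ?thesis
  proof (rule Gamma_intro[where R = "\<lambda>i. \<Union>k\<in>{k. A i k \<noteq> 0}. {j. B k j \<noteq> 0}"
        and Q = "\<lambda>j. \<Union>k\<in>{k. B k j \<noteq> 0}. {i. A i k \<noteq> 0}" and N = "N * N'" and M = "N' * N"])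
    show "cmod ((A \<otimes>\<^bsub>\<Gamma>\<^sup>\<infinity>\<^esub> B) i j) \<le> real N * (C * C')" for i j
    proof -
      have "cmod ((A \<otimes>\<^bsub>\<Gamma>\<^sup>\<infinity>\<^esub> B) i j) \<le> (\<Sum>k | A i k \<noteq> 0. C * C')"
        unfolding Gamma_mult
        by (intro sum_norm_le) (auto simp: norm_mult intro!: mult_mono A B)
      also have "\<dots> \<le> real N * (C * C')"
        using A(4)[of i] A(1) B(1) by (simp add: mult_right_mono)
      finally show ?thesis .
    qed
    show "card (\<Union>k\<in>{k. A i k \<noteq> 0}. {j. B k j \<noteq> 0}) \<le> N * N'" for i by (intro UN A B)
    show "card (\<Union>k\<in>{k. B k j \<noteq> 0}. {i. A i k \<noteq> 0}) \<le> N' * N" for j by (intro UN A B)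
    show "j \<in> (\<Union>k\<in>{k. A i k \<noteq> 0}. {j. B k j \<noteq> 0})" "i \<in> (\<Union>k\<in>{k. B k j \<noteq> 0}. {i. A i k \<noteq> 0})"
      if "(A \<otimes>\<^bsub>\<Gamma>\<^sup>\<infinity>\<^esub> B) i j \<noteq> 0" for i j using nz[OF that] by auto
  qed (use A B in auto)
qed

lemma abelian_group_Gamma: "abelian_group \<Gamma>\<^sup>\<infinity>"
proof (rule abelian_groupI)
  fix A assume "A \<in> carrier \<Gamma>\<^sup>\<infinity>"
  then show "\<exists>B\<in>carrier \<Gamma>\<^sup>\<infinity>. B \<oplus>\<^bsub>\<Gamma>\<^sup>\<infinity>\<^esub> A = \<zero>\<^bsub>\<Gamma>\<^sup>\<infinity>\<^esub>"
    by (intro bexI[of _ "\<lambda>i j. - A i j"]) (auto simp: Gamma_plus Gamma_zero Gamma_closed_uminus)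
qed (auto simp: Gamma_plus Gamma_zero Gamma_closed_add Gamma_closed_zero fun_eq_iff add_ac)

lemma Gamma_a_inv: "A \<in> Gamma_carrier \<Longrightarrow> \<ominus>\<^bsub>\<Gamma>\<^sup>\<infinity>\<^esub> A = (\<lambda>i j. - A i j)"
  by (rule abelian_group.minus_equality[OF abelian_group_Gamma])
    (auto simp: Gamma_plus Gamma_zero Gamma_closed_uminus)

lemma Gamma_a_minus:
  "A \<in> Gamma_carrier \<Longrightarrow> B \<in> Gamma_carrier \<Longrightarrow> A \<ominus>\<^bsub>\<Gamma>\<^sup>\<infinity>\<^esub> B = (\<lambda>i j. A i j - B i j)"
  by (simp add: a_minus_def Gamma_plus Gamma_a_inv)

definition diag_matrix :: "(nat \<Rightarrow> complex) \<Rightarrow> cmatrix"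
  where "diag_matrix \<alpha> = (\<lambda>i j. if i = j then \<alpha> i else 0)"

lemma Gamma_partial_injection:
  assumes "inj_on f D" "\<alpha> \<in> carrier linf"
  shows "(\<lambda>i j. if i \<in> D \<and> j = f i then \<alpha> i else 0) \<in> Gamma_carrier"
    "(\<lambda>j i. if i \<in> D \<and> j = f i then \<alpha> i else 0) \<in> Gamma_carrier"
proof -
  obtain C where C: "\<And>n. cmod (\<alpha> n) \<le> C" using assms(2) by (auto simp: linf_iff)
  have "C \<ge> 0" using C[of 0] norm_ge_zero order_trans by blast
  moreover have fin: "finite {i \<in> D. f i = j}" "card {i \<in> D. f i = j} \<le> 1" for j
  proof -
    have "\<exists>i. {i \<in> D. f i = j} \<subseteq> {i}" using assms(1) by (auto simp: inj_on_def)
    then show "finite {i \<in> D. f i = j}" "card {i \<in> D. f i = j} \<le> 1"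
      by (auto dest: finite_subset card_mono[rotated])
  qed
  ultimately show "(\<lambda>i j. if i \<in> D \<and> j = f i then \<alpha> i else 0) \<in> Gamma_carrier"
    by (intro Gamma_intro[where C = C and R = "\<lambda>i. {f i}" and Q = "\<lambda>j. {i \<in> D. f i = j}" and N = 1 and M = 1])
      (use C in \<open>auto split: if_splits\<close>)
  show "(\<lambda>j i. if i \<in> D \<and> j = f i then \<alpha> i else 0) \<in> Gamma_carrier"
    by (intro Gamma_intro[where C = C and Q = "\<lambda>i. {f i}" and R = "\<lambda>j. {i \<in> D. f i = j}" and N = 1 and M = 1])
      (use C \<open>C \<ge> 0\<close> fin in \<open>auto split: if_splits\<close>)
qed

lemma diag_matrix_in_Gamma: "\<alpha> \<in> carrier linf \<Longrightarrow> diag_matrix \<alpha> \<in> Gamma_carrier"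
  using Gamma_partial_injection(1)[of "\<lambda>i. i" UNIV \<alpha>] by (simp add: diag_matrix_def eq_commute)

lemma Gamma_mult_single:
  assumes "A \<in> Gamma_carrier" "\<And>k. k \<noteq> l \<Longrightarrow> A i k * B k j = 0"
  shows "(A \<otimes>\<^bsub>\<Gamma>\<^sup>\<infinity>\<^esub> B) i j = A i l * B l j"
proof -
  have f: "finite {k. A i k \<noteq> 0}" using assms(1) by (rule Gamma_elim)
  \<comment> \<open>The product sums over the support of row i, which may miss
    \<open>l\<close>.\<close>
  have "(A \<otimes>\<^bsub>\<Gamma>\<^sup>\<infinity>\<^esub> B) i j = (\<Sum>k\<in>insert l {k. A i k \<noteq> 0}. A i k * B k j)"
    unfolding Gamma_mult using f by (intro sum.mono_neutral_left) auto
  also have "\<dots> = (\<Sum>k\<in>{l}. A i k * B k j)"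
    using f assms(2) by (intro sum.mono_neutral_right) auto
  finally show ?thesis by simp
qed

text \<open>Greedy colouring: when vertex n is reached, its at most N neighbours cannot use up the N
  + 1 colours 0, ..., N.\<close>

lemma bounded_degree_colouring:
  fixes E :: "nat \<Rightarrow> nat \<Rightarrow> bool"
  assumes "\<And>i j. E i j \<Longrightarrow> E j i" "\<And>i. finite {j. E i j}" "\<And>i. card {j. E i j} \<le> N"
  shows "\<exists>col. (\<forall>i. col i \<le> N) \<and> (\<forall>i j. E i j \<longrightarrow> i \<noteq> j \<longrightarrow> col i \<noteq> col j)"
proof -
  have ex: "\<exists>c\<le>N. \<forall>m. E n m \<longrightarrow> c \<noteq> col m" for n and col :: "nat \<Rightarrow> nat"
  proof (rule ccontr)
    assume "\<not> ?thesis"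
    then have "{..N} \<subseteq> col ` {m. E n m}" by auto
    then have "card {..N} \<le> card {m. E n m}" using assms(2) by (meson surj_card_le)
    then show False using assms(3)[of n] by simp
  qed
  have "\<exists>col. \<forall>n. col n \<le> N \<and> (\<forall>m<n. E n m \<longrightarrow> col n \<noteq> col m)"
    by (rule dependent_wf_choice[OF wf_less, of "\<lambda>col n c. c \<le> N \<and> (\<forall>m<n. E n m \<longrightarrow> c \<noteq> col m)"])
      (use ex in \<open>auto, blast\<close>)
  then obtain col where col: "\<And>n. col n \<le> N" "\<And>m n. m < n \<Longrightarrow> E n m \<Longrightarrow> col n \<noteq> col m" by blast
  have "col i \<noteq> col j" if "E i j" "i \<noteq> j" for i j
    using col(2)[of i j] col(2)[of j i] that assms(1)[of i j] by (cases i j rule: linorder_cases) auto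
  with col(1) show ?thesis by blast
qed

section \<open>Commutator subgroups and the ideal of matrices\<close>

lemma commutator_in_subgroup:
  "r \<in> carrier R \<Longrightarrow> a \<in> I \<Longrightarrow> r \<otimes>\<^bsub>R\<^esub> a \<ominus>\<^bsub>R\<^esub> a \<otimes>\<^bsub>R\<^esub> r \<in> commutator_subgroup R I"
  unfolding commutator_subgroup_def by (rule generate.incl) auto

lemma commutator_subgroup_subgroup:
  assumes "abelian_group R" "I \<subseteq> carrier R"
    and "\<And>x y. x \<in> carrier R \<Longrightarrow> y \<in> carrier R \<Longrightarrow> x \<otimes>\<^bsub>R\<^esub> y \<in> carrier R"
  shows "subgroup (commutator_subgroup R I) (add_monoid R)"
  unfolding commutator_subgroup_def
proof (rule group.generate_is_subgroup)
  show "group (add_monoid R)" using assms(1) by (rule abelian_group.a_group)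
  show "{r \<otimes>\<^bsub>R\<^esub> a \<ominus>\<^bsub>R\<^esub> a \<otimes>\<^bsub>R\<^esub> r |r a. r \<in> carrier R \<and> a \<in> I} \<subseteq> carrier (add_monoid R)"
    using assms by (auto intro!: abelian_group.minus_closed[OF assms(1)])
qed

context symmetric_seq_ideal
begin

abbreviation "\<Gamma>_comm \<equiv> commutator_subgroup \<Gamma>\<^sup>\<infinity> (I_ideal S)"

lemma I_ideal_Gamma: "I_ideal S \<subseteq> Gamma_carrier"
  by (auto simp: I_ideal_def)

lemma subgroup_Gamma_comm: "subgroup \<Gamma>_comm (add_monoid \<Gamma>\<^sup>\<infinity>)"
  by (rule commutator_subgroup_subgroup[OF abelian_group_Gamma])
    (auto simp: Gamma_closed_mult I_ideal_Gamma[THEN subsetD])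

lemma Gamma_comm_add: "A \<in> \<Gamma>_comm \<Longrightarrow> B \<in> \<Gamma>_comm \<Longrightarrow> (\<lambda>i j. A i j + B i j) \<in> \<Gamma>_comm"
  using subgroup.m_closed[OF subgroup_Gamma_comm, of A B] by (simp add: Gamma_plus)

lemma Gamma_comm_zero: "(\<lambda>i j. 0) \<in> \<Gamma>_comm"
  using subgroup.one_closed[OF subgroup_Gamma_comm] by (simp add: Gamma_zero)

lemma Gamma_comm_sum: "(\<And>k. k \<in> F \<Longrightarrow> f k \<in> \<Gamma>_comm) \<Longrightarrow> (\<lambda>i j. \<Sum>k\<in>F. f k i j) \<in> \<Gamma>_comm"
  by (induction F rule: infinite_finite_induct) (auto intro: Gamma_comm_add Gamma_comm_zero)

lemma Gamma_commutator:
  assumes "A \<in> Gamma_carrier" "B \<in> I_ideal S"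
  shows "(\<lambda>i j. (A \<otimes>\<^bsub>\<Gamma>\<^sup>\<infinity>\<^esub> B) i j - (B \<otimes>\<^bsub>\<Gamma>\<^sup>\<infinity>\<^esub> A) i j) \<in> \<Gamma>_comm"
  using commutator_in_subgroup[of A "\<Gamma>\<^sup>\<infinity>" B "I_ideal S"] assms I_ideal_Gamma
  by (auto simp: Gamma_a_minus Gamma_closed_mult subset_iff)

lemma I_ideal_dominated:
  assumes "A \<in> I_ideal S" "\<And>i j. cmod (B i j) \<le> K * cmod (A i j)" shows "B \<in> I_ideal S"
  using assms(1) Gamma_dominated[of A B K, OF _ assms(2)]
    S_dominated[of "\<lambda>n. case_prod A (prod_decode n)" "\<lambda>n. case_prod B (prod_decode n)" K] assms(2)
  by (auto simp: I_ideal_def split: prod.splits)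

lemma I_ideal_diff: "A \<in> I_ideal S \<Longrightarrow> B \<in> I_ideal S \<Longrightarrow> (\<lambda>i j. A i j - B i j) \<in> I_ideal S"
  using S_diff[of "\<lambda>n. case_prod A (prod_decode n)" "\<lambda>n. case_prod B (prod_decode n)"]
  by (auto simp: I_ideal_def Gamma_closed_diff case_prod_unfold)

lemma I_ideal_add: "A \<in> I_ideal S \<Longrightarrow> B \<in> I_ideal S \<Longrightarrow> (\<lambda>i j. A i j + B i j) \<in> I_ideal S"
  using S_add[of "\<lambda>n. case_prod A (prod_decode n)" "\<lambda>n. case_prod B (prod_decode n)"]
  by (auto simp: I_ideal_def Gamma_closed_add case_prod_unfold)

lemma I_ideal_diagonal: assumes "A \<in> I_ideal S" shows "(\<lambda>n. A n n) \<in> S"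
proof -
  have "(\<lambda>n. case_prod A (prod_decode n)) \<in> S" using assms by (simp add: I_ideal_def)
  from S_reindex[OF this, of "\<lambda>n. prod_encode (n, n)" UNIV]
  show ?thesis by (simp add: inj_on_def)
qed

text \<open>A position (i, f i) on the graph of f is determined by its row, so the flattened matrix
  is a pullback of \<alpha> along an injection.\<close>

lemma partial_injection_in_I_ideal:
  assumes "inj_on f D" "\<alpha> \<in> S"
  shows "(\<lambda>i j. if i \<in> D \<and> j = f i then \<alpha> i else 0) \<in> I_ideal S"
proof -
  have "(\<lambda>n. if n \<in> {n. fst (prod_decode n) \<in> D \<and> snd (prod_decode n) = f (fst (prod_decode n))}
      then \<alpha> (fst (prod_decode n)) else 0) \<in> S"
  proof (rule S_reindex[OF assms(2)])
    show "inj_on (\<lambda>n. fst (prod_decode n)) {n. fst (prod_decode n) \<in> D \<and> snd (prod_decode n) = f (fst (prod_decode n))}"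
      by (rule inj_onI) (metis (mono_tags, lifting) mem_Collect_eq prod_decode_eq prod_eqI)
  qed
  then show ?thesis using Gamma_partial_injection(1)[OF assms(1) S_linf[OF assms(2)]]
    by (simp add: I_ideal_def case_prod_unfold)
qed

lemma diag_matrix_in_I_ideal: "\<alpha> \<in> S \<Longrightarrow> diag_matrix \<alpha> \<in> I_ideal S"
  using partial_injection_in_I_ideal[of "\<lambda>i. i" UNIV \<alpha>] by (simp add: diag_matrix_def eq_commute)

text \<open>For a generator, let V be the partial isometry with V e_i = e_(f i) for i in D, and B
  its transpose with weights - \<alpha>. Then V B = - diag (f_* \<alpha>) and B V = - diag \<alpha>.
  The sign fits the order of the commutator, where the ideal element B is the second entry.\<close>

lemma diag_matrix_null: "\<alpha> \<in> null_seqs S \<Longrightarrow> diag_matrix \<alpha> \<in> \<Gamma>_comm"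
proof (induction rule: null_seqs.induct)
  case zero
  then show ?case using Gamma_comm_zero by (simp add: diag_matrix_def)
next
  case (add \<alpha> \<beta>)
  have "diag_matrix (\<lambda>n. \<alpha> n + \<beta> n) = (\<lambda>i j. diag_matrix \<alpha> i j + diag_matrix \<beta> i j)"
    by (simp add: diag_matrix_def fun_eq_iff)
  then show ?case using Gamma_comm_add[OF add.IH] by simp
next
  case (move \<alpha> f D)
  define V where "V = (\<lambda>j i. if i \<in> D \<and> j = f i then 1 else 0 :: complex)"
  define B where "B = (\<lambda>i j. if i \<in> D \<and> j = f i then - \<alpha> i else 0)"
  have V: "V \<in> Gamma_carrier"
    unfolding V_def using Gamma_partial_injection(2)[OF move(2), of "\<lambda>_. 1"] by (simp add: linf_iff) (metis norm_one order_refl)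
  have mS: "(\<lambda>i. - \<alpha> i) \<in> S" using S_cmult[OF move(1), of "-1"] by simp
  have B: "B \<in> I_ideal S"
    unfolding B_def by (rule partial_injection_in_I_ideal[OF move(2) mS])
  have BG: "B \<in> Gamma_carrier" using B I_ideal_Gamma by auto
  have "(V \<otimes>\<^bsub>\<Gamma>\<^sup>\<infinity>\<^esub> B) i j - (B \<otimes>\<^bsub>\<Gamma>\<^sup>\<infinity>\<^esub> V) i j = diag_matrix (\<lambda>n. \<alpha> n - pushforward D f \<alpha> n) i j" for i j
  proof -
    have "(V \<otimes>\<^bsub>\<Gamma>\<^sup>\<infinity>\<^esub> B) i j = diag_matrix (\<lambda>n. - pushforward D f \<alpha> n) i j"
    proof (cases "i \<in> f ` D")
      case True
      then obtain k where k: "k \<in> D" "i = f k" by auto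
      have "(V \<otimes>\<^bsub>\<Gamma>\<^sup>\<infinity>\<^esub> B) i j = V i k * B k j"
        by (rule Gamma_mult_single[OF V]) (use k move(2) in \<open>auto simp: V_def inj_on_def\<close>)
      then show ?thesis using k pushforward_apply[OF move(2), of k \<alpha>] by (auto simp: V_def B_def diag_matrix_def)
    next
      case False
      have "(V \<otimes>\<^bsub>\<Gamma>\<^sup>\<infinity>\<^esub> B) i j = V i i * B i j"
        by (rule Gamma_mult_single[OF V]) (use False in \<open>auto simp: V_def\<close>)
      then show ?thesis using False by (auto simp: V_def diag_matrix_def pushforward_outside)
    qed
    moreover have "(B \<otimes>\<^bsub>\<Gamma>\<^sup>\<infinity>\<^esub> V) i j = diag_matrix (\<lambda>n. - \<alpha> n) i j"
    proof -
      have "(B \<otimes>\<^bsub>\<Gamma>\<^sup>\<infinity>\<^esub> V) i j = B i (f i) * V (f i) j"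
        by (rule Gamma_mult_single[OF BG]) (auto simp: B_def)
      then show ?thesis using move(2) move(3)[of i] by (auto simp: V_def B_def diag_matrix_def inj_on_def)
    qed
    ultimately show ?thesis by (simp add: diag_matrix_def)
  qed
  with Gamma_commutator[OF V B] show ?case by simp
qed

text \<open>For the colour projections P_c and B_c = P_c A, the commutator of P_c and B_c is P_c A -
  P_c A P_c. Summing over the colours leaves A minus the sum of the P_c A P_c, and that sum is the
  diagonal of A because distinct indices of one colour are not joined.\<close>

lemma I_ideal_minus_diagonal:
  assumes "A \<in> I_ideal S"
  shows "(\<lambda>i j. A i j - diag_matrix (\<lambda>n. A n n) i j) \<in> \<Gamma>_comm"
proof -
  have AG: "A \<in> Gamma_carrier" using assms I_ideal_Gamma by auto
  then obtain C N where A: "C \<ge> 0" "\<And>i j. cmod (A i j) \<le> C"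
    "\<And>i. finite {j. A i j \<noteq> 0}" "\<And>i. card {j. A i j \<noteq> 0} \<le> N"
    "\<And>j. finite {i. A i j \<noteq> 0}" "\<And>j. card {i. A i j \<noteq> 0} \<le> N"
    by (rule Gamma_elim) blast
  have *: "{j. A i j \<noteq> 0 \<or> A j i \<noteq> 0} = {j. A i j \<noteq> 0} \<union> {j. A j i \<noteq> 0}" for i by auto
  obtain col where col: "\<And>i. col i \<le> N + N" "\<And>i j. A i j \<noteq> 0 \<or> A j i \<noteq> 0 \<Longrightarrow> i \<noteq> j \<Longrightarrow> col i \<noteq> col j"
  proof -
    \<comment> \<open>Edges are taken in both directions: at most N neighbours come from the row and
      N from the column.\<close>
    have "\<exists>col. (\<forall>i. col i \<le> N + N) \<and> (\<forall>i j. (A i j \<noteq> 0 \<or> A j i \<noteq> 0) \<longrightarrow> i \<noteq> j \<longrightarrow> col i \<noteq> col j)"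
    proof (rule bounded_degree_colouring)
      show "card {j. A i j \<noteq> 0 \<or> A j i \<noteq> 0} \<le> N + N" for i
        unfolding * by (rule order_trans[OF card_Un_le add_mono[OF A(4) A(6)]])
      show "finite {j. A i j \<noteq> 0 \<or> A j i \<noteq> 0}" for i unfolding * using A by simp
    qed auto
    then show thesis using that by blast
  qed
  define P where "P c = diag_matrix (\<lambda>i. if col i = c then 1 else 0)" for c
  define B where "B c = (\<lambda>i j. if col i = c then A i j else 0)" for c
  have P: "P c \<in> Gamma_carrier" for c
    unfolding P_def by (rule diag_matrix_in_Gamma) (auto simp: linf_iff intro!: exI[of _ 1])
  have B: "B c \<in> I_ideal S" for c
    by (rule I_ideal_dominated[OF assms, of _ 1]) (simp add: B_def)
  then have BG: "B c \<in> Gamma_carrier" for c using I_ideal_Gamma by auto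
  have PB: "(P c \<otimes>\<^bsub>\<Gamma>\<^sup>\<infinity>\<^esub> B c) i j = B c i j" for c i j
  proof -
    have "(P c \<otimes>\<^bsub>\<Gamma>\<^sup>\<infinity>\<^esub> B c) i j = P c i i * B c i j"
      by (rule Gamma_mult_single[OF P]) (auto simp: P_def diag_matrix_def)
    then show ?thesis by (simp add: P_def B_def diag_matrix_def)
  qed
  have BP: "(B c \<otimes>\<^bsub>\<Gamma>\<^sup>\<infinity>\<^esub> P c) i j = (if col j = c then B c i j else 0)" for c i j
  proof -
    have "(B c \<otimes>\<^bsub>\<Gamma>\<^sup>\<infinity>\<^esub> P c) i j = B c i j * P c j j"
      by (rule Gamma_mult_single[OF BG]) (auto simp: P_def diag_matrix_def)
    then show ?thesis by (simp add: P_def diag_matrix_def)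
  qed
  have "(\<lambda>i j. \<Sum>c\<in>{..N + N}. (P c \<otimes>\<^bsub>\<Gamma>\<^sup>\<infinity>\<^esub> B c) i j - (B c \<otimes>\<^bsub>\<Gamma>\<^sup>\<infinity>\<^esub> P c) i j) \<in> \<Gamma>_comm"
    by (intro Gamma_comm_sum Gamma_commutator P B)
  moreover have "(\<Sum>c\<in>{..N + N}. (P c \<otimes>\<^bsub>\<Gamma>\<^sup>\<infinity>\<^esub> B c) i j - (B c \<otimes>\<^bsub>\<Gamma>\<^sup>\<infinity>\<^esub> P c) i j)
      = A i j - diag_matrix (\<lambda>n. A n n) i j" for i j
  proof -
    have "(\<Sum>c\<in>{..N + N}. (P c \<otimes>\<^bsub>\<Gamma>\<^sup>\<infinity>\<^esub> B c) i j - (B c \<otimes>\<^bsub>\<Gamma>\<^sup>\<infinity>\<^esub> P c) i j)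
        = (\<Sum>c\<in>{..N + N}. if c = col i then (if i = j then 0 else A i j) else 0)"
    proof (rule sum.cong[OF refl])
      show "(P c \<otimes>\<^bsub>\<Gamma>\<^sup>\<infinity>\<^esub> B c) i j - (B c \<otimes>\<^bsub>\<Gamma>\<^sup>\<infinity>\<^esub> P c) i j
          = (if c = col i then (if i = j then 0 else A i j) else 0)" for c
        unfolding PB BP using col(2)[of i j] by (cases "A i j = 0") (auto simp: B_def)
    qed
    then show ?thesis using col(1)[of i] by (simp add: diag_matrix_def)
  qed
  ultimately show ?thesis by simp
qed

end

section \<open>Diagonal operators and matrices as operators\<close>

lemma norm_diag_op_le:
  assumes "\<And>n. cmod (\<alpha> n) \<le> C" shows "norm (diag_op \<alpha> x) \<le> C * norm x"
proof (rule norm_ell2_le)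
  have C: "C \<ge> 0" using assms[of 0] norm_ge_zero order_trans by blast
  then show "C * norm x \<ge> 0" by simp
  have \<alpha>: "\<alpha> \<in> carrier linf" using assms by (auto simp: linf_iff)
  fix F :: "nat set" assume F: "finite F"
  have "(\<Sum>n\<in>F. (cmod (ell2_nth (diag_op \<alpha> x) n))\<^sup>2) \<le> (\<Sum>n\<in>F. C\<^sup>2 * (cmod (ell2_nth x n))\<^sup>2)"
    using assms by (intro sum_mono) (simp add: ell2_nth_diag_op[OF \<alpha>] norm_mult power_mult_distrib mult_right_mono power_mono)
  also have "\<dots> \<le> C\<^sup>2 * (norm x)\<^sup>2"
    using sum_le_norm_ell2[OF F, of x] by (simp add: sum_distrib_left[symmetric] mult_left_mono)
  finally show "(\<Sum>n\<in>F. (cmod (ell2_nth (diag_op \<alpha> x) n))\<^sup>2) \<le> (C * norm x)\<^sup>2"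
    by (simp add: power_mult_distrib)
qed

lemma diag_op_in_B: assumes "\<alpha> \<in> carrier linf" shows "diag_op \<alpha> \<in> carrier \<B>"
proof -
  obtain C where "\<And>n. cmod (\<alpha> n) \<le> C" using assms by (auto simp: linf_iff)
  from norm_diag_op_le[OF this] show ?thesis
    by (intro B_intro[where K = C] ell2_eqI) (simp_all add: ell2_nth_diag_op[OF assms] ell2_rep_eqs algebra_simps)
qed

lemma diag_op_unit_vec: "\<alpha> \<in> carrier linf \<Longrightarrow> diag_op \<alpha> (unit_vec n) = \<alpha> n *\<^sub>C unit_vec n"
  by (rule ell2_eqI) (simp add: ell2_nth_diag_op ell2_rep_eqs unit_vec.rep_eq)

lemma ell2_nth_matrix_op_unit_vec:
  assumes "A \<in> Gamma_carrier" shows "ell2_nth (matrix_op A (unit_vec n)) i = A i n"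
proof -
  have f: "finite {j. A i j \<noteq> 0}" using assms by (rule Gamma_elim)
  have "ell2_nth (matrix_op A (unit_vec n)) i = (\<Sum>j | A i j \<noteq> 0. if j = n then A i j else 0)"
    using assms by (subst ell2_nth_matrix_op) (auto simp: unit_vec.rep_eq intro!: sum.cong)
  then show ?thesis using f by simp
qed

text \<open>Cauchy-Schwarz in a row with at most N entries of modulus at most C, and then each
  coordinate of the vector is counted at most N times; together this gives the norm bound N
  C.\<close>

lemma matrix_op_in_B: assumes "A \<in> Gamma_carrier" shows "matrix_op A \<in> carrier \<B>"
proof -
  obtain C N where A: "C \<ge> 0" "\<And>i j. cmod (A i j) \<le> C"
    "\<And>i. finite {j. A i j \<noteq> 0}" "\<And>i. card {j. A i j \<noteq> 0} \<le> N"
    "\<And>j. finite {i. A i j \<noteq> 0}" "\<And>j. card {i. A i j \<noteq> 0} \<le> N"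
    using assms by (rule Gamma_elim) blast
  note nth = ell2_nth_matrix_op[of A, unfolded Gamma_carrier_eq, OF assms]
  show ?thesis
  proof (rule B_intro)
    show "norm (matrix_op A x) \<le> real N * C * norm x" for x
    proof (rule norm_ell2_le)
      show "real N * C * norm x \<ge> 0" using A by simp
      fix F :: "nat set" assume F: "finite F"
      define u where "u j = (cmod (ell2_nth x j))\<^sup>2" for j
      have u0: "u j \<ge> 0" for j by (simp add: u_def)
      define U where "U = (\<Union>i\<in>F. {j. A i j \<noteq> 0})"
      have U: "finite U" using F A by (simp add: U_def)
      have entry: "(cmod (ell2_nth (matrix_op A x) i))\<^sup>2 \<le> N * C\<^sup>2 * (\<Sum>j | A i j \<noteq> 0. u j)" for i
      proof -
        have "(cmod (ell2_nth (matrix_op A x) i))\<^sup>2 \<le> (\<Sum>j | A i j \<noteq> 0. cmod (A i j * ell2_nth x j))\<^sup>2"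
          unfolding nth by (intro power_mono norm_sum norm_ge_zero)
        also have "\<dots> \<le> (\<Sum>j | A i j \<noteq> 0. (cmod (A i j * ell2_nth x j))\<^sup>2) * card {j. A i j \<noteq> 0}"
          by (rule sum_squared_le_sum_of_squares)
        also have "\<dots> \<le> (\<Sum>j | A i j \<noteq> 0. C\<^sup>2 * u j) * N"
        proof (intro mult_mono sum_mono)
          show "(cmod (A i j * ell2_nth x j))\<^sup>2 \<le> C\<^sup>2 * u j" for j
            using A(2)[of i j] by (simp add: u_def norm_mult power_mult_distrib mult_right_mono power_mono)
        qed (use A u0 in \<open>auto intro: sum_nonneg\<close>)
        finally show ?thesis by (simp only: sum_distrib_left sum_distrib_right mult_ac)
      qed
      have "(\<Sum>i\<in>F. \<Sum>j | A i j \<noteq> 0. u j) = (\<Sum>i\<in>F. \<Sum>j\<in>U. if A i j \<noteq> 0 then u j else 0)"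
      proof (rule sum.cong[OF refl])
        fix i assume "i \<in> F"
        then have "{j. A i j \<noteq> 0} = {j \<in> U. A i j \<noteq> 0}" by (auto simp: U_def)
        then show "(\<Sum>j | A i j \<noteq> 0. u j) = (\<Sum>j\<in>U. if A i j \<noteq> 0 then u j else 0)"
          using sum.inter_filter[OF U, of u "\<lambda>j. A i j \<noteq> 0"] by simp
      qed
      also have "\<dots> = (\<Sum>j\<in>U. \<Sum>i\<in>F. if A i j \<noteq> 0 then u j else 0)" by (rule sum.swap)
      also have "\<dots> = (\<Sum>j\<in>U. real (card {i\<in>F. A i j \<noteq> 0}) * u j)"
        using F by (simp add: sum.inter_filter[symmetric])
      also have "\<dots> \<le> (\<Sum>j\<in>U. N * u j)"
      proof (intro sum_mono mult_right_mono u0)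
        fix j
        have "card {i\<in>F. A i j \<noteq> 0} \<le> card {i. A i j \<noteq> 0}" using A by (intro card_mono) auto
        then show "real (card {i\<in>F. A i j \<noteq> 0}) \<le> real N" using A(6)[of j] by simp
      qed
      also have "\<dots> \<le> N * (norm x)\<^sup>2"
        using sum_le_norm_ell2[OF U, of x] by (simp add: sum_distrib_left[symmetric] mult_left_mono u_def)
      finally have "N * C\<^sup>2 * (\<Sum>i\<in>F. \<Sum>j | A i j \<noteq> 0. u j) \<le> N * C\<^sup>2 * (N * (norm x)\<^sup>2)"
        by (intro mult_left_mono) auto
      moreover have "(\<Sum>i\<in>F. (cmod (ell2_nth (matrix_op A x) i))\<^sup>2) \<le> N * C\<^sup>2 * (\<Sum>i\<in>F. \<Sum>j | A i j \<noteq> 0. u j)"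
        by (subst sum_distrib_left) (intro sum_mono entry)
      ultimately show "(\<Sum>i\<in>F. (cmod (ell2_nth (matrix_op A x) i))\<^sup>2) \<le> (real N * C * norm x)\<^sup>2"
        by (simp add: power2_eq_square mult_ac)
    qed
  qed (rule ell2_eqI; simp add: nth ell2_rep_eqs sum_distrib_left distrib_left sum.distrib mult_ac)+
qed

lemma matrix_op_eqI:
  assumes "A \<in> Gamma_carrier" "T \<in> carrier \<B>" "\<And>i n. ell2_nth (T (unit_vec n)) i = A i n"
  shows "matrix_op A = T"
  by (rule B_eqI[OF matrix_op_in_B[OF assms(1)] assms(2)], rule ell2_eqI)
    (simp add: ell2_nth_matrix_op_unit_vec[OF assms(1)] assms(3))

lemma inj_on_matrix_op: "inj_on matrix_op Gamma_carrier"
  by (intro inj_onI ext) (metis ell2_nth_matrix_op_unit_vec)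

lemma matrix_op_plus:
  "A \<in> Gamma_carrier \<Longrightarrow> B \<in> Gamma_carrier \<Longrightarrow>
    matrix_op (\<lambda>i j. A i j + B i j) = (\<lambda>x. matrix_op A x + matrix_op B x)"
  by (rule matrix_op_eqI)
    (simp_all add: Gamma_closed_add B_plus matrix_op_in_B ell2_rep_eqs ell2_nth_matrix_op_unit_vec)

lemma matrix_op_minus:
  "A \<in> Gamma_carrier \<Longrightarrow> B \<in> Gamma_carrier \<Longrightarrow>
    matrix_op (\<lambda>i j. A i j - B i j) = (\<lambda>x. matrix_op A x - matrix_op B x)"
  by (rule matrix_op_eqI)
    (simp_all add: Gamma_closed_diff B_minus_op matrix_op_in_B ell2_rep_eqs ell2_nth_matrix_op_unit_vec)

lemma matrix_op_mult:
  assumes "A \<in> Gamma_carrier" "B \<in> Gamma_carrier"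
  shows "matrix_op (A \<otimes>\<^bsub>\<Gamma>\<^sup>\<infinity>\<^esub> B) = matrix_op A \<circ> matrix_op B"
proof (rule matrix_op_eqI[OF Gamma_closed_mult[OF assms] B_comp[OF assms[THEN matrix_op_in_B]]])
  show "ell2_nth ((matrix_op A \<circ> matrix_op B) (unit_vec n)) i = (A \<otimes>\<^bsub>\<Gamma>\<^sup>\<infinity>\<^esub> B) i n" for i n
    unfolding Gamma_mult comp_def
    by (subst ell2_nth_matrix_op) (simp_all add: assms ell2_nth_matrix_op_unit_vec)
qed

lemma Gamma_one_closed: "(\<lambda>i j. if i = j then 1 else 0) \<in> Gamma_carrier"
  using diag_matrix_in_Gamma[of "\<lambda>_. 1"] by (auto simp: diag_matrix_def linf_iff)

lemma matrix_op_ring_hom: "matrix_op \<in> ring_hom \<Gamma>\<^sup>\<infinity> \<B>"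
proof (rule ring_hom_memI)
  show "matrix_op \<one>\<^bsub>\<Gamma>\<^sup>\<infinity>\<^esub> = \<one>\<^bsub>\<B>\<^esub>"
    unfolding Gamma_one B_ops by (rule matrix_op_eqI) (auto simp: Gamma_one_closed B_id unit_vec.rep_eq)
qed (simp_all add: matrix_op_in_B matrix_op_mult matrix_op_plus Gamma_plus)

lemma matrix_op_diag_matrix:
  "\<alpha> \<in> carrier linf \<Longrightarrow> matrix_op (diag_matrix \<alpha>) = diag_op \<alpha>"
  by (rule matrix_op_eqI[OF diag_matrix_in_Gamma diag_op_in_B])
    (auto simp: diag_op_unit_vec ell2_rep_eqs unit_vec.rep_eq diag_matrix_def)

context symmetric_seq_ideal
begin

lemma diag_image_B: "diag_op ` S \<subseteq> carrier \<B>"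
  using diag_op_in_B S_linf by auto

lemma ideal_J: "ideal (J_ideal S) \<B>"
  unfolding J_ideal_def by (rule ring.genideal_ideal[OF ring_bounded_ops diag_image_B])

lemma diag_in_J: "\<alpha> \<in> S \<Longrightarrow> diag_op \<alpha> \<in> J_ideal S"
  unfolding J_ideal_def using ring.genideal_self[OF ring_bounded_ops diag_image_B] by auto

lemma J_B: "T \<in> J_ideal S \<Longrightarrow> T \<in> carrier \<B>"
  using ideal_J by (meson additive_subgroup.a_Hcarr ideal.axioms(1))

lemma J_left: "T \<in> J_ideal S \<Longrightarrow> U \<in> carrier \<B> \<Longrightarrow> (\<lambda>x. U (T x)) \<in> J_ideal S"
  using ideal.I_l_closed[OF ideal_J, of T U] by (simp add: comp_def)

lemma J_right: "T \<in> J_ideal S \<Longrightarrow> U \<in> carrier \<B> \<Longrightarrow> (\<lambda>x. T (U x)) \<in> J_ideal S"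
  using ideal.I_r_closed[OF ideal_J, of T U] by (simp add: comp_def)

lemma J_plus: "T \<in> J_ideal S \<Longrightarrow> U \<in> J_ideal S \<Longrightarrow> (\<lambda>x. T x + U x) \<in> J_ideal S"
  using additive_subgroup.a_closed[OF ideal.axioms(1)[OF ideal_J], of T U] by simp

lemma J_zero: "(\<lambda>x. 0) \<in> J_ideal S"
  using additive_subgroup.zero_closed[OF ideal.axioms(1)[OF ideal_J]] by simp

lemma J_scale: "T \<in> J_ideal S \<Longrightarrow> (\<lambda>x. c *\<^sub>C T x) \<in> J_ideal S"
  using J_left[OF _ B_scale[OF B_id(2)], of T c] by simp

lemma J_minus: "T \<in> J_ideal S \<Longrightarrow> U \<in> J_ideal S \<Longrightarrow> (\<lambda>x. T x - U x) \<in> J_ideal S"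
  using J_plus[OF _ J_scale[of U "-1"], of T] by (simp add: scaleC_minus_left)

text \<open>Dividing each row by its largest entry writes a matrix of \<open>I_S\<close> as a diagonal matrix
  with entries in \<open>S\<close> times a matrix with entries in the unit disc.\<close>

lemma matrix_op_I_ideal: assumes "A \<in> I_ideal S" shows "matrix_op A \<in> J_ideal S"
proof -
  have AG: "A \<in> Gamma_carrier" using assms I_ideal_Gamma by auto
  have "\<exists>k. \<forall>j. cmod (A i j) \<le> cmod (A i k)" for i
  proof (cases "\<exists>j. A i j \<noteq> 0")
    case True
    have f: "finite {j. A i j \<noteq> 0}" using AG by (rule Gamma_elim)
    define X where "X = (\<lambda>j. cmod (A i j)) ` {j. A i j \<noteq> 0}"
    have X: "finite X" "X \<noteq> {}" using f True by (auto simp: X_def)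
    obtain k where k: "Max X = cmod (A i k)" using Max_in[OF X] by (auto simp: X_def)
    have "cmod (A i j) \<le> cmod (A i k)" for j
    proof (cases "A i j = 0")
      case False
      then show ?thesis unfolding k[symmetric] by (intro Max_ge X(1)) (auto simp: X_def)
    qed simp
    then show ?thesis by blast
  qed auto
  then obtain k where k: "\<And>i j. cmod (A i j) \<le> cmod (A i (k i))" by metis
  define \<alpha> where "\<alpha> i = A i (k i)" for i
  define W where "W i j = A i j / \<alpha> i" for i j
  have "(\<lambda>n. case_prod A (prod_decode n)) \<in> S" using assms by (simp add: I_ideal_def)
  from S_reindex[OF this, of "\<lambda>n. prod_encode (n, k n)" UNIV]
  have \<alpha>: "\<alpha> \<in> S" by (simp add: inj_on_def \<alpha>_def[abs_def])
  obtain C N where A: "C \<ge> 0" "\<And>i j. cmod (A i j) \<le> C"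
    "\<And>i. finite {j. A i j \<noteq> 0}" "\<And>i. card {j. A i j \<noteq> 0} \<le> N"
    "\<And>j. finite {i. A i j \<noteq> 0}" "\<And>j. card {i. A i j \<noteq> 0} \<le> N"
    using AG by (rule Gamma_elim) blast
  have W: "W \<in> Gamma_carrier"
  proof (rule Gamma_intro[where R = "\<lambda>i. {j. A i j \<noteq> 0}" and Q = "\<lambda>j. {i. A i j \<noteq> 0}"])
    show "cmod (W i j) \<le> 1" for i j
      using k[of i j] by (cases "\<alpha> i = 0") (auto simp: W_def \<alpha>_def norm_divide divide_le_eq)
  qed (use A in \<open>auto simp: W_def\<close>)
  have "matrix_op A = (\<lambda>x. diag_op \<alpha> (matrix_op W x))"
  proof (rule matrix_op_eqI[OF AG])
    show "(\<lambda>x. diag_op \<alpha> (matrix_op W x)) \<in> carrier \<B>"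
      using J_right[OF diag_in_J[OF \<alpha>] matrix_op_in_B[OF W]] by (rule J_B)
    show "ell2_nth (diag_op \<alpha> (matrix_op W (unit_vec n))) i = A i n" for i n
      using k[of i n] by (cases "\<alpha> i = 0")
        (auto simp: ell2_nth_diag_op S_linf[OF \<alpha>] ell2_nth_matrix_op_unit_vec[OF W] W_def \<alpha>_def)
  qed
  then show ?thesis using J_right[OF diag_in_J[OF \<alpha>] matrix_op_in_B[OF W]] by simp
qed

end

section \<open>Traces of finite rank operators\<close>

lemma orthonormal_spanning_set:
  fixes U :: "'a::real_inner set"
  assumes "finite U"
  obtains B where "finite B" "card B \<le> card U" "span B = span U" "pairwise orthogonal B" "\<And>v. v \<in> B \<Longrightarrow> norm v = 1"
proof -
  obtain C where C: "finite C" "card C \<le> card U" "span C = span U" "pairwise orthogonal C"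
    using basis_orthogonal[OF assms] by blast
  define B where "B = (\<lambda>v. (1 / norm v) *\<^sub>R v) ` (C - {0})"
  have "span B = span (C - {0})"
    unfolding B_def by (rule span_image_scale) (use C in auto)
  then have "span B = span U" using C(3) by simp
  moreover have "card B \<le> card U"
    using card_image_le[of "C - {0}" "\<lambda>v. (1 / norm v) *\<^sub>R v"] card_mono[of C "C - {0}"] C by (auto simp: B_def)
  moreover have "pairwise orthogonal B"
  proof (rule pairwiseI)
    fix x y assume "x \<in> B" "y \<in> B" "x \<noteq> y"
    then obtain v w where "x = (1 / norm v) *\<^sub>R v" "y = (1 / norm w) *\<^sub>R w" "v \<in> C" "w \<in> C" "v \<noteq> w"
      by (auto simp: B_def)
    then show "orthogonal x y" using C(4) by (auto simp: pairwise_def orthogonal_def)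
  qed
  moreover have "norm v = 1" if "v \<in> B" for v using that by (auto simp: B_def split: if_splits)
  moreover have "finite B" using C(1) by (simp add: B_def)
  ultimately show thesis using that[of B] by blast
qed

text \<open>The numbers \<open>w k (u k)\<close> add up to the complex trace of the finite rank
  operator in the last hypothesis. Its real trace is twice the real part of the complex one, and is
  computed in an orthonormal basis of the real span of the vectors u k and i u k. That span has
  dimension at most \<open>2 * card K\<close>, and each basis vector contributes at most c.\<close>

lemma finite_rank_trace_real:
  fixes u :: "'k \<Rightarrow> ell2" and w :: "'k \<Rightarrow> ell2 \<Rightarrow> complex"
  assumes K: "finite K" and w: "\<And>k. linear (w k)" "\<And>k x. w k (\<i> *\<^sub>C x) = \<i> * w k x"
    and F: "\<And>x. norm (\<Sum>k\<in>K. w k x *\<^sub>C u k) \<le> c * norm x"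
  shows "\<bar>\<Sum>k\<in>K. Re (w k (u k))\<bar> \<le> real (card K) * c"
proof -
  define U where "U = u ` K \<union> (\<lambda>k. \<i> *\<^sub>C u k) ` K"
  have "card U \<le> card (u ` K) + card ((\<lambda>k. \<i> *\<^sub>C u k) ` K)" unfolding U_def by (rule card_Un_le)
  also have "\<dots> \<le> 2 * card K" using card_image_le[OF K, of u] card_image_le[OF K, of "\<lambda>k. \<i> *\<^sub>C u k"] by linarith
  finally have cU: "card U \<le> 2 * card K" .
  have "finite U" using K by (simp add: U_def)
  then obtain B where B: "finite B" "card B \<le> card U" "span B = span U" "pairwise orthogonal B" "\<And>v. v \<in> B \<Longrightarrow> norm v = 1"
    by (rule orthonormal_spanning_set) blast
  have ex: "x = (\<Sum>v\<in>B. (x \<bullet> v) *\<^sub>R v)" if "x \<in> U" for x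
    using orthonormal_basis_expand[OF B(4,5) _ B(1), of x] B(3) span_base[OF that] by simp
  have wB: "w k x = (\<Sum>v\<in>B. (x \<bullet> v) *\<^sub>R w k v)" if "x \<in> U" for x k
    using arg_cong[OF ex[OF that], of "w k"] by (simp add: linear_sum[OF w(1)] linear_scale[OF w(1)])
  have "2 * Re (w k (u k)) = (\<Sum>v\<in>B. (w k v *\<^sub>C u k) \<bullet> v)" if "k \<in> K" for k
  proof -
    \<comment> \<open>Expanding first u k and then i u k in \<open>B\<close> gives two formulas for
      the same number; termwise they add up to a real inner product with v.\<close>
    have "Re (w k (u k)) = (\<Sum>v\<in>B. (u k \<bullet> v) * Re (w k v))"
      using that by (subst wB) (auto simp: U_def)
    moreover have "Re (w k (u k)) = (\<Sum>v\<in>B. ((\<i> *\<^sub>C u k) \<bullet> v) * Im (w k v))"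
    proof -
      have "Re (w k (u k)) = Im (w k (\<i> *\<^sub>C u k))" by (simp add: w(2))
      also have "\<dots> = (\<Sum>v\<in>B. ((\<i> *\<^sub>C u k) \<bullet> v) * Im (w k v))"
        using that by (subst wB) (auto simp: U_def)
      finally show ?thesis .
    qed
    ultimately have "2 * Re (w k (u k)) = (\<Sum>v\<in>B. (u k \<bullet> v) * Re (w k v) + ((\<i> *\<^sub>C u k) \<bullet> v) * Im (w k v))"
      by (simp add: sum.distrib)
    also have "\<dots> = (\<Sum>v\<in>B. (w k v *\<^sub>C u k) \<bullet> v)"
      by (intro sum.cong refl) (subst scaleC_Complex, simp add: inner_add_left mult_ac)
    finally show ?thesis .
  qed
  then have "2 * (\<Sum>k\<in>K. Re (w k (u k))) = (\<Sum>k\<in>K. \<Sum>v\<in>B. (w k v *\<^sub>C u k) \<bullet> v)"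
    by (simp add: sum_distrib_left)
  also have "\<dots> = (\<Sum>v\<in>B. (\<Sum>k\<in>K. w k v *\<^sub>C u k) \<bullet> v)"
    by (subst sum.swap) (simp add: inner_sum_left)
  finally have eq: "2 * (\<Sum>k\<in>K. Re (w k (u k))) = (\<Sum>v\<in>B. (\<Sum>k\<in>K. w k v *\<^sub>C u k) \<bullet> v)" .
  have c: "c \<ge> 0" using order_trans[OF norm_ge_zero F[of "unit_vec 0"]] by simp
  have "\<bar>\<Sum>v\<in>B. (\<Sum>k\<in>K. w k v *\<^sub>C u k) \<bullet> v\<bar> \<le> (\<Sum>v\<in>B. c)"
  proof (rule order_trans[OF sum_abs], rule sum_mono)
    fix v assume v: "v \<in> B"
    have "\<bar>(\<Sum>k\<in>K. w k v *\<^sub>C u k) \<bullet> v\<bar> \<le> norm (\<Sum>k\<in>K. w k v *\<^sub>C u k) * norm v"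
      by (rule Cauchy_Schwarz_ineq2)
    then show "\<bar>(\<Sum>k\<in>K. w k v *\<^sub>C u k) \<bullet> v\<bar> \<le> c" using F[of v] B(5)[OF v] by simp
  qed
  also have "\<dots> \<le> real (2 * card K) * c"
    using B(2) cU c by (simp add: mult_right_mono)
  finally show ?thesis using eq by simp
qed

lemma finite_rank_trace:
  fixes u :: "'k \<Rightarrow> ell2" and w :: "'k \<Rightarrow> ell2 \<Rightarrow> complex"
  assumes K: "finite K" and w: "\<And>k. linear (w k)" "\<And>k x. w k (\<i> *\<^sub>C x) = \<i> * w k x"
    and F: "\<And>x. norm (\<Sum>k\<in>K. w k x *\<^sub>C u k) \<le> c * norm x"
  shows "cmod (\<Sum>k\<in>K. w k (u k)) \<le> 2 * real (card K) * c"
proof -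
  have "\<bar>Re (\<Sum>k\<in>K. w k (u k))\<bar> \<le> real (card K) * c"
    using finite_rank_trace_real[OF assms] by simp
  moreover have "\<bar>Im (\<Sum>k\<in>K. w k (u k))\<bar> \<le> real (card K) * c"
  proof -
    \<comment> \<open>The factor -i turns the imaginary part of the trace into the real part and
      preserves the norm bound.\<close>
    have "linear (\<lambda>x. - \<i> * w k x)" for k
      by (intro linearI) (simp_all add: linear_add[OF w(1)] linear_scale[OF w(1)] algebra_simps)
    moreover have "norm (\<Sum>k\<in>K. (- \<i> * w k x) *\<^sub>C u k) \<le> c * norm x" for x
    proof -
      have "(\<Sum>k\<in>K. (- \<i> * w k x) *\<^sub>C u k) = (- \<i>) *\<^sub>C (\<Sum>k\<in>K. w k x *\<^sub>C u k)"
        by (subst B_sum[OF B_scale[OF B_id(2)]]) simp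
      then show ?thesis using F[of x] by simp
    qed
    ultimately show ?thesis
      using finite_rank_trace_real[OF K, of "\<lambda>k x. - \<i> * w k x" u c] w(2) by simp
  qed
  ultimately show ?thesis using cmod_le[of "\<Sum>k\<in>K. w k (u k)"] by linarith
qed

section \<open>Factorisations through a diagonal operator\<close>

type_synonym op_pairs = "((ell2 \<Rightarrow> ell2) \<times> (ell2 \<Rightarrow> ell2)) list"

abbreviation of_reals :: "(nat \<Rightarrow> real) \<Rightarrow> nat \<Rightarrow> complex"
  where "of_reals a \<equiv> \<lambda>n. complex_of_real (a n)"

text \<open>The factors are kept as data: the numbers \<open>diag_coeff\<close> depend on the chosen
  factorisation and not on the operator alone.\<close>

definition factored :: "(nat \<Rightarrow> real) \<Rightarrow> op_pairs \<Rightarrow> ell2 \<Rightarrow> ell2"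
  where "factored a ps x = (\<Sum>(R, L)\<leftarrow>ps. R (diag_op (of_reals a) (L x)))"

definition diag_coeff :: "op_pairs \<Rightarrow> nat \<Rightarrow> complex"
  where "diag_coeff ps j = (\<Sum>(R, L)\<leftarrow>ps. ell2_nth (L (R (unit_vec j))) j)"

abbreviation B_pairs :: "op_pairs \<Rightarrow> bool"
  where "B_pairs ps \<equiv> set ps \<subseteq> carrier \<B> \<times> carrier \<B>"

text \<open>If \<open>T = \<Sum> R D\<^sub>a L\<close>, then the formal trace of \<open>T\<close> is the sum over \<open>j\<close> of the numbers
  \<open>a\<^sub>j (\<Sum> L R)\<^sub>j\<^sub>j\<close>. They are the \<open>\<tau> j\<close> below.\<close>

definition traced :: "(nat \<Rightarrow> real) \<Rightarrow> (ell2 \<Rightarrow> ell2) \<Rightarrow> (nat \<Rightarrow> complex) \<Rightarrow> bool"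
  where "traced a T \<tau> \<longleftrightarrow> (\<exists>ps. B_pairs ps \<and> T = factored a ps \<and> (\<forall>j. \<tau> j = of_real (a j) * diag_coeff ps j))"

lemma factored_simps [simp]:
  "factored a [] = (\<lambda>x. 0)"
  "factored a (p # ps) x = fst p (diag_op (of_reals a) (snd p x)) + factored a ps x"
  "factored a (ps @ qs) x = factored a ps x + factored a qs x"
  by (auto simp: factored_def case_prod_unfold)

lemma diag_coeff_simps [simp]:
  "diag_coeff [] j = 0"
  "diag_coeff (p # ps) j = ell2_nth (snd p (fst p (unit_vec j))) j + diag_coeff ps j"
  "diag_coeff (ps @ qs) j = diag_coeff ps j + diag_coeff qs j"
  by (auto simp: diag_coeff_def case_prod_unfold)

lemma of_reals_linf: "(\<And>n. 0 \<le> a n) \<Longrightarrow> decseq a \<Longrightarrow> of_reals a \<in> carrier linf"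
  by (auto simp: linf_iff decseq_def intro!: exI[of _ "a 0"])

lemma factored_in_B:
  assumes "of_reals a \<in> carrier linf" "B_pairs ps" shows "factored a ps \<in> carrier \<B>"
  using assms(2)
proof (induction ps)
  case (Cons p ps)
  then have "(\<lambda>x. (fst p \<circ> diag_op (of_reals a) \<circ> snd p) x + factored a ps x) \<in> carrier \<B>"
    by (intro B_plus B_comp diag_op_in_B assms(1)) auto
  then show ?case by (simp add: factored_simps(2)[abs_def])
qed (simp add: B_zero_op)

lemma traced_zero: "traced a (\<lambda>x. 0) (\<lambda>j. 0)"
  unfolding traced_def by (rule exI[of _ "[]"]) simp

lemma traced_add:
  assumes "traced a T \<tau>" "traced a U \<upsilon>" shows "traced a (\<lambda>x. T x + U x) (\<lambda>j. \<tau> j + \<upsilon> j)"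
proof -
  obtain ps qs where "B_pairs ps" "T = factored a ps" "\<forall>j. \<tau> j = of_real (a j) * diag_coeff ps j"
    "B_pairs qs" "U = factored a qs" "\<forall>j. \<upsilon> j = of_real (a j) * diag_coeff qs j"
    using assms unfolding traced_def by blast
  then show ?thesis unfolding traced_def
    by (intro exI[of _ "ps @ qs"]) (auto simp: fun_eq_iff algebra_simps)
qed

text \<open>Y is attached to R as Y R in one product and to L as L Y in the other. Both times the
  diagonal of L Y R results, so the trace property holds term by term.\<close>

lemma traced_comp:
  assumes "traced a T \<tau>" "Y \<in> carrier \<B>"
  obtains \<upsilon> where "traced a (\<lambda>x. Y (T x)) \<upsilon>" "traced a (\<lambda>x. T (Y x)) \<upsilon>"
proof -
  obtain ps where ps: "B_pairs ps" "T = factored a ps" using assms unfolding traced_def by blast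
  define ql where "ql = map (\<lambda>(R, L). (Y \<circ> R, L)) ps"
  define qr where "qr = map (\<lambda>(R, L). (R, L \<circ> Y)) ps"
  have "Y (factored a ps x) = factored a ql x" for x
    unfolding ql_def by (induction ps) (auto simp: B_zero[OF assms(2)] B_add[OF assms(2)])
  moreover have "factored a ps (Y x) = factored a qr x" for x
    unfolding qr_def by (induction ps) auto
  moreover have "diag_coeff ql j = diag_coeff qr j" for j
    unfolding ql_def qr_def by (induction ps) auto
  moreover have "B_pairs ql" "B_pairs qr"
    using ps(1) assms(2) B_comp by (auto simp: ql_def qr_def)
  ultimately have *: "traced a (\<lambda>x. Y (T x)) (\<lambda>j. of_real (a j) * diag_coeff ql j)"
    and "traced a (\<lambda>x. T (Y x)) (\<lambda>j. of_real (a j) * diag_coeff qr j)"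
    unfolding traced_def ps(2) by (auto simp: fun_eq_iff intro: exI[of _ ql] exI[of _ qr])
  moreover have "diag_coeff ql = diag_coeff qr" unfolding ql_def qr_def fun_eq_iff by (intro allI, induction ps) auto
  ultimately show thesis using that by simp
qed

lemma traced_uminus:
  assumes "traced a T \<tau>" shows "traced a (\<lambda>x. - T x) (\<lambda>j. - \<tau> j)"
proof -
  obtain ps where ps: "B_pairs ps" "T = factored a ps" "\<forall>j. \<tau> j = of_real (a j) * diag_coeff ps j"
    using assms unfolding traced_def by blast
  define qs where "qs = map (\<lambda>(R, L). (\<lambda>x. - R x, L)) ps"
  have "- factored a ps x = factored a qs x" for x
    unfolding qs_def by (induction ps) auto
  moreover have "- diag_coeff ps j = diag_coeff qs j" for j
    unfolding qs_def using ps(1)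
    by (induction ps) (auto simp: B_minus ell2_rep_eqs)
  moreover have "B_pairs qs" using ps(1) by (auto simp: qs_def B_uminus)
  ultimately show ?thesis unfolding traced_def ps(2) using ps(3)
    by (intro exI[of _ qs]) (auto simp: fun_eq_iff, metis mult_minus_right)
qed

lemma traced_diff:
  "traced a T \<tau> \<Longrightarrow> traced a U \<upsilon> \<Longrightarrow> traced a (\<lambda>x. T x - U x) (\<lambda>j. \<tau> j - \<upsilon> j)"
  using traced_add[OF _ traced_uminus, of a T \<tau> U \<upsilon>] by simp

lemma traced_commutator:
  assumes "traced a T \<tau>" "Y \<in> carrier \<B>"
  shows "traced a (\<lambda>x. Y (T x) - T (Y x)) (\<lambda>j. 0)"
proof -
  obtain \<upsilon> where "traced a (\<lambda>x. Y (T x)) \<upsilon>" "traced a (\<lambda>x. T (Y x)) \<upsilon>"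
    using traced_comp[OF assms] .
  from traced_diff[OF this] show ?thesis by simp
qed

text \<open>Write a = b \<rho> with 0 \<le> \<rho> \<le> 1 and move the diagonal operator of \<rho>
  into L; the factor split off from a reappears in the diagonal coefficients. This brings two
  operators to a common sequence.\<close>

lemma traced_mono:
  assumes "traced a T \<tau>" "\<And>n. 0 \<le> a n" "\<And>n. a n \<le> b n" "decseq b"
  shows "traced b T \<tau>"
proof -
  obtain ps where ps: "B_pairs ps" "T = factored a ps" "\<forall>j. \<tau> j = of_real (a j) * diag_coeff ps j"
    using assms(1) unfolding traced_def by blast
  have b0: "b n \<ge> 0" for n using assms(2,3) order_trans by blast
  have bl: "of_reals b \<in> carrier linf" using b0 assms(4) by (rule of_reals_linf)
  define \<rho> where "\<rho> n = complex_of_real (a n / b n)" for n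
  have "cmod (\<rho> n) \<le> 1" for n
    using assms(2,3)[of n] b0[of n] by (simp add: \<rho>_def norm_divide divide_le_eq del: of_real_divide)
  then have \<rho>: "\<rho> \<in> carrier linf" by (auto simp: linf_iff)
  have a_eq: "of_real (b n) * \<rho> n = of_real (a n)" for n
  proof (cases "b n = 0")
    case True
    then have "a n = 0" using assms(2,3)[of n] by simp
    then show ?thesis using True by (simp add: \<rho>_def)
  qed (simp add: \<rho>_def)
  have al: "of_reals a \<in> carrier linf"
  proof -
    have "cmod (of_reals a n) \<le> b 0" for n
      using assms(2)[of n] assms(3)[of n] decseqD[OF assms(4), of 0 n] by simp
    then show ?thesis by (auto simp: linf_iff)
  qed
  define qs where "qs = map (\<lambda>(R, L). (R, diag_op \<rho> \<circ> L)) ps"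
  have d: "diag_op (of_reals b) (diag_op \<rho> x) = diag_op (of_reals a) x" for x
    by (rule ell2_eqI) (simp add: ell2_nth_diag_op \<rho> bl al a_eq mult.assoc[symmetric])
  have "factored a ps x = factored b qs x" for x
    unfolding qs_def by (induction ps) (auto simp: d)
  moreover have "diag_coeff qs j = \<rho> j * diag_coeff ps j" for j
    unfolding qs_def by (induction ps) (auto simp: ell2_nth_diag_op[OF \<rho>] distrib_left)
  moreover have "B_pairs qs" using ps(1) B_comp[OF diag_op_in_B[OF \<rho>]] by (auto simp: qs_def)
  ultimately show ?thesis unfolding traced_def ps(2) using ps(3)
    by (intro exI[of _ qs]) (auto simp: fun_eq_iff mult.assoc[symmetric] a_eq)
qed

text \<open>As a decreases, the truncated diagonal operator has norm at most a n. So C is the sum of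
  products of bounds for R and L, the same for all n.\<close>

lemma factored_tail_bound:
  assumes "B_pairs ps" "decseq a" "\<And>n. 0 \<le> a n"
  shows "\<exists>C\<ge>0. \<forall>n x. norm (factored (\<lambda>j. if j < n then 0 else a j) ps x) \<le> C * a n * norm x"
  using assms(1)
proof (induction ps)
  case Nil
  then show ?case by (intro exI[of _ 0]) simp
next
  case (Cons p ps)
  then obtain C where C: "C \<ge> 0" "\<And>n x. norm (factored (\<lambda>j. if j < n then 0 else a j) ps x) \<le> C * a n * norm x" by auto
  have p: "fst p \<in> carrier \<B>" "snd p \<in> carrier \<B>" using Cons.prems by auto
  obtain K where K: "K > 0" "\<And>x. norm (fst p x) \<le> K * norm x" using B_bound[OF p(1)] by blast
  obtain M where M: "M > 0" "\<And>x. norm (snd p x) \<le> M * norm x" using B_bound[OF p(2)] by blast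
  have "norm (factored (\<lambda>j. if j < n then 0 else a j) (p # ps) x) \<le> (K * M + C) * a n * norm x" for n x
  proof -
    have "norm (diag_op (\<lambda>j. complex_of_real (if j < n then 0 else a j)) (snd p x)) \<le> a n * norm (snd p x)"
      by (rule norm_diag_op_le) (use assms(3) decseqD[OF assms(2)] in auto)
    also have "\<dots> \<le> a n * (M * norm x)" by (intro mult_left_mono M assms)
    finally have "norm (fst p (diag_op (\<lambda>j. complex_of_real (if j < n then 0 else a j)) (snd p x))) \<le> K * (a n * (M * norm x))"
      using K by (meson mult_left_mono order_trans less_imp_le)
    from norm_triangle_mono[OF this C(2)] show ?thesis by (simp add: algebra_simps)
  qed
  then show ?case using K M C by (intro exI[of _ "K * M + C"]) auto
qed

lemma diag_op_split:
  assumes "\<alpha> \<in> carrier linf"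
  shows "diag_op \<alpha> x = (\<Sum>j<n. (\<alpha> j * ell2_nth x j) *\<^sub>C unit_vec j) + diag_op (\<lambda>j. if j < n then 0 else \<alpha> j) x"
proof (rule ell2_eqI)
  fix i
  obtain C where C: "\<And>n. cmod (\<alpha> n) \<le> C" using assms by (auto simp: linf_iff)
  have "cmod (if j < n then 0 else \<alpha> j) \<le> C" for j using C[of j] order_trans[OF norm_ge_zero C[of j]] by simp
  then have tl: "(\<lambda>j. if j < n then 0 else \<alpha> j) \<in> carrier linf" unfolding linf_iff by blast
  have "ell2_nth (\<Sum>j<n. (\<alpha> j * ell2_nth x j) *\<^sub>C unit_vec j) i = (\<Sum>j<n. if j = i then \<alpha> j * ell2_nth x j else 0)"
    unfolding ell2_nth_sum by (intro sum.cong) (auto simp: ell2_rep_eqs unit_vec.rep_eq)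
  then show "ell2_nth (diag_op \<alpha> x) i
      = ell2_nth ((\<Sum>j<n. (\<alpha> j * ell2_nth x j) *\<^sub>C unit_vec j) + diag_op (\<lambda>j. if j < n then 0 else \<alpha> j) x) i"
    by (simp add: ell2_rep_eqs ell2_nth_diag_op[OF assms] ell2_nth_diag_op[OF tl])
qed

text \<open>The head is displayed as \<open>length ps * n\<close> products of a functional and a
  vector, the form in which its rank and its trace are estimated.\<close>

lemma factored_split:
  assumes "B_pairs ps" "decseq a" "\<And>n. 0 \<le> a n"
  shows "factored a ps x = (\<Sum>k\<in>{..<length ps} \<times> {..<n}.
      (of_real (a (snd k)) * ell2_nth (snd (ps ! fst k) x) (snd k)) *\<^sub>C fst (ps ! fst k) (unit_vec (snd k)))
    + factored (\<lambda>j. if j < n then 0 else a j) ps x"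
proof -
  have al: "of_reals a \<in> carrier linf" using assms(2,3) by (intro of_reals_linf) auto
  have d: "diag_op (of_reals a) y = (\<Sum>j<n. (of_real (a j) * ell2_nth y j) *\<^sub>C unit_vec j)
      + diag_op (\<lambda>j. complex_of_real (if j < n then 0 else a j)) y" for y
  proof -
    have "(\<lambda>j. complex_of_real (if j < n then 0 else a j)) = (\<lambda>j. if j < n then 0 else of_real (a j))" by auto
    then show ?thesis using diag_op_split[OF al, of y n] by metis
  qed
  have "factored a ps x = (\<Sum>i<length ps. \<Sum>j<n. (of_real (a j) * ell2_nth (snd (ps ! i) x) j) *\<^sub>C fst (ps ! i) (unit_vec j))
    + factored (\<lambda>j. if j < n then 0 else a j) ps x"
    using assms(1)
  proof (induction ps)
    case (Cons p ps)
    have p: "fst p \<in> carrier \<B>" using Cons.prems by auto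
    have "fst p (diag_op (of_reals a) (snd p x))
        = (\<Sum>j<n. (of_real (a j) * ell2_nth (snd p x) j) *\<^sub>C fst p (unit_vec j))
          + fst p (diag_op (\<lambda>j. complex_of_real (if j < n then 0 else a j)) (snd p x))"
      by (subst d) (simp only: B_add[OF p] B_sum[OF p] B_scaleC[OF p])
    then show ?case using Cons by (simp add: sum.lessThan_Suc_shift del: sum.lessThan_Suc)
  qed simp
  then show ?thesis by (simp add: sum.cartesian_product case_prod_unfold)
qed

lemma diag_coeff_sum: "diag_coeff ps j = (\<Sum>i<length ps. ell2_nth (snd (ps ! i) (fst (ps ! i) (unit_vec j))) j)"
  by (induction ps) (simp_all add: sum.lessThan_Suc_shift del: sum.lessThan_Suc)

text \<open>The head of a vanishing sum \<open>\<Sum> R D\<^sub>a L\<close> is minus its tail; it has small rank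
  and small norm, hence small trace.\<close>

lemma traced_zero_averages:
  assumes "traced a (\<lambda>x. 0) \<tau>" "decseq a" "\<And>n. 0 \<le> a n"
  shows "\<exists>C. \<forall>n. cmod (\<Sum>j<n. \<tau> j) \<le> C * real n * a n"
proof -
  obtain ps where ps: "B_pairs ps" "\<And>x. factored a ps x = 0" "\<And>j. \<tau> j = of_real (a j) * diag_coeff ps j"
    using assms(1) unfolding traced_def by metis
  obtain C where C: "C \<ge> 0" "\<And>n x. norm (factored (\<lambda>j. if j < n then 0 else a j) ps x) \<le> C * a n * norm x"
    using factored_tail_bound[OF ps(1) assms(2,3)] by blast
  have "cmod (\<Sum>j<n. \<tau> j) \<le> (2 * length ps * C) * real n * a n" for n
  proof -
    \<comment> \<open>The default 0 beyond the list makes \<open>w k\<close> linear for every k, not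
      only for those in \<open>K\<close>.\<close>
    define w where "w k x = (if fst k < length ps then of_real (a (snd k)) * ell2_nth (snd (ps ! fst k) x) (snd k) else 0)" for k x
    define u where "u k = fst (ps ! fst k) (unit_vec (snd k))" for k
    define K where "K = {..<length ps} \<times> {..<n}"
    have L: "snd (ps ! i) \<in> carrier \<B>" if "i < length ps" for i using ps(1) nth_mem[OF that] by auto
    have "cmod (\<Sum>k\<in>K. w k (u k)) \<le> 2 * real (card K) * (C * a n)"
    proof (rule finite_rank_trace)
      show "finite K" by (simp add: K_def)
      show "linear (w k)" for k
      proof (cases "fst k < length ps")
        case True
        show ?thesis using True
          by (intro linearI) (simp_all add: w_def B_add[OF L] linear_scale[OF bounded_linear.linear[OF B_bounded_linear[OF L]]] ell2_rep_eqs algebra_simps)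
      qed (intro linearI, simp_all add: w_def)
      show "w k (\<i> *\<^sub>C x) = \<i> * w k x" for k x
        by (simp add: w_def B_scaleC[OF L] ell2_rep_eqs)
      show "norm (\<Sum>k\<in>K. w k x *\<^sub>C u k) \<le> C * a n * norm x" for x
      proof -
        have "(\<Sum>k\<in>K. w k x *\<^sub>C u k) = (\<Sum>k\<in>{..<length ps} \<times> {..<n}.
            (of_real (a (snd k)) * ell2_nth (snd (ps ! fst k) x) (snd k)) *\<^sub>C fst (ps ! fst k) (unit_vec (snd k)))"
          by (intro sum.cong) (auto simp: K_def w_def u_def)
        then have "(\<Sum>k\<in>K. w k x *\<^sub>C u k) + factored (\<lambda>j. if j < n then 0 else a j) ps x = 0"
          using factored_split[OF ps(1) assms(2,3), of x n] ps(2)[of x] by simp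
        then have "(\<Sum>k\<in>K. w k x *\<^sub>C u k) = - factored (\<lambda>j. if j < n then 0 else a j) ps x"
          by (simp add: eq_neg_iff_add_eq_0)
        then show ?thesis using C(2)[of n x] by simp
      qed
    qed
    \<comment> \<open>The trace of the head: for fixed j, the sum over the pairs (R, L) is the trace
      term with index j.\<close>
    moreover have "(\<Sum>k\<in>K. w k (u k)) = (\<Sum>j<n. \<tau> j)"
    proof -
      have "(\<Sum>k\<in>K. w k (u k)) = (\<Sum>i<length ps. \<Sum>j<n. of_real (a j) * ell2_nth (snd (ps ! i) (fst (ps ! i) (unit_vec j))) j)"
        unfolding K_def sum.cartesian_product by (intro sum.cong) (auto simp: w_def u_def)
      also have "\<dots> = (\<Sum>j<n. \<tau> j)"
        by (subst sum.swap) (simp add: ps(3) diag_coeff_sum sum_distrib_left)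
      finally show ?thesis .
    qed
    ultimately show ?thesis by (simp add: K_def mult_ac)
  qed
  then show ?thesis by blast
qed

lemma B_subgroup_commutators:
  assumes "I \<subseteq> carrier \<B>" shows "subgroup (commutator_subgroup \<B> I) (add_monoid \<B>)"
  using ring_bounded_ops assms
  by (intro commutator_subgroup_subgroup) (auto intro: ring.is_abelian_group B_comp)

section \<open>Majorants and trace terms for elements of the ideals\<close>

context symmetric_seq_ideal
begin

text \<open>If an element of \<open>S\<close> has modulus at least \<epsilon> on an infinite set,
  its pullback along the enumeration of that set is bounded below, which forces 1 into
  \<open>S\<close>.\<close>

lemma S_null_or_linf: "S = carrier linf \<or> (\<forall>\<alpha>\<in>S. \<alpha> \<longlonglongrightarrow> 0)"
proof (rule disjCI)
  assume "\<not> (\<forall>\<alpha>\<in>S. \<alpha> \<longlonglongrightarrow> 0)"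
  then obtain \<alpha> \<epsilon> where \<alpha>: "\<alpha> \<in> S" and \<epsilon>: "\<epsilon> > 0" "\<And>N. \<exists>n\<ge>N. cmod (\<alpha> n) \<ge> \<epsilon>"
    unfolding lim_sequentially by (auto simp: not_less)
  define X where "X = {n. cmod (\<alpha> n) \<ge> \<epsilon>}"
  have X: "infinite X" unfolding X_def infinite_nat_iff_unbounded_le using \<epsilon>(2) by auto
  have "(\<lambda>n. if n \<in> UNIV then \<alpha> (enumerate X n) else 0) \<in> S"
    using strict_mono_enumerate[OF X] by (intro S_reindex[OF \<alpha>] strict_mono_imp_inj_on)
  then have "(\<lambda>n. 1) \<in> S"
  proof (rule S_dominated[where C = "1 / \<epsilon>"])
    show "cmod 1 \<le> 1 / \<epsilon> * cmod (if n \<in> UNIV then \<alpha> (enumerate X n) else 0)" for n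
      using enumerate_in_set[OF X, of n] \<epsilon>(1) by (simp add: X_def)
  qed
  then have "\<beta> \<in> S" if "\<beta> \<in> carrier linf" for \<beta> using S_mult[OF _ that] by fastforce
  then show "S = carrier linf" using S_linf by auto
qed

text \<open>Members of \<open>S\<close> whose tails are controlled by one value; up to rearrangement
  they dominate all of \<open>S\<close>.\<close>

definition majorant :: "(nat \<Rightarrow> real) \<Rightarrow> bool"
  where "majorant a \<longleftrightarrow> decseq a \<and> (\<forall>n. 0 \<le> a n) \<and> of_reals a \<in> S"

lemma majorantD: "majorant a \<Longrightarrow> decseq a" "majorant a \<Longrightarrow> 0 \<le> a n" "majorant a \<Longrightarrow> of_reals a \<in> S"
  by (auto simp: majorant_def)

lemma majorant_add: "majorant a \<Longrightarrow> majorant b \<Longrightarrow> majorant (\<lambda>n. a n + b n)"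
  using S_add[of "of_reals a" "of_reals b"] by (auto simp: majorant_def decseq_def add_mono)

text \<open>For a null sequence, f ranks the nonzero entries by decreasing modulus and a lists the
  moduli in that order. A bounded sequence may have no decreasing rearrangement, but when
  \<open>S\<close> is all of \<ell>^\<infinity> a constant bound serves.\<close>

lemma ex_majorant:
  assumes "\<alpha> \<in> S"
  shows "\<exists>a D f. majorant a \<and> inj_on f D \<and> (\<forall>n. n \<notin> D \<longrightarrow> \<alpha> n = 0) \<and> (\<forall>n\<in>D. cmod (\<alpha> n) \<le> a (f n))"
  using S_null_or_linf
proof
  assume S: "S = carrier linf"
  obtain C where C: "\<And>n. cmod (\<alpha> n) \<le> C" using assms by (rule S_bounded) blast
  have "C \<ge> 0" using C[of 0] norm_ge_zero order_trans by blast
  moreover have "(\<lambda>_. complex_of_real C) \<in> S" unfolding S by (auto simp: linf_iff)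
  ultimately have "majorant (\<lambda>_. C)" unfolding majorant_def by (auto simp: decseq_def)
  then show ?thesis using C by (intro exI[of _ "\<lambda>_. C"] exI[of _ UNIV] exI[of _ "\<lambda>n. n"]) auto
next
  assume "\<forall>\<alpha>\<in>S. \<alpha> \<longlonglongrightarrow> 0"
  then have lim: "\<alpha> \<longlonglongrightarrow> 0" using assms by auto
  define r where "r n = cmod (\<alpha> n)" for n
  define D where "D = {n. \<alpha> n \<noteq> 0}"
  \<comment> \<open>Ties in modulus are broken by the index. As \<alpha> tends to 0, only finitely
    many entries precede a nonzero one, so the cardinality \<open>f n\<close> is a genuine
    rank.\<close>
  define pred where "pred n = {m \<in> D. r m > r n \<or> r m = r n \<and> m < n}" for n
  define f where "f n = card (pred n)" for n
  have fin: "finite (pred n)" if "n \<in> D" for n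
  proof -
    have "\<forall>\<^sub>F m in sequentially. r m < r n"
      using tendsto_norm[OF lim] that unfolding r_def by (intro order_tendstoD) (auto simp: D_def)
    then obtain N where N: "\<And>m. m \<ge> N \<Longrightarrow> r m < r n" by (auto simp: eventually_sequentially)
    then have "pred n \<subseteq> {..<N}" unfolding pred_def by (smt (verit) lessThan_iff mem_Collect_eq not_less subsetI)
    then show ?thesis by (rule finite_subset) simp
  qed
  have less: "f m < f n" if "m \<in> pred n" "n \<in> D" for m n
    unfolding f_def by (rule psubset_card_mono[OF fin]) (use that in \<open>auto simp: pred_def\<close>)
  have inj: "inj_on f D"
  proof (rule inj_onI)
    fix m n assume mn: "m \<in> D" "n \<in> D" "f m = f n"
    have "m \<in> pred n \<or> n \<in> pred m \<or> m = n" using mn by (auto simp: pred_def)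
    then show "m = n" using less[of m n] less[of n m] mn by auto
  qed
  define a where "a k = cmod (pushforward D f \<alpha> k)" for k
  have af: "a (f n) = r n" if "n \<in> D" for n
    using pushforward_apply[OF inj that, of \<alpha>] by (simp add: a_def r_def)
  have "a (Suc k) \<le> a k" for k
  proof (cases "Suc k \<in> f ` D")
    case True
    then obtain n where n: "n \<in> D" "Suc k = f n" by auto
    have pD: "pred n \<subseteq> D" by (auto simp: pred_def)
    \<comment> \<open>The ranks have no gaps, by counting: with \<open>Suc k\<close> also k is a
      rank, namely that of a predecessor.\<close>
    have "f ` pred n = {..<f n}"
    proof (rule card_subset_eq)
      show "f ` pred n \<subseteq> {..<f n}" using less n by auto
      show "card (f ` pred n) = card {..<f n}"
        using card_image[OF inj_on_subset[OF inj pD]] by (simp add: f_def)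
    qed simp
    then obtain m where "m \<in> pred n" "k = f m" using n by (metis imageE lessI lessThan_iff)
    then show ?thesis using af n by (auto simp: pred_def)
  qed (simp add: a_def pushforward_outside)
  then have "decseq a" by (rule decseq_SucI)
  moreover have "of_reals a \<in> S"
    by (rule S_dominated[OF S_pushforward[OF assms inj], of _ 1]) (simp add: a_def)
  ultimately have "majorant a" by (simp add: majorant_def a_def)
  then show ?thesis using inj af
    by (intro exI[of _ a] exI[of _ D] exI[of _ f]) (auto simp: D_def r_def)
qed

text \<open>diag \<alpha> = W D_a V, where V carries e_n to e_(f n) and W carries it back with
  weight \<alpha>_n / a_(f n). As V W is diagonal, the trace terms are the entries of \<alpha>,
  moved by f.\<close>

lemma diag_traced:
  assumes "\<alpha> \<in> S"
  shows "\<exists>a D f. majorant a \<and> inj_on f D \<and> (\<forall>n. n \<notin> D \<longrightarrow> \<alpha> n = 0) \<and>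
    (\<forall>j. cmod (pushforward D f \<alpha> j) \<le> a j) \<and> traced a (diag_op \<alpha>) (pushforward D f \<alpha>)"
proof -
  obtain a D f where a: "majorant a" and f: "inj_on f D" and D: "\<And>n. n \<notin> D \<Longrightarrow> \<alpha> n = 0"
    and le: "\<And>n. n \<in> D \<Longrightarrow> cmod (\<alpha> n) \<le> a (f n)" using ex_majorant[OF assms] by blast
  have al: "of_reals a \<in> carrier linf" using a majorantD(3) S_linf by blast
  define \<rho> where "\<rho> n = (if n \<in> D then \<alpha> n / of_real (a (f n)) else 0)" for n
  have \<rho>: "\<rho> \<in> carrier linf"
  proof -
    have "cmod (\<rho> n) \<le> 1" for n
      using le[of n] majorantD(2)[OF a, of "f n"] by (auto simp: \<rho>_def norm_divide divide_le_eq)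
    then show ?thesis by (auto simp: linf_iff)
  qed
  define W where "W i j = (if i \<in> D \<and> j = f i then \<rho> i else 0)" for i j
  define V where "V j i = (if i \<in> D \<and> j = f i then 1 else 0 :: complex)" for j i
  have W: "W \<in> Gamma_carrier" unfolding W_def using Gamma_partial_injection(1)[OF f \<rho>] .
  have V: "V \<in> Gamma_carrier" unfolding V_def using Gamma_partial_injection(2)[OF f, of "\<lambda>_. 1"] by (auto simp: linf_iff)
  have Vu: "matrix_op V (unit_vec n) = (if n \<in> D then unit_vec (f n) else 0)" for n
    by (rule ell2_eqI) (auto simp: ell2_nth_matrix_op_unit_vec[OF V] V_def unit_vec.rep_eq ell2_rep_eqs)
  have Wu: "matrix_op W (unit_vec (f n)) = \<rho> n *\<^sub>C unit_vec n" if "n \<in> D" for n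
    by (rule ell2_eqI) (use that f in \<open>auto simp: ell2_nth_matrix_op_unit_vec[OF W] W_def unit_vec.rep_eq ell2_rep_eqs inj_on_def\<close>)
  have Wu0: "matrix_op W (unit_vec j) = 0" if "j \<notin> f ` D" for j
    by (rule ell2_eqI) (use that in \<open>auto simp: ell2_nth_matrix_op_unit_vec[OF W] W_def ell2_rep_eqs\<close>)
  have WB: "matrix_op W \<in> carrier \<B>" and VB: "matrix_op V \<in> carrier \<B>" using W V by (simp_all add: matrix_op_in_B)
  have \<rho>a: "of_real (a (f n)) * \<rho> n = \<alpha> n" if "n \<in> D" for n
    using le[OF that] that by (cases "a (f n) = 0") (auto simp: \<rho>_def)
  have "diag_op \<alpha> = (\<lambda>x. matrix_op W (diag_op (of_reals a) (matrix_op V x)))"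
  proof (rule B_eqI)
    show "(\<lambda>x. matrix_op W (diag_op (of_reals a) (matrix_op V x))) \<in> carrier \<B>"
      using B_comp[OF B_comp[OF WB diag_op_in_B[OF al]] VB] by (simp add: comp_def)
    show "diag_op \<alpha> (unit_vec n) = matrix_op W (diag_op (of_reals a) (matrix_op V (unit_vec n)))" for n
    proof (cases "n \<in> D")
      case True
      then show ?thesis
        by (simp add: diag_op_unit_vec S_linf assms Vu al B_scaleC[OF WB] Wu \<rho>a)
    next
      case False
      then show ?thesis
        by (simp add: diag_op_unit_vec S_linf assms Vu D B_zero[OF WB] B_zero[OF diag_op_in_B[OF al]])
    qed
  qed (use assms diag_op_in_B S_linf in auto)
  moreover have "pushforward D f \<alpha> j = of_real (a j) * ell2_nth (matrix_op V (matrix_op W (unit_vec j))) j" for j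
  proof (cases "j \<in> f ` D")
    case True
    then obtain n where n: "n \<in> D" "j = f n" by auto
    then show ?thesis
      using pushforward_apply[OF f n(1), of \<alpha>] \<rho>a[OF n(1)]
      by (simp add: Wu B_scaleC[OF VB] Vu ell2_rep_eqs unit_vec.rep_eq)
  next
    case False
    then show ?thesis by (simp add: pushforward_outside Wu0 B_zero[OF VB] ell2_rep_eqs)
  qed
  ultimately have "traced a (diag_op \<alpha>) (pushforward D f \<alpha>)"
    unfolding traced_def using WB VB by (intro exI[of _ "[(matrix_op W, matrix_op V)]"]) (auto simp: fun_eq_iff)
  moreover have "cmod (pushforward D f \<alpha> j) \<le> a j" for j
  proof (cases "j \<in> f ` D")
    case True
    then show ?thesis using pushforward_apply[OF f, of _ \<alpha>] le by auto
  qed (simp add: pushforward_outside majorantD(2)[OF a])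
  ultimately show ?thesis using a f D by blast
qed

lemma traced_in_B: "majorant a \<Longrightarrow> traced a T \<tau> \<Longrightarrow> T \<in> carrier \<B>"
  unfolding traced_def using factored_in_B S_linf majorantD(3) by blast

lemma traced_majorant_mono:
  assumes "traced a T \<tau>" "majorant a" "majorant b"
  shows "traced (\<lambda>n. a n + b n) T \<tau>" "traced (\<lambda>n. b n + a n) T \<tau>"
  using majorant_add[OF assms(2,3)]
  by (auto intro!: traced_mono[OF assms(1)] simp: majorantD[OF assms(2)] majorantD[OF assms(3)] add.commute dest: majorantD)

text \<open>The operators with such a factorisation contain the generators of J_S and form an ideal;
  for a sum, the majorants are added.\<close>

lemma J_traced: assumes "T \<in> J_ideal S" shows "\<exists>a \<tau>. majorant a \<and> traced a T \<tau>"
proof -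
  define X where "X = {T. \<exists>a \<tau>. majorant a \<and> traced a T \<tau>}"
  have XB: "X \<subseteq> carrier \<B>" using traced_in_B by (auto simp: X_def)
  have m0: "majorant (\<lambda>_. 0)" using S_zero by (simp add: majorant_def decseq_def)
  have X_add: "(\<lambda>x. T x + U x) \<in> X" if TU: "T \<in> X" "U \<in> X" for T U
  proof -
    obtain a \<tau> b \<upsilon> where "majorant a" "traced a T \<tau>" "majorant b" "traced b U \<upsilon>" using TU by (auto simp: X_def)
    then show ?thesis unfolding X_def mem_Collect_eq
      using majorant_add traced_add traced_majorant_mono by metis
  qed
  have "ideal X \<B>"
  proof (rule idealI[OF ring_bounded_ops])
    interpret ring \<B> by (rule ring_bounded_ops)
    show "subgroup X (add_monoid \<B>)"
    proof (rule group.subgroupI)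
      show "group (add_monoid \<B>)" by (rule a_group)
      show "X \<noteq> {}" using m0 traced_zero by (auto simp: X_def)
      show "inv\<^bsub>add_monoid \<B>\<^esub> T \<in> X" if "T \<in> X" for T
      proof -
        have "inv\<^bsub>add_monoid \<B>\<^esub> T = (\<lambda>x. - T x)" using B_a_inv[of T] that XB by (auto simp: a_inv_def)
        then show ?thesis using that unfolding X_def mem_Collect_eq by (metis traced_uminus)
      qed
    qed (use XB X_add in auto)
    show "x \<otimes>\<^bsub>\<B>\<^esub> T \<in> X" "T \<otimes>\<^bsub>\<B>\<^esub> x \<in> X" if "T \<in> X" "x \<in> carrier \<B>" for T x
    proof -
      obtain a \<tau> where a: "majorant a" "traced a T \<tau>" using \<open>T \<in> X\<close> by (auto simp: X_def)
      obtain \<upsilon> where "traced a (\<lambda>y. x (T y)) \<upsilon>" "traced a (\<lambda>y. T (x y)) \<upsilon>"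
        using traced_comp[OF a(2) \<open>x \<in> carrier \<B>\<close>] .
      then show "x \<otimes>\<^bsub>\<B>\<^esub> T \<in> X" "T \<otimes>\<^bsub>\<B>\<^esub> x \<in> X" unfolding X_def B_ops comp_def using a(1) by blast+
    qed
  qed
  moreover have "diag_op ` S \<subseteq> X"
  proof (rule image_subsetI)
    show "diag_op \<alpha> \<in> X" if "\<alpha> \<in> S" for \<alpha> using diag_traced[OF that] unfolding X_def by blast
  qed
  ultimately have "J_ideal S \<subseteq> X" unfolding J_ideal_def by (rule ring.genideal_minimal[OF ring_bounded_ops])
  then show ?thesis using assms by (auto simp: X_def)
qed

abbreviation "B_comm \<equiv> commutator_subgroup \<B> (J_ideal S)"

lemma J_subset_B: "J_ideal S \<subseteq> carrier \<B>"
  using J_B by auto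

lemma subgroup_B_comm: "subgroup B_comm (add_monoid \<B>)"
  by (rule B_subgroup_commutators[OF J_subset_B])

lemma B_comm_add: "T \<in> B_comm \<Longrightarrow> U \<in> B_comm \<Longrightarrow> (\<lambda>x. T x + U x) \<in> B_comm"
  using subgroup.m_closed[OF subgroup_B_comm, of T U] by simp

lemma B_comm_in_B: "T \<in> B_comm \<Longrightarrow> T \<in> carrier \<B>"
  using subgroup.mem_carrier[OF subgroup_B_comm] by simp

lemma B_comm_uminus: "T \<in> B_comm \<Longrightarrow> (\<lambda>x. - T x) \<in> B_comm"
  using subgroup.m_inv_closed[OF subgroup_B_comm, of T] B_a_inv[OF B_comm_in_B, of T] by (simp add: a_inv_def)

lemma B_comm_diff: "T \<in> B_comm \<Longrightarrow> U \<in> B_comm \<Longrightarrow> (\<lambda>x. T x - U x) \<in> B_comm"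
  using B_comm_add[OF _ B_comm_uminus, of T U] by simp

lemma B_commutator:
  assumes "Y \<in> carrier \<B>" "T \<in> J_ideal S" shows "(\<lambda>x. Y (T x) - T (Y x)) \<in> B_comm"
  using commutator_in_subgroup[of Y \<B> T "J_ideal S"] assms J_B[OF assms(2)]
  by (simp add: B_a_minus B_comp)

text \<open>A single commutator has a factorisation with vanishing terms by
  \<open>traced_commutator\<close>, and this survives negatives and, over a common majorant,
  sums.\<close>

lemma B_comm_traced: assumes "Z \<in> B_comm" shows "\<exists>a. majorant a \<and> traced a Z (\<lambda>_. 0)"
  using assms unfolding commutator_subgroup_def
proof (induction rule: generate.induct)
  case one
  show ?case using S_zero traced_zero by (intro exI[of _ "\<lambda>_. 0"]) (auto simp: majorant_def decseq_def)
next
  case (incl Z)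
  then obtain Y T where YT: "Y \<in> carrier \<B>" "T \<in> J_ideal S" "Z = Y \<otimes>\<^bsub>\<B>\<^esub> T \<ominus>\<^bsub>\<B>\<^esub> T \<otimes>\<^bsub>\<B>\<^esub> Y" by auto
  then have "Z = (\<lambda>x. Y (T x) - T (Y x))" using J_B[OF YT(2)] by (simp add: B_a_minus B_comp)
  then show ?case using J_traced[OF YT(2)] traced_commutator[OF _ YT(1)] by metis
next
  case (inv Z)
  then obtain Y T where YT: "Y \<in> carrier \<B>" "T \<in> J_ideal S" "Z = Y \<otimes>\<^bsub>\<B>\<^esub> T \<ominus>\<^bsub>\<B>\<^esub> T \<otimes>\<^bsub>\<B>\<^esub> Y" by auto
  then have Z: "Z = (\<lambda>x. Y (T x) - T (Y x))" using J_B[OF YT(2)] by (simp add: B_a_minus B_comp)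
  obtain a where a: "majorant a" "traced a Z (\<lambda>_. 0)"
    using J_traced[OF YT(2)] traced_commutator[OF _ YT(1)] unfolding Z by metis
  have "inv\<^bsub>add_monoid \<B>\<^esub> Z = (\<lambda>x. - Z x)" using B_a_inv[OF traced_in_B[OF a]] by (simp add: a_inv_def)
  then show ?case using traced_uminus[OF a(2)] a(1) by auto
next
  case (eng Z Z')
  then obtain a b where ab: "majorant a" "traced a Z (\<lambda>_. 0)" "majorant b" "traced b Z' (\<lambda>_. 0)" by blast
  have "traced (\<lambda>n. a n + b n) (\<lambda>x. Z x + Z' x) (\<lambda>_. 0)"
    using traced_add[OF traced_majorant_mono(1)[OF ab(2,1,3)] traced_majorant_mono(2)[OF ab(4,3,1)]] by simp
  then show ?case using majorant_add[OF ab(1,3)] by auto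
qed

text \<open>The operator has one factorisation with zero terms, as a sum of commutators, and another
  with terms f_* \<beta>. Their difference factors the zero operator with terms f_* \<beta>, so that
  the partial sums of f_* \<beta> are small.\<close>

lemma null_of_diag_in_B_comm:
  assumes "\<beta> \<in> S" "diag_op \<beta> \<in> B_comm" shows "\<beta> \<in> null_seqs S"
proof -
  obtain a where a: "majorant a" "traced a (diag_op \<beta>) (\<lambda>_. 0)" using B_comm_traced[OF assms(2)] by blast
  obtain b D f where b: "majorant b" "inj_on f D" "\<And>n. n \<notin> D \<Longrightarrow> \<beta> n = 0"
    "\<And>j. cmod (pushforward D f \<beta> j) \<le> b j" "traced b (diag_op \<beta>) (pushforward D f \<beta>)"
    using diag_traced[OF assms(1)] by blast
  note m = majorant_add[OF a(1) b(1)]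
  have "traced (\<lambda>n. a n + b n) (\<lambda>x. 0) (pushforward D f \<beta>)"
    using traced_diff[OF traced_majorant_mono(2)[OF b(5,1) a(1)] traced_majorant_mono(1)[OF a(2,1) b(1)]] by simp
  then obtain C where C: "\<And>n. cmod (\<Sum>j<n. pushforward D f \<beta> j) \<le> C * real n * (a n + b n)"
    using traced_zero_averages[of "\<lambda>n. a n + b n"] majorantD[OF m] by blast
  have "pushforward D f \<beta> \<in> null_seqs S"
  proof (rule null_of_small_averages[OF majorantD[OF m] _ C])
    show "cmod (pushforward D f \<beta> n) \<le> a n + b n" for n
      using b(4)[of n] majorantD(2)[OF a(1), of n] by linarith
  qed
  then show ?thesis using null_if_pushforward_null[OF assms(1) b(2,3)] by blast
qed

end

section \<open>Compact self-adjoint operators\<close>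

text \<open>For bounded sequences, coordinatewise convergence to 0 is weak convergence to 0, see
  \<open>cinner_weak_null\<close>.\<close>

definition weak_null :: "(nat \<Rightarrow> ell2) \<Rightarrow> bool"
  where "weak_null y \<longleftrightarrow> (\<exists>M. \<forall>n. norm (y n) \<le> M) \<and> (\<forall>j. (\<lambda>n. ell2_nth (y n) j) \<longlonglongrightarrow> 0)"

text \<open>Complete continuity, which on a Hilbert space is the same as compactness.\<close>

definition compact_op :: "(ell2 \<Rightarrow> ell2) \<Rightarrow> bool"
  where "compact_op T \<longleftrightarrow> T \<in> carrier \<B> \<and> (\<forall>y. weak_null y \<longrightarrow> (\<lambda>n. T (y n)) \<longlonglongrightarrow> 0)"

lemma tendsto_zero_if_approx:
  fixes f :: "nat \<Rightarrow> 'a::real_normed_vector"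
  assumes "\<And>\<epsilon>. \<epsilon> > 0 \<Longrightarrow> \<exists>g. g \<longlonglongrightarrow> (0::real) \<and> (\<forall>n. norm (f n) \<le> g n + \<epsilon>)"
  shows "f \<longlonglongrightarrow> 0"
proof (rule tendstoI)
  fix e :: real assume e: "e > 0"
  then obtain g where g: "g \<longlonglongrightarrow> 0" "\<And>n. norm (f n) \<le> g n + e / 2" using assms[of "e / 2"] by auto
  have "\<forall>\<^sub>F n in sequentially. g n < e / 2" using g(1) e by (intro order_tendstoD) auto
  then show "\<forall>\<^sub>F n in sequentially. dist (f n) 0 < e"
  proof eventually_elim
    case (elim n)
    then show ?case using g(2)[of n] by simp
  qed
qed

lemma cinner_weak_null: assumes "weak_null y" shows "(\<lambda>n. cinner f (y n)) \<longlonglongrightarrow> 0"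
proof (rule tendsto_zero_if_approx)
  fix \<epsilon> :: real assume \<epsilon>: "\<epsilon> > 0"
  obtain M where M: "\<And>n. norm (y n) \<le> M" using assms by (auto simp: weak_null_def)
  define t where "t N = (\<Sum>k<N. ell2_nth f k *\<^sub>C unit_vec k)" for N
  have "t \<longlonglongrightarrow> f" using unit_vec_sums[of f] by (simp add: sums_def t_def[abs_def])
  then have "(\<lambda>N. norm (f - t N) * M) \<longlonglongrightarrow> norm (f - f) * M" by (intro tendsto_intros)
  then have "\<forall>\<^sub>F N in sequentially. norm (f - t N) * M < \<epsilon>" using \<epsilon> by (intro order_tendstoD) auto
  then obtain N where N: "norm (f - t N) * M < \<epsilon>" by (auto simp: eventually_sequentially)
  define g where "g n = (\<Sum>k<N. cmod (ell2_nth f k) * cmod (ell2_nth (y n) k))" for n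
  have "g \<longlonglongrightarrow> (\<Sum>k<N. cmod (ell2_nth f k) * cmod 0)"
    unfolding g_def using assms by (intro tendsto_intros) (auto simp: weak_null_def)
  moreover have "cmod (cinner f (y n)) \<le> g n + \<epsilon>" for n
  proof -
    have "cinner (t N) (y n) = (\<Sum>k<N. cnj (ell2_nth f k) * ell2_nth (y n) k)"
      by (simp add: t_def cinner_sum_left cinner_unit_vec)
    then have "cmod (cinner (t N) (y n)) \<le> g n"
      unfolding g_def by (auto intro!: order_trans[OF norm_sum] simp: norm_mult)
    moreover have "cmod (cinner (f - t N) (y n)) \<le> \<epsilon>"
    proof -
      have "cmod (cinner (f - t N) (y n)) \<le> norm (f - t N) * norm (y n)" by (rule norm_cinner)
      also have "\<dots> \<le> norm (f - t N) * M" by (intro mult_left_mono M) auto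
      finally show ?thesis using N by simp
    qed
    moreover have "cinner f (y n) = cinner (t N) (y n) + cinner (f - t N) (y n)"
      by (simp add: cinner_diff_left)
    ultimately show ?thesis using norm_triangle_mono by metis
  qed
  ultimately show "\<exists>g. g \<longlonglongrightarrow> 0 \<and> (\<forall>n. cmod (cinner f (y n)) \<le> g n + \<epsilon>)" by auto
qed

lemma weak_null_image: assumes "weak_null y" "L \<in> carrier \<B>" shows "weak_null (\<lambda>n. L (y n))"
  unfolding weak_null_def
proof
  obtain M where M: "\<And>n. norm (y n) \<le> M" using assms by (auto simp: weak_null_def)
  obtain K where K: "K > 0" "\<And>x. norm (L x) \<le> K * norm x" using B_bound[OF assms(2)] by blast
  have "norm (L (y n)) \<le> K * M" for n using K(2)[of "y n"] mult_left_mono[OF M[of n], of K] K(1) by linarith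
  then show "\<exists>M. \<forall>n. norm (L (y n)) \<le> M" by blast
  have "ell2_nth (L (y n)) j = cinner (adj L (unit_vec j)) (y n)" for j n
    using arg_cong[OF cinner_adj[OF assms(2), of "y n" "unit_vec j"], of cnj] by (simp add: cinner_unit_vec)
  then show "\<forall>j. (\<lambda>n. ell2_nth (L (y n)) j) \<longlonglongrightarrow> 0" using cinner_weak_null[OF assms(1)] by simp
qed

lemma diag_op_weak_null:
  assumes "weak_null y" "\<alpha> \<longlonglongrightarrow> 0" "\<alpha> \<in> carrier linf" shows "(\<lambda>n. diag_op \<alpha> (y n)) \<longlonglongrightarrow> 0"
proof (rule tendsto_zero_if_approx)
  fix \<epsilon> :: real assume \<epsilon>: "\<epsilon> > 0"
  obtain M where M: "\<And>n. norm (y n) \<le> M" using assms by (auto simp: weak_null_def)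
  have M0: "M \<ge> 0" using M[of 0] norm_ge_zero order_trans by blast
  \<comment> \<open>Dividing by M + 1 covers the case M = 0.\<close>
  have "\<forall>\<^sub>F j in sequentially. cmod (\<alpha> j) < \<epsilon> / (M + 1)"
    using tendsto_norm[OF assms(2)] \<epsilon> M0 by (intro order_tendstoD) auto
  then obtain N where N: "\<And>j. j \<ge> N \<Longrightarrow> cmod (\<alpha> j) < \<epsilon> / (M + 1)" by (auto simp: eventually_sequentially)
  define g where "g n = (\<Sum>j<N. cmod (\<alpha> j) * cmod (ell2_nth (y n) j))" for n
  have "g \<longlonglongrightarrow> (\<Sum>j<N. cmod (\<alpha> j) * cmod 0)"
    unfolding g_def using assms by (intro tendsto_intros) (auto simp: weak_null_def)
  moreover have "norm (diag_op \<alpha> (y n)) \<le> g n + \<epsilon>" for n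
  proof -
    have "norm (\<Sum>j<N. (\<alpha> j * ell2_nth (y n) j) *\<^sub>C unit_vec j) \<le> g n"
      unfolding g_def by (rule order_trans[OF norm_sum]) (simp add: norm_mult)
    moreover have "norm (diag_op (\<lambda>j. if j < N then 0 else \<alpha> j) (y n)) \<le> \<epsilon>"
    proof -
      have "norm (diag_op (\<lambda>j. if j < N then 0 else \<alpha> j) (y n)) \<le> \<epsilon> / (M + 1) * norm (y n)"
        by (rule norm_diag_op_le) (use N \<epsilon> M0 in \<open>auto simp: less_imp_le not_less\<close>)
      also have "\<dots> \<le> \<epsilon> / (M + 1) * (M + 1)" using M[of n] \<epsilon> M0 by (intro mult_left_mono) auto
      finally show ?thesis using M0 by simp
    qed
    ultimately show ?thesis unfolding diag_op_split[OF assms(3), of "y n" N] by (rule norm_triangle_mono)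
  qed
  ultimately show "\<exists>g. g \<longlonglongrightarrow> 0 \<and> (\<forall>n. norm (diag_op \<alpha> (y n)) \<le> g n + \<epsilon>)" by auto
qed

lemma B_tendsto_zero: "T \<in> carrier \<B> \<Longrightarrow> y \<longlonglongrightarrow> 0 \<Longrightarrow> (\<lambda>n. T (y n)) \<longlonglongrightarrow> 0"
  using bounded_linear.tendsto_zero[OF B_bounded_linear] .

lemma factored_weak_null:
  assumes "B_pairs ps" "weak_null y" "of_reals a \<longlonglongrightarrow> 0" "of_reals a \<in> carrier linf"
  shows "(\<lambda>n. factored a ps (y n)) \<longlonglongrightarrow> 0"
  using assms(1)
proof (induction ps)
  case (Cons p ps)
  then have p: "fst p \<in> carrier \<B>" "snd p \<in> carrier \<B>" by auto
  have "(\<lambda>n. fst p (diag_op (of_reals a) (snd p (y n)))) \<longlonglongrightarrow> 0"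
    by (rule B_tendsto_zero[OF p(1) diag_op_weak_null[OF weak_null_image[OF assms(2) p(2)] assms(3,4)]])
  from tendsto_add[OF this Cons.IH] Cons.prems show ?case by simp
qed simp

text \<open>The coordinates lie in a countable product of closed discs, which is sequentially
  compact. Finite partial sums of squares pass to the limit, which therefore stays in the unit
  ball.\<close>

lemma bounded_weak_subsequence:
  fixes x :: "nat \<Rightarrow> ell2"
  assumes "\<And>n. norm (x n) \<le> 1"
  shows "\<exists>r z. strict_mono r \<and> norm z \<le> 1 \<and> weak_null (\<lambda>n. x (r n) - z)"
proof -
  have "compactin (product_topology (\<lambda>i::nat. euclidean :: complex topology) UNIV) (PiE UNIV (\<lambda>_. cball 0 1))"
    unfolding compactin_PiE by auto
  then have "compact (PiE UNIV (\<lambda>_. cball 0 1) :: (nat \<Rightarrow> complex) set)"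
    by (simp add: euclidean_product_topology)
  then have sc: "seq_compact (PiE UNIV (\<lambda>_. cball 0 1) :: (nat \<Rightarrow> complex) set)" by (rule compact_imp_seq_compact)
  have "ell2_nth (x n) \<in> PiE UNIV (\<lambda>_. cball 0 1)" for n
    using order_trans[OF ell2_nth_le_norm assms] by auto
  then obtain l r where lr: "strict_mono r" "((\<lambda>n. ell2_nth (x n)) \<circ> r) \<longlonglongrightarrow> l"
    using sc[unfolded seq_compact_def, rule_format, of "\<lambda>n. ell2_nth (x n)"] by auto
  have l: "(\<lambda>n. ell2_nth (x (r n)) j) \<longlonglongrightarrow> l j" for j
    using continuous_on_tendsto_compose[OF continuous_on_product_coordinates lr(2), of j] by (simp add: comp_def)
  have "(\<Sum>j\<in>F. (cmod (l j))\<^sup>2) \<le> 1\<^sup>2" if "finite F" for F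
  proof (rule LIMSEQ_le_const2)
    show "(\<lambda>n. \<Sum>j\<in>F. (cmod (ell2_nth (x (r n)) j))\<^sup>2) \<longlonglongrightarrow> (\<Sum>j\<in>F. (cmod (l j))\<^sup>2)"
      by (intro tendsto_intros l)
    have "(norm (x n))\<^sup>2 \<le> 1\<^sup>2" for n using assms[of n] by (intro power_mono) auto
    then show "\<exists>N. \<forall>n\<ge>N. (\<Sum>j\<in>F. (cmod (ell2_nth (x (r n)) j))\<^sup>2) \<le> 1\<^sup>2"
      using sum_le_norm_ell2[OF that] order_trans by blast
  qed
  note z = Abs_ell2_bounded[OF this zero_le_one]
  have "norm (x (r n) - Abs_ell2 l) \<le> 2" for n
    using norm_triangle_ineq4[of "x (r n)" "Abs_ell2 l"] assms[of "r n"] z(2) by linarith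
  moreover have "(\<lambda>n. ell2_nth (x (r n) - Abs_ell2 l) j) \<longlonglongrightarrow> 0" for j
    using l[of j] z(1) by (simp add: minus_ell2.rep_eq LIM_zero_iff)
  ultimately have "weak_null (\<lambda>n. x (r n) - Abs_ell2 l)" unfolding weak_null_def by blast
  then show ?thesis using lr(1) z(2) by blast
qed

section \<open>Eigenvectors of compact symmetric operators\<close>

definition compact_symmetric :: "(ell2 \<Rightarrow> ell2) \<Rightarrow> bool"
  where "compact_symmetric H \<longleftrightarrow> compact_op H \<and> (\<forall>x y. cinner (H x) y = cinner x (H y))"

lemma compact_symmetricD:
  assumes "compact_symmetric H"
  shows "H \<in> carrier \<B>" "weak_null y \<Longrightarrow> (\<lambda>n. H (y n)) \<longlonglongrightarrow> 0" "cinner (H x) y' = cinner x (H y')"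
  using assms by (auto simp: compact_symmetric_def compact_op_def)

text \<open>The norm of \<open>H\<close> is attained at some unit vector \<open>z\<close>. Equality in
  \<open>\<bar>\<bar>H\<^sup>2 z - s\<^sup>2 z\<bar>\<bar> \<ge> 0\<close> then shows that \<open>z\<close> is an eigenvector of \<open>H\<^sup>2\<close>, so that
  \<open>(H - s)(H + s) z = 0\<close>.\<close>

lemma top_eigenvector:
  assumes "compact_symmetric H"
  shows "\<exists>g \<mu>. H g = \<mu> *\<^sub>R g \<and> (norm g = 1 \<and> \<mu> \<noteq> 0 \<or> g = 0 \<and> \<mu> = 0) \<and> (\<forall>x. norm (H x) \<le> \<bar>\<mu>\<bar> * norm x)"
proof -
  note H = compact_symmetricD[OF assms]
  note bl = B_bounded_linear[OF H(1)]
  define s where "s = onorm H"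
  have s: "norm (H x) \<le> s * norm x" for x unfolding s_def by (rule onorm[OF bl])
  have s0: "s \<ge> 0" unfolding s_def by (rule onorm_pos_le[OF bl])
  show ?thesis
  proof (cases "s = 0")
    case True
    then show ?thesis using s B_zero[OF H(1)] by (intro exI[of _ 0]) auto
  next
    case False
    then have s1: "s > 0" using s0 by simp
    \<comment> \<open>Numbers strictly below the norm of \<open>H\<close>, each exceeded by
      \<open>H\<close> at some unit vector.\<close>
    define b where "b n = s * (1 - inverse (real (Suc n)))" for n
    have "b \<longlonglongrightarrow> s * (1 - 0)" unfolding b_def by (intro tendsto_intros LIMSEQ_inverse_real_of_nat)
    then have b: "b \<longlonglongrightarrow> s" by simp
    have "\<exists>x. norm x = 1 \<and> norm (H x) > b n" for n
    proof (rule ccontr)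
      assume not: "\<not> ?thesis"
      have "b n \<ge> 0" using s0 unfolding b_def by (intro mult_nonneg_nonneg) (auto simp: divide_simps)
      moreover have "norm (H x) \<le> b n * norm x" for x
      proof (cases "x = 0")
        case True then show ?thesis by (simp add: B_zero[OF H(1)])
      next
        case False
        have "norm (H ((1 / norm x) *\<^sub>R x)) \<le> b n" using not False by (simp add: not_less)
        then show ?thesis using False by (simp add: bounded_linear.linear[OF bl, THEN linear_scale] divide_le_eq)
      qed
      ultimately have "s \<le> b n" unfolding s_def by (rule onorm_bound)
      also have "b n < s * 1" unfolding b_def using s1 by (intro mult_strict_left_mono) auto
      finally show False by simp
    qed
    then obtain x where x: "\<And>n. norm (x n) = 1" "\<And>n. norm (H (x n)) > b n" by metis
    have "norm (x n) \<le> 1" for n by (simp add: x(1))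
    from bounded_weak_subsequence[of x, OF this] obtain r z where
      r: "strict_mono r" and z: "norm z \<le> 1" "weak_null (\<lambda>n. x (r n) - z)" by blast
    have "(\<lambda>n. H (x (r n) - z)) \<longlonglongrightarrow> 0" by (rule H(2)[OF z(2)])
    then have "(\<lambda>n. H (x (r n))) \<longlonglongrightarrow> H z" unfolding B_diff[OF H(1)] by (simp add: LIM_zero_iff)
    then have lim: "(\<lambda>n. norm (H (x (r n)))) \<longlonglongrightarrow> norm (H z)" by (rule tendsto_norm)
    have "(\<lambda>n. b (r n)) \<longlonglongrightarrow> s" using LIMSEQ_subseq_LIMSEQ[OF b r] by (simp add: comp_def)
    from LIMSEQ_le[OF this lim] have "s \<le> norm (H z)" using x(2) less_imp_le by blast
    moreover have "norm (H z) \<le> s * norm z" by (rule s)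
    moreover have "s * norm z \<le> s * 1" using z s0 by (intro mult_left_mono) auto
    ultimately have Hz: "norm (H z) = s" and "s * norm z = s * 1" by linarith+
    then have nz: "norm z = 1" using False by simp
    have "(H z) \<bullet> (H z) = (H (H z)) \<bullet> z" using H(3)[of "H z" z] by (simp flip: Re_cinner)
    then have ip: "(H (H z)) \<bullet> z = s\<^sup>2" using Hz by (simp add: dot_square_norm)
    have "(norm (H (H z) - (s\<^sup>2) *\<^sub>R z))\<^sup>2 = (norm (H (H z)))\<^sup>2 - 2 * s\<^sup>2 * ((H (H z)) \<bullet> z) + (s\<^sup>2)\<^sup>2 * (norm z)\<^sup>2"
      unfolding power2_norm_eq_inner by (simp add: inner_diff_left inner_diff_right inner_commute power2_eq_square algebra_simps)
    moreover have "norm (H (H z)) \<le> s\<^sup>2" using s[of "H z"] by (simp add: Hz power2_eq_square)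
    then have "(norm (H (H z)))\<^sup>2 \<le> (s\<^sup>2)\<^sup>2" by (intro power_mono) auto
    ultimately have "(norm (H (H z) - (s\<^sup>2) *\<^sub>R z))\<^sup>2 \<le> 0" by (simp add: ip nz power2_eq_square)
    then have HHz: "H (H z) = (s\<^sup>2) *\<^sub>R z" by simp
    define v where "v = H z + s *\<^sub>R z"
    note lin = bounded_linear.linear[OF bl, THEN linear_scale]
    show ?thesis
    proof (cases "v = 0")
      case True
      then have "H z = (- s) *\<^sub>R z" by (simp add: v_def eq_neg_iff_add_eq_0)
      then show ?thesis using nz s s1 by (intro exI[of _ z] exI[of _ "- s"]) auto
    next
      case False
      have "H v = s *\<^sub>R v" by (simp add: v_def B_add[OF H(1)] lin HHz algebra_simps power2_eq_square)
      then have "H ((1 / norm v) *\<^sub>R v) = s *\<^sub>R ((1 / norm v) *\<^sub>R v)" by (simp add: lin)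
      then show ?thesis using False s s1 by (intro exI[of _ "(1 / norm v) *\<^sub>R v"] exI[of _ s]) auto
    qed
  qed
qed

lemma rank_one_in_B: "(\<lambda>x. (c * cinner g x) *\<^sub>C g) \<in> carrier \<B>"
proof (rule B_intro)
  show "norm ((c * cinner g x) *\<^sub>C g) \<le> (cmod c * norm g * norm g) * norm x" for x
  proof -
    have "cmod c * cmod (cinner g x) * norm g \<le> cmod c * (norm g * norm x) * norm g"
      by (intro mult_right_mono mult_left_mono norm_cinner) auto
    then show ?thesis by (simp add: norm_mult mult_ac)
  qed
qed (auto simp: cinner_add_right scaleC_add_left algebra_simps)

lemma compact_symmetric_deflate:
  assumes "compact_symmetric H"
  shows "compact_symmetric (\<lambda>x. H x - (complex_of_real \<mu> * cinner g x) *\<^sub>C g)"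
  unfolding compact_symmetric_def compact_op_def
proof (intro conjI allI impI)
  note H = compact_symmetricD[OF assms]
  show "(\<lambda>x. H x - (complex_of_real \<mu> * cinner g x) *\<^sub>C g) \<in> carrier \<B>"
    by (intro B_minus_op H rank_one_in_B)
  show "(\<lambda>n. H (y n) - (complex_of_real \<mu> * cinner g (y n)) *\<^sub>C g) \<longlonglongrightarrow> 0" if "weak_null y" for y
  proof -
    have "(\<lambda>n. norm ((complex_of_real \<mu> * cinner g (y n)) *\<^sub>C g)) \<longlonglongrightarrow> cmod (complex_of_real \<mu> * 0) * norm g"
      unfolding norm_scaleC by (intro tendsto_intros cinner_weak_null that)
    then have "(\<lambda>n. norm ((complex_of_real \<mu> * cinner g (y n)) *\<^sub>C g)) \<longlonglongrightarrow> 0" by (simp del: norm_scaleC)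
    then have "(\<lambda>n. (complex_of_real \<mu> * cinner g (y n)) *\<^sub>C g) \<longlonglongrightarrow> 0" by (rule tendsto_norm_zero_cancel)
    from tendsto_diff[OF H(2)[OF that] this] show ?thesis by simp
  qed
  show "cinner (H x - (complex_of_real \<mu> * cinner g x) *\<^sub>C g) y = cinner x (H y - (complex_of_real \<mu> * cinner g y) *\<^sub>C g)" for x y
    by (simp add: cinner_diff_left cinner_diff_right H(3))
qed

text \<open>Top eigenvectors are split off one after the other. Once the remainder vanishes, the
  pair (0, 0) pads the sequences, so finite rank is no separate case.\<close>

theorem compact_symmetric_spectral:
  assumes "compact_symmetric H"
  shows "\<exists>g \<mu>. (\<forall>n. norm (g n) = 1 \<and> \<mu> n \<noteq> 0 \<or> g n = 0 \<and> \<mu> n = 0) \<and>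
    (\<forall>m n. m \<noteq> n \<longrightarrow> cinner (g m) (g n) = 0) \<and> decseq (\<lambda>n. \<bar>\<mu> n\<bar>) \<and> (\<forall>n. H (g n) = \<mu> n *\<^sub>R g n) \<and>
    (\<forall>N x. norm (H x - (\<Sum>n<N. (complex_of_real (\<mu> n) * cinner (g n) x) *\<^sub>C g n)) \<le> \<bar>\<mu> N\<bar> * norm x)"
proof -
  define eig where "eig T p \<longleftrightarrow> T (fst p) = snd p *\<^sub>R fst p \<and> (norm (fst p) = 1 \<and> snd p \<noteq> 0 \<or> fst p = 0 \<and> snd p = 0)
      \<and> (\<forall>x. norm (T x) \<le> \<bar>snd p\<bar> * norm x)" for T :: "ell2 \<Rightarrow> ell2" and p :: "ell2 \<times> real"
  define pk where "pk T = (SOME p. eig T p)" for T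
  have pk: "eig T (pk T)" if T: "compact_symmetric T" for T
  proof -
    obtain v l where "T v = l *\<^sub>R v" "norm v = 1 \<and> l \<noteq> 0 \<or> v = 0 \<and> l = 0" "\<forall>x. norm (T x) \<le> \<bar>l\<bar> * norm x"
      using top_eigenvector[OF T] by blast
    then have "eig T (v, l)" unfolding eig_def by simp
    then show ?thesis unfolding pk_def by (rule someI)
  qed
  define Hs where "Hs = rec_nat H (\<lambda>_ T x. T x - (complex_of_real (snd (pk T)) * cinner (fst (pk T)) x) *\<^sub>C fst (pk T))"
  define g where "g n = fst (pk (Hs n))" for n
  define \<mu> where "\<mu> n = snd (pk (Hs n))" for n
  have Hs0: "Hs 0 = H" by (simp add: Hs_def)
  have HsS: "Hs (Suc n) x = Hs n x - (complex_of_real (\<mu> n) * cinner (g n) x) *\<^sub>C g n" for n x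
    by (simp add: Hs_def g_def \<mu>_def)
  have cs: "compact_symmetric (Hs n)" for n
  proof (induction n)
    case (Suc n)
    from compact_symmetric_deflate[OF this, of "\<mu> n" "g n"] show ?case by (simp add: HsS[abs_def])
  qed (simp add: Hs0 assms)
  have e: "Hs n (g n) = \<mu> n *\<^sub>R g n" "norm (g n) = 1 \<and> \<mu> n \<noteq> 0 \<or> g n = 0 \<and> \<mu> n = 0"
    "norm (Hs n x) \<le> \<bar>\<mu> n\<bar> * norm x" for n x
    using pk[OF cs[of n]] by (auto simp: eig_def g_def \<mu>_def)
  have gg: "cinner (g n) (g n) = 1 \<or> g n = 0" for n using e(2)[of n] by (auto simp: cinner_self)
  have lc: "complex_of_real (\<mu> n) * cinner (g n) y = cinner (Hs n (g n)) y" for n y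
    unfolding e(1) by (simp flip: scaleC_of_real)
  \<comment> \<open>A step kills the eigenvector just removed; on those killed before, symmetry of
    the remainder makes the correction term vanish.\<close>
  have kill: "m < n \<Longrightarrow> Hs n (g m) = 0" for m n
  proof (induction n)
    case (Suc n)
    show ?case
    proof (cases "m = n")
      case True
      then show ?thesis using gg[of n] by (auto simp: HsS e(1) scaleC_of_real B_zero[OF compact_symmetricD(1)[OF cs]])
    next
      case False
      then have "Hs n (g m) = 0" using Suc by simp
      moreover have "complex_of_real (\<mu> n) * cinner (g n) (g m) = cinner (g n) (Hs n (g m))"
        unfolding lc by (rule compact_symmetricD(3)[OF cs])
      ultimately show ?thesis unfolding HsS by (simp only: cinner_zero scaleC_zero_left diff_self)
    qed
  qed simp
  have orth_less: "cinner (g n) (g m) = 0" if "m < n" for m n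
  proof -
    have "complex_of_real (\<mu> n) * cinner (g n) (g m) = cinner (g n) (Hs n (g m))"
      unfolding lc by (rule compact_symmetricD(3)[OF cs])
    then show ?thesis using kill[OF that] e(2)[of n] by auto
  qed
  have orth: "cinner (g m) (g n) = 0" if "m \<noteq> n" for m n
    using that orth_less[of m n] orth_less[of n m] cnj_cinner[of "g n" "g m"] by (cases m n rule: linorder_cases) auto
  have sum: "Hs N x = H x - (\<Sum>n<N. (complex_of_real (\<mu> n) * cinner (g n) x) *\<^sub>C g n)" for N x
    by (induction N) (auto simp: Hs0 HsS)
  \<comment> \<open>By orthogonality the new eigenvector is also one of the previous remainder,
    whose norm is at most |\<mu> n|.\<close>
  have "\<bar>\<mu> (Suc n)\<bar> \<le> \<bar>\<mu> n\<bar>" for n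
  proof (cases "g (Suc n) = 0")
    case False
    then have n1: "norm (g (Suc n)) = 1" using e(2)[of "Suc n"] by auto
    have "\<mu> (Suc n) *\<^sub>R g (Suc n) = Hs n (g (Suc n))"
      unfolding e(1)[symmetric] HsS by (simp add: orth)
    then have "\<bar>\<mu> (Suc n)\<bar> = norm (Hs n (g (Suc n)))" using n1 by (metis norm_scaleR mult.right_neutral)
    then show ?thesis using e(3)[of n "g (Suc n)"] n1 by simp
  qed (use e(2)[of "Suc n"] in auto)
  then have "decseq (\<lambda>n. \<bar>\<mu> n\<bar>)" by (rule decseq_SucI)
  moreover have "H (g n) = \<mu> n *\<^sub>R g n" for n
  proof -
    have "(\<Sum>k<n. (complex_of_real (\<mu> k) * cinner (g k) (g n)) *\<^sub>C g k) = 0"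
      by (intro sum.neutral) (auto simp: orth)
    then show ?thesis using sum[of n "g n"] e(1)[of n] by simp
  qed
  moreover have "norm (H x - (\<Sum>n<N. (complex_of_real (\<mu> n) * cinner (g n) x) *\<^sub>C g n)) \<le> \<bar>\<mu> N\<bar> * norm x" for N x
    using e(3)[of N x] by (simp add: sum)
  ultimately show ?thesis using e(2) orth by (intro exI[of _ g] exI[of _ \<mu>]) blast
qed

text \<open>If |\<mu> k| exceeded C a n, then on the span of the first k + 1 eigenvectors the
  operator would stretch every nonzero vector by more than its tail can. The head would be injective
  there, although its real rank is at most \<open>2 * length ps * n \<le> k\<close>.\<close>

lemma factored_eigenvalue_bound:
  assumes ps: "B_pairs ps" and a: "decseq a" "\<And>n. 0 \<le> a n"
    and g: "\<And>n. norm (g n) = 1 \<and> \<mu> n \<noteq> 0 \<or> g n = 0 \<and> \<mu> n = 0" "\<And>m n. m \<noteq> n \<Longrightarrow> cinner (g m) (g n) = 0"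
      "decseq (\<lambda>n. \<bar>\<mu> n\<bar>)" "\<And>n. factored a ps (g n) = \<mu> n *\<^sub>R g n"
  shows "\<exists>C\<ge>0. \<forall>k. \<bar>\<mu> k\<bar> \<le> C * a (k div (2 * length ps + 2))"
proof -
  obtain C where C: "C \<ge> 0" "\<And>n x. norm (factored (\<lambda>j. if j < n then 0 else a j) ps x) \<le> C * a n * norm x"
    using factored_tail_bound[OF ps a] by blast
  have "\<bar>\<mu> k\<bar> \<le> C * a n" if n: "2 * length ps * n \<le> k" for k n
  proof (rule ccontr)
    assume not: "\<not> ?thesis"
    define K where "K = {..<length ps} \<times> {..<n}"
    define w where "w p x = of_real (a (snd p)) * ell2_nth (snd (ps ! fst p) x) (snd p)" for p x
    define u where "u p = fst (ps ! fst p) (unit_vec (snd p))" for p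
    define F where "F x = (\<Sum>p\<in>K. w p x *\<^sub>C u p)" for x
    \<comment> \<open>Dimensions are counted over the reals, so the vectors i u p are added and the
      rank doubles.\<close>
    define U where "U = u ` K \<union> (\<lambda>p. \<i> *\<^sub>C u p) ` K"
    have L: "snd (ps ! fst p) \<in> carrier \<B>" if "p \<in> K" for p
    proof -
      have "ps ! fst p \<in> set ps" using that by (auto simp: K_def)
      then show ?thesis using ps by auto
    qed
    have split: "factored a ps x = F x + factored (\<lambda>j. if j < n then 0 else a j) ps x" for x
      using factored_split[OF ps a, of x n] by (simp add: F_def w_def u_def K_def)
    have linF: "linear F"
    proof (rule linearI)
      show "F (x + y) = F x + F y" for x y unfolding F_def sum.distrib[symmetric]
        by (intro sum.cong refl) (simp add: w_def B_add[OF L] ell2_rep_eqs algebra_simps scaleC_add_left)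
      show "F (r *\<^sub>R x) = r *\<^sub>R F x" for r x unfolding F_def scaleR_sum_right
        by (intro sum.cong refl) (simp add: w_def B_scaleC[OF L] ell2_rep_eqs mult_ac flip: scaleC_of_real)
    qed
    have K: "finite K" "card K = length ps * n" by (simp_all add: K_def)
    have "card U \<le> card (u ` K) + card ((\<lambda>p. \<i> *\<^sub>C u p) ` K)" unfolding U_def by (rule card_Un_le)
    also have "\<dots> \<le> 2 * length ps * n" using card_image_le[OF K(1), of u] card_image_le[OF K(1), of "\<lambda>p. \<i> *\<^sub>C u p"] K(2) by linarith
    finally have cU: "card U \<le> k" using n by linarith
    have fU: "finite U" using K by (simp add: U_def)
    have FU: "F x \<in> span U" for x
      unfolding F_def by (intro span_sum, subst scaleC_Complex, intro span_add span_mul span_base) (auto simp: U_def)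
    define X where "X = g ` {..k}"
    have big: "\<bar>\<mu> i\<bar> > C * a n" if "i \<le> k" for i using not decseqD[OF g(3) that] by linarith
    have pos: "C * a n \<ge> 0" using C a by simp
    have n1: "norm (g i) = 1" if "i \<le> k" for i using big[OF that] pos g(1)[of i] by auto
    have inner0: "g i \<bullet> g j = 0" if "i \<noteq> j" for i j using g(2)[OF that] by (simp flip: Re_cinner)
    have inj: "inj_on g {..k}"
    proof (rule inj_onI)
      fix i j assume "i \<in> {..k}" "j \<in> {..k}" "g i = g j"
      then show "i = j" using inner0[of i j] n1[of i] by (cases "i = j") (auto simp: dot_square_norm)
    qed
    have cX: "card X = Suc k" using card_image[OF inj] by (simp add: X_def)
    have orth: "pairwise orthogonal X"
      by (auto simp: X_def pairwise_def orthogonal_def) (metis inner0)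
    have X0: "0 \<notin> X" using n1 by (force simp: X_def)
    have norm_ge: "norm (factored a ps x) \<ge> \<bar>\<mu> k\<bar> * norm x" if x: "x \<in> span X" for x
    proof -
      have fB: "factored a ps (\<Sum>i\<le>k. c i *\<^sub>R g i) = (\<Sum>i\<le>k. (c i * \<mu> i) *\<^sub>R g i)" for c
      proof -
        have "linear (factored a ps)"
          using bounded_linear.linear[OF B_bounded_linear[OF factored_in_B[OF of_reals_linf ps]]] a by blast
        then show ?thesis by (simp add: linear_sum linear_scale g(4))
      qed
      have ex: "x = (\<Sum>i\<le>k. (x \<bullet> g i) *\<^sub>R g i)"
        using orthonormal_basis_expand[OF orth _ x] n1 by (simp add: X_def sum.reindex[OF inj] image_iff) force
      have pyth: "(norm (\<Sum>i\<le>k. c i *\<^sub>R g i))\<^sup>2 = (\<Sum>i\<le>k. (c i)\<^sup>2)" for c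
        by (subst norm_sum_Pythagorean) (auto simp: pairwise_def orthogonal_def inner0 n1)
      have "(\<bar>\<mu> k\<bar> * norm x)\<^sup>2 = \<bar>\<mu> k\<bar>\<^sup>2 * (\<Sum>i\<le>k. (x \<bullet> g i)\<^sup>2)"
        by (subst (1) ex) (simp add: power_mult_distrib pyth)
      also have "\<dots> \<le> (\<Sum>i\<le>k. (x \<bullet> g i * \<mu> i)\<^sup>2)"
        unfolding sum_distrib_left
      proof (rule sum_mono)
        fix i assume "i \<in> {..k}"
        then have "\<bar>\<mu> k\<bar>\<^sup>2 \<le> \<bar>\<mu> i\<bar>\<^sup>2" using decseqD[OF g(3), of i k] by (intro power_mono) auto
        then show "\<bar>\<mu> k\<bar>\<^sup>2 * (x \<bullet> g i)\<^sup>2 \<le> (x \<bullet> g i * \<mu> i)\<^sup>2"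
          using mult_right_mono[of "\<bar>\<mu> k\<bar>\<^sup>2" "\<bar>\<mu> i\<bar>\<^sup>2" "(x \<bullet> g i)\<^sup>2"]
          by (simp add: power_mult_distrib mult.commute)
      qed
      also have "\<dots> = (norm (factored a ps x))\<^sup>2"
      proof -
        have "factored a ps x = (\<Sum>i\<le>k. (x \<bullet> g i * \<mu> i) *\<^sub>R g i)"
          using fB[of "\<lambda>i. x \<bullet> g i"] by (simp only: ex[symmetric])
        then show ?thesis by (simp only: pyth)
      qed
      finally show ?thesis by (rule power2_le_imp_le) simp
    qed
    have F0: "x = 0" if "x \<in> span X" "F x = 0" for x
    proof -
      have "\<bar>\<mu> k\<bar> * norm x \<le> C * a n * norm x"
        using norm_ge[OF that(1)] split[of x] C(2)[where n = n and x = x] that(2) by simp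
      then show ?thesis using big[of k] by (cases "x = 0") auto
    qed
    have injF: "inj_on F (span X)"
    proof (rule inj_onI)
      fix x y assume "x \<in> span X" "y \<in> span X" "F x = F y"
      then show "x = y" using F0[of "x - y"] by (simp add: span_diff linear_diff[OF linF])
    qed
    have "independent X" by (rule pairwise_orthogonal_independent[OF orth X0])
    then have "independent (F ` X)" by (rule linear_independent_injective_image[OF linF _ injF])
    then have "card (F ` X) \<le> card U" using independent_span_bound[OF fU] FU by blast
    moreover have "card (F ` X) = card X" by (intro card_image inj_on_subset[OF injF] span_superset)
    ultimately show False using cU cX by simp
  qed
  then have "\<bar>\<mu> k\<bar> \<le> C * a (k div (2 * length ps + 2))" for k
  proof -
    \<comment> \<open>The extra 2 in the divisor keeps it positive for an empty list.\<close>
    have "2 * length ps * (k div (2 * length ps + 2)) \<le> (2 * length ps + 2) * (k div (2 * length ps + 2))"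
      by (intro mult_right_mono) auto
    also have "\<dots> \<le> k" by (rule times_div_less_eq_dividend)
    finally show ?thesis using \<open>\<And>n k. 2 * length ps * n \<le> k \<Longrightarrow> \<bar>\<mu> k\<bar> \<le> C * a n\<close> by blast
  qed
  then show ?thesis using C(1) by blast
qed

lemma cinner_sums: "(\<lambda>n. cnj (ell2_nth x n) * ell2_nth y n) sums cinner x y"
proof -
  have "(\<lambda>n. cinner x (ell2_nth y n *\<^sub>C unit_vec n)) sums cinner x y"
    by (rule bounded_linear.sums[OF bounded_linear_cinner_right unit_vec_sums])
  moreover have "cinner x (unit_vec n) = cnj (ell2_nth x n)" for n
    by (metis cinner_unit_vec cnj_cinner)
  ultimately show ?thesis by (simp add: mult.commute)
qed

lemma diag_op_symmetric:
  assumes "of_reals a \<in> carrier linf"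
  shows "cinner (diag_op (of_reals a) x) y = cinner x (diag_op (of_reals a) y)"
  using cinner_sums[of "diag_op (of_reals a) x" y] cinner_sums[of x "diag_op (of_reals a) y"]
  by (simp add: ell2_nth_diag_op[OF assms] mult_ac sums_unique2)

text \<open>The coefficient map of an orthonormal system padded with zeros, bounded by Bessel's
  inequality.\<close>

lemma Bessel_op:
  assumes g: "\<And>n::nat. norm (g n) = 1 \<or> g n = 0" "\<And>m n. m \<noteq> n \<Longrightarrow> cinner (g m) (g n) = 0"
  obtains W where "W \<in> carrier \<B>" "\<And>x n. ell2_nth (W x) n = cinner (g n) x"
proof -
  have b: "(\<Sum>n\<in>F. (cmod (cinner (g n) x))\<^sup>2) \<le> (norm x)\<^sup>2" if F: "finite F" for F x
  proof -
    \<comment> \<open>The orthogonal projection of x to the span of the g n with n in F; its squared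
      norm is the partial sum in question.\<close>
    define z where "z = (\<Sum>n\<in>F. cinner (g n) x *\<^sub>C g n)"
    define s where "s = (\<Sum>n\<in>F. (cmod (cinner (g n) x))\<^sup>2)"
    have gz: "cinner (g n) z = cinner (g n) x" if "n \<in> F" for n
    proof -
      have "cinner (g n) z = (\<Sum>k\<in>F. if k = n then cinner (g n) x * cinner (g n) (g n) else 0)"
        unfolding z_def cinner_sum_right using g(2) by (intro sum.cong) auto
      also have "\<dots> = cinner (g n) x" using F that g(1)[of n] by (auto simp: cinner_self)
      finally show ?thesis .
    qed
    have cc: "cinner y (g n) * cinner (g n) y = of_real ((cmod (cinner (g n) y))\<^sup>2)" for n y
      by (metis cnj_cinner complex_norm_square mult.commute)
    have "cinner z z = (\<Sum>n\<in>F. cinner x (g n) * cinner (g n) x)"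
      by (subst z_def) (simp add: cinner_sum_left gz)
    then have "of_real ((norm z)\<^sup>2) = complex_of_real s" unfolding cinner_self cc s_def of_real_sum .
    then have nz: "(norm z)\<^sup>2 = s" by (simp only: of_real_eq_iff)
    have "cinner z x = (\<Sum>n\<in>F. cinner x (g n) * cinner (g n) x)"
      by (simp add: z_def cinner_sum_left)
    then have "cinner z x = of_real s" unfolding cc s_def of_real_sum .
    then have "s \<le> norm z * norm x" using norm_cinner[of z x] by simp
    then have "norm z * norm z \<le> norm z * norm x" using nz by (simp add: power2_eq_square)
    then have "norm z \<le> norm x" by (cases "norm z = 0") auto
    then have "(norm z)\<^sup>2 \<le> (norm x)\<^sup>2" by (intro power_mono) auto
    then show ?thesis unfolding nz by (simp add: s_def)
  qed
  define W where "W x = Abs_ell2 (\<lambda>n. cinner (g n) x)" for x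
  note n = Abs_ell2_bounded[OF b norm_ge_zero]
  have nth: "ell2_nth (W x) n = cinner (g n) x" for x n
    using fun_cong[OF n(1)] by (simp add: W_def)
  have "W \<in> carrier \<B>"
  proof (rule B_intro)
    show "norm (W x) \<le> 1 * norm x" for x unfolding W_def using n(2) by simp
  qed (rule ell2_eqI; simp add: nth ell2_rep_eqs cinner_add_right)+
  then show thesis using that nth by blast
qed

section \<open>Diagonalisation when S consists of null sequences\<close>

context symmetric_seq_ideal
begin

lemma factored_in_J:
  assumes "majorant a" "B_pairs ps" shows "factored a ps \<in> J_ideal S"
  using assms(2)
proof (induction ps)
  case Nil
  then show ?case by (simp add: J_zero)
next
  case (Cons p ps)
  then have "(\<lambda>x. fst p (diag_op (of_reals a) (snd p x)) + factored a ps x) \<in> J_ideal S"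
    by (intro J_plus J_left[OF J_right[OF diag_in_J[OF majorantD(3)[OF assms(1)]]]]) auto
  then show ?case by (simp add: factored_simps(2)[abs_def])
qed

lemma J_factored: "T \<in> J_ideal S \<Longrightarrow> \<exists>a ps. majorant a \<and> B_pairs ps \<and> T = factored a ps"
  using J_traced unfolding traced_def by blast

text \<open>The adjoint of R D_a L is L* D_a R*, because a is real.\<close>

lemma J_adjoint:
  assumes "T \<in> J_ideal S"
  shows "\<exists>T'\<in>J_ideal S. \<forall>x y. cinner (T x) y = cinner x (T' y)"
proof -
  obtain a ps where a: "majorant a" and ps: "B_pairs ps" "T = factored a ps" using J_factored[OF assms] by blast
  define qs where "qs = map (\<lambda>(R, L). (adj L, adj R)) ps"
  have qs: "B_pairs qs" using ps(1) adj_in_B by (auto simp: qs_def)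
  have "cinner (factored a ps x) y = cinner x (factored a qs y)" for x y
    using ps(1) unfolding qs_def
  proof (induction ps)
    case (Cons p ps)
    then have p: "fst p \<in> carrier \<B>" "snd p \<in> carrier \<B>" by auto
    have "cinner (fst p (diag_op (of_reals a) (snd p x))) y = cinner x (adj (snd p) (diag_op (of_reals a) (adj (fst p) y)))"
      unfolding cinner_adj[OF p(2)] cinner_adj[OF p(1), symmetric]
      by (rule diag_op_symmetric[OF S_linf[OF majorantD(3)[OF a]]])
    then show ?case using Cons by (simp add: cinner_add_left cinner_add_right case_prod_unfold)
  qed simp
  then show ?thesis using factored_in_J[OF a qs] ps(2) by blast
qed

text \<open>Let W be the coefficient map of the eigenvectors and D = diag \<mu>. Then H = W* D W,
  and W W* is the projection to the coordinates with g n \<noteq> 0, which include all those where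
  \<mu> is nonzero. So c H - c D is the commutator of W* and c D W. The scalar is carried along
  because \<open>commutator_subgroup\<close> is an additive span.\<close>

lemma symmetric_in_J_diagonalize:
  assumes S: "\<forall>\<alpha>\<in>S. \<alpha> \<longlonglongrightarrow> 0" and H: "H \<in> J_ideal S" "\<And>x y. cinner (H x) y = cinner x (H y)"
  shows "\<exists>\<mu>. of_reals \<mu> \<in> S \<and> (\<forall>c. (\<lambda>x. c *\<^sub>C H x - diag_op (\<lambda>n. c * of_real (\<mu> n)) x) \<in> B_comm)"
proof -
  obtain a ps where a: "majorant a" and ps: "B_pairs ps" "H = factored a ps" using J_factored[OF H(1)] by blast
  note aD = majorantD[OF a]
  have HB: "H \<in> carrier \<B>" using H(1) by (rule J_B)
  have "(\<lambda>n. H (y n)) \<longlonglongrightarrow> 0" if "weak_null y" for y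
    unfolding ps(2) by (rule factored_weak_null[OF ps(1) that]) (use S aD(3) S_linf in auto)
  then have "compact_symmetric H" using HB H(2) by (simp add: compact_symmetric_def compact_op_def)
  from compact_symmetric_spectral[OF this] obtain g \<mu> where
    g: "\<And>n. norm (g n) = 1 \<and> \<mu> n \<noteq> 0 \<or> g n = 0 \<and> \<mu> n = 0" "\<And>m n. m \<noteq> n \<Longrightarrow> cinner (g m) (g n) = 0"
      "decseq (\<lambda>n. \<bar>\<mu> n\<bar>)" "\<And>n. H (g n) = \<mu> n *\<^sub>R g n"
    and approx: "\<And>N x. norm (H x - (\<Sum>n<N. (complex_of_real (\<mu> n) * cinner (g n) x) *\<^sub>C g n)) \<le> \<bar>\<mu> N\<bar> * norm x"
    by blast
  obtain C where C: "\<And>k. \<bar>\<mu> k\<bar> \<le> C * a (k div (2 * length ps + 2))"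
    using factored_eigenvalue_bound[OF ps(1) aD(1,2) g(1,2,3) g(4)[unfolded ps(2)]] by blast
  \<comment> \<open>Repeating the entries of a absorbs the rank factor in the eigenvalue
    bound.\<close>
  have \<mu>S: "of_reals \<mu> \<in> S"
    by (rule S_dominated[OF S_div[OF aD(3), of "2 * length ps + 2"], of _ C]) (use C aD(2) in auto)
  then have \<mu>0: "of_reals \<mu> \<longlonglongrightarrow> 0" using S by auto
  obtain W where W: "W \<in> carrier \<B>" "\<And>x n. ell2_nth (W x) n = cinner (g n) x"
    using Bessel_op[of g] g(1,2) by blast
  note A = adj_in_B[OF W(1)]
  have sumH: "(\<lambda>n. complex_of_real (\<mu> n) * cinner (g n) x * cinner z (g n)) sums cinner z (H x)" for x z
  proof -
    have "(\<lambda>N. \<bar>\<mu> N\<bar>) \<longlonglongrightarrow> 0" using tendsto_norm[OF \<mu>0] by simp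
    then have lim: "(\<lambda>N. \<bar>\<mu> N\<bar> * norm x) \<longlonglongrightarrow> 0" by (rule tendsto_mult_left_zero)
    have "(\<lambda>N. H x - (\<Sum>n<N. (complex_of_real (\<mu> n) * cinner (g n) x) *\<^sub>C g n)) \<longlonglongrightarrow> 0"
      by (rule Lim_null_comparison[OF always_eventually lim]) (use approx in blast)
    from tendsto_diff[OF tendsto_const[of "H x"] this]
    have "(\<lambda>N. \<Sum>n<N. (complex_of_real (\<mu> n) * cinner (g n) x) *\<^sub>C g n) \<longlonglongrightarrow> H x" by simp
    then have "(\<lambda>n. (complex_of_real (\<mu> n) * cinner (g n) x) *\<^sub>C g n) sums H x" unfolding sums_def .
    from bounded_linear.sums[OF bounded_linear_cinner_right this, of z] show ?thesis by simp
  qed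
  have \<mu>l: "of_reals \<mu> \<in> carrier linf" using \<mu>S by (rule S_linf)
  have H_eq: "H x = adj W (diag_op (of_reals \<mu>) (W x))" for x
  proof (rule cinner_eqI)
    fix z
    have "(\<lambda>n. cnj (ell2_nth (W z) n) * ell2_nth (diag_op (of_reals \<mu>) (W x)) n) sums cinner z (adj W (diag_op (of_reals \<mu>) (W x)))"
      unfolding cinner_adj[OF W(1)] by (rule cinner_sums)
    moreover have "cnj (ell2_nth (W z) n) * ell2_nth (diag_op (of_reals \<mu>) (W x)) n
        = complex_of_real (\<mu> n) * cinner (g n) x * cinner z (g n)" for n
      by (simp add: W(2) ell2_nth_diag_op[OF \<mu>l])
    ultimately show "cinner z (H x) = cinner z (adj W (diag_op (of_reals \<mu>) (W x)))"
      using sumH[of x z] by (simp add: sums_unique2)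
  qed
  have WW: "ell2_nth (diag_op \<beta> (W (adj W (unit_vec m)))) n = (if n = m then \<beta> n else 0)"
    if \<beta>: "\<beta> \<in> carrier linf" "\<And>n. g n = 0 \<Longrightarrow> \<beta> n = 0" for \<beta> m n
  proof -
    have "ell2_nth (W (adj W (unit_vec m))) n = cnj (cinner (unit_vec m) (W (g n)))"
      by (simp add: W(2) cinner_adj[OF W(1)])
    also have "\<dots> = cinner (g n) (g m)" by (simp add: cinner_unit_vec W(2))
    finally show ?thesis
      using g(1)[of n] g(2)[of n m] \<beta>(2)[of n] by (auto simp: ell2_nth_diag_op[OF \<beta>(1)] cinner_self)
  qed
  have "(\<lambda>x. c *\<^sub>C H x - diag_op (\<lambda>n. c * of_real (\<mu> n)) x) \<in> B_comm" for c
  proof -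
    define \<beta> where "\<beta> n = c * complex_of_real (\<mu> n)" for n
    have \<beta>S: "\<beta> \<in> S" unfolding \<beta>_def by (rule S_cmult[OF \<mu>S])
    have \<beta>l: "\<beta> \<in> carrier linf" using \<beta>S by (rule S_linf)
    have "(\<lambda>x. diag_op \<beta> (W (adj W x))) = diag_op \<beta>"
    proof (rule B_eqI)
      show "(\<lambda>x. diag_op \<beta> (W (adj W x))) \<in> carrier \<B>"
        using B_comp[OF diag_op_in_B[OF \<beta>l] B_comp[OF W(1) A]] by (simp add: comp_def)
      show "diag_op \<beta> \<in> carrier \<B>" by (rule diag_op_in_B[OF \<beta>l])
      show "diag_op \<beta> (W (adj W (unit_vec m))) = diag_op \<beta> (unit_vec m)" for m
      proof (rule ell2_eqI)
        fix n
        have z: "\<beta> n = 0" if "g n = 0" for n using g(1)[of n] that by (auto simp: \<beta>_def)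
        show "ell2_nth (diag_op \<beta> (W (adj W (unit_vec m)))) n = ell2_nth (diag_op \<beta> (unit_vec m)) n"
          by (subst WW[OF \<beta>l z]) (simp_all add: ell2_nth_diag_op[OF \<beta>l] unit_vec.rep_eq)
      qed
    qed
    then have dW: "diag_op \<beta> (W (adj W x)) = diag_op \<beta> x" for x by metis
    have cd: "diag_op \<beta> x = c *\<^sub>C diag_op (of_reals \<mu>) x" for x
      by (rule ell2_eqI) (simp add: ell2_nth_diag_op[OF \<beta>l] ell2_nth_diag_op[OF \<mu>l] ell2_rep_eqs \<beta>_def)
    have "(\<lambda>x. adj W (diag_op \<beta> (W x)) - diag_op \<beta> (W (adj W x))) \<in> B_comm"
      by (rule B_commutator[OF A]) (rule J_right[OF diag_in_J[OF \<beta>S] W(1)])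
    moreover have "adj W (diag_op \<beta> (W x)) = c *\<^sub>C H x" for x
      unfolding cd B_scaleC[OF A] H_eq ..
    ultimately show ?thesis unfolding dW \<beta>_def by simp
  qed
  then show ?thesis using \<mu>S by blast
qed

lemma J_diagonalize_null:
  assumes "\<forall>\<alpha>\<in>S. \<alpha> \<longlonglongrightarrow> 0" "T \<in> J_ideal S"
  shows "\<exists>\<alpha>\<in>S. (\<lambda>x. T x - diag_op \<alpha> x) \<in> B_comm"
proof -
  obtain T' where T': "T' \<in> J_ideal S" "\<And>x y. cinner (T x) y = cinner x (T' y)" using J_adjoint[OF assms(2)] by blast
  have T'2: "cinner (T' x) y = cinner x (T y)" for x y
    using arg_cong[OF T'(2)[of y x], of cnj] by simp
  define H where "H x = T x + T' x" for x
  define G where "G x = \<i> *\<^sub>C (T x - T' x)" for x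
  have "H \<in> J_ideal S" unfolding H_def by (rule J_plus[OF assms(2) T'(1)])
  moreover have "cinner (H x) y = cinner x (H y)" for x y
    by (simp add: H_def cinner_add_left cinner_add_right T'(2) T'2)
  ultimately obtain \<mu> where \<mu>: "of_reals \<mu> \<in> S" "\<And>c. (\<lambda>x. c *\<^sub>C H x - diag_op (\<lambda>n. c * of_real (\<mu> n)) x) \<in> B_comm"
    using symmetric_in_J_diagonalize[OF assms(1)] by blast
  have "G \<in> J_ideal S" unfolding G_def by (intro J_scale J_minus assms(2) T'(1))
  moreover have "cinner (G x) y = cinner x (G y)" for x y
    by (simp add: G_def cinner_diff_left cinner_diff_right T'(2) T'2 algebra_simps)
  ultimately obtain \<nu> where \<nu>: "of_reals \<nu> \<in> S" "\<And>c. (\<lambda>x. c *\<^sub>C G x - diag_op (\<lambda>n. c * of_real (\<nu> n)) x) \<in> B_comm"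
    using symmetric_in_J_diagonalize[OF assms(1)] by blast
  \<comment> \<open>The coefficients are those of T = H / 2 - (i / 2) G.\<close>
  define \<alpha> where "\<alpha> n = 1 / 2 * of_real (\<mu> n) + (- \<i> / 2) * complex_of_real (\<nu> n)" for n
  have \<alpha>1: "(\<lambda>n. 1 / 2 * complex_of_real (\<mu> n)) \<in> S" and \<alpha>2: "(\<lambda>n. (- \<i> / 2) * complex_of_real (\<nu> n)) \<in> S"
    by (rule S_cmult[OF \<mu>(1)], rule S_cmult[OF \<nu>(1)])
  have \<alpha>: "\<alpha> \<in> S" unfolding \<alpha>_def by (rule S_add[OF \<alpha>1 \<alpha>2])
  have T_eq: "T x = (1 / 2) *\<^sub>C H x + (- \<i> / 2) *\<^sub>C G x" for x
    by (rule ell2_eqI) (simp add: H_def G_def ell2_rep_eqs field_simps)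
  have D: "diag_op \<alpha> x = diag_op (\<lambda>n. 1 / 2 * complex_of_real (\<mu> n)) x + diag_op (\<lambda>n. (- \<i> / 2) * complex_of_real (\<nu> n)) x" for x
    by (rule ell2_eqI) (simp only: ell2_rep_eqs ell2_nth_diag_op[OF S_linf[OF \<alpha>]] ell2_nth_diag_op[OF S_linf[OF \<alpha>1]]
        ell2_nth_diag_op[OF S_linf[OF \<alpha>2]] \<alpha>_def distrib_right)
  have "T x - diag_op \<alpha> x = ((1 / 2) *\<^sub>C H x - diag_op (\<lambda>n. 1 / 2 * of_real (\<mu> n)) x)
      + ((- \<i> / 2) *\<^sub>C G x - diag_op (\<lambda>n. (- \<i> / 2) * of_real (\<nu> n)) x)" for x
    unfolding T_eq D by (simp only: add_diff_add)
  then have "(\<lambda>x. T x - diag_op \<alpha> x) \<in> B_comm" using B_comm_add[OF \<mu>(2) \<nu>(2)] by presburger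
  then show ?thesis using \<alpha> by blast
qed

end

section \<open>Infinite repetition of an operator\<close>

text \<open>\<open>P\<close> is the isometry that carries e_i to e_(f i), and \<open>Q\<close> is
  its adjoint.\<close>

lemma gather_scatter:
  assumes "inj f"
  obtains P Q where "P \<in> carrier \<B>" "Q \<in> carrier \<B>" "\<And>x i. ell2_nth (Q x) i = ell2_nth x (f i)"
    "\<And>x i. ell2_nth (P x) (f i) = ell2_nth x i" "\<And>x j. j \<notin> range f \<Longrightarrow> ell2_nth (P x) j = 0"
proof -
  define M where "M i j = (if i \<in> UNIV \<and> j = f i then 1 else 0 :: complex)" for i j
  have one: "(\<lambda>_. 1) \<in> carrier linf" by (auto simp: linf_iff)
  have M: "M \<in> Gamma_carrier" "(\<lambda>j i. M i j) \<in> Gamma_carrier"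
    unfolding M_def using Gamma_partial_injection[OF assms one] .
  have Q: "ell2_nth (matrix_op M x) i = ell2_nth x (f i)" for x i
  proof -
    have "{j. M i j \<noteq> 0} = {f i}" by (auto simp: M_def)
    then show ?thesis using M by (simp add: ell2_nth_matrix_op M_def)
  qed
  have P: "ell2_nth (matrix_op (\<lambda>j i. M i j) x) (f i) = ell2_nth x i" for x i
  proof -
    have "{k. M k (f i) \<noteq> 0} = {i}" using assms by (auto simp: M_def inj_def)
    then show ?thesis using M by (simp add: ell2_nth_matrix_op M_def)
  qed
  have "ell2_nth (matrix_op (\<lambda>j i. M i j) x) j = 0" if "j \<notin> range f" for x j
  proof -
    have "{k. M k j \<noteq> 0} = {}" using that by (auto simp: M_def)
    then show ?thesis using M by (simp add: ell2_nth_matrix_op)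
  qed
  then show thesis using that[of "matrix_op (\<lambda>j i. M i j)" "matrix_op M"] P Q M matrix_op_in_B by blast
qed

text \<open>Infinite repetition of \<open>T\<close> along a decomposition of the space into countably many copies
  of itself: \<open>\<Phi> = V\<^sub>0 T V\<^sub>0\<^sup>* + V\<^sub>1 \<Phi> V\<^sub>1\<^sup>*\<close>, where \<open>V\<^sub>0\<close> is the inclusion of the first copy and
  \<open>V\<^sub>1\<close> the shift of the copies.\<close>

lemma infinite_repetition:
  assumes T: "T \<in> carrier \<B>"
  obtains \<Phi> V0 Q0 V1 Q1 where "\<Phi> \<in> carrier \<B>" "V0 \<in> carrier \<B>" "Q0 \<in> carrier \<B>" "V1 \<in> carrier \<B>" "Q1 \<in> carrier \<B>"
    "\<And>x. Q0 (V0 x) = x" "\<And>x. Q1 (V1 x) = x" "\<And>x. \<Phi> x = V0 (T (Q0 x)) + V1 (\<Phi> (Q1 x))"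
proof -
  have inj_row: "inj (\<lambda>n. prod_encode (k, n))" for k by (auto simp: inj_def)
  have "\<exists>R. R \<in> carrier \<B> \<and> (\<forall>x i. ell2_nth (R x) i = ell2_nth x (prod_encode (k, i)))" for k
    by (rule gather_scatter[OF inj_row[of k]]) blast
  then obtain R where R: "\<And>k. R k \<in> carrier \<B>" "\<And>k x i. ell2_nth (R k x) i = ell2_nth x (prod_encode (k, i))" by metis
  obtain K where K: "K > 0" "\<And>x. norm (T x) \<le> K * norm x" using B_bound[OF T] by blast
  \<comment> \<open>\<open>R k\<close> reads off row k under the pairing; the rows are disjoint, so
    their squared norms add up to at most that of x.\<close>
  have R_sum: "(\<Sum>k\<in>A. (norm (R k x))\<^sup>2) \<le> (norm x)\<^sup>2" if A: "finite A" for A x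
  proof (rule LIMSEQ_le_const2)
    show "(\<lambda>m. \<Sum>k\<in>A. \<Sum>n<m. (cmod (ell2_nth (R k x) n))\<^sup>2) \<longlonglongrightarrow> (\<Sum>k\<in>A. (norm (R k x))\<^sup>2)"
      unfolding norm_ell2_sq by (intro tendsto_sum summable_LIMSEQ ell2_summable)
    have "(\<Sum>k\<in>A. \<Sum>n<m. (cmod (ell2_nth (R k x) n))\<^sup>2) = (\<Sum>p\<in>prod_encode ` (A \<times> {..<m}). (cmod (ell2_nth x p))\<^sup>2)" for m
      by (subst sum.reindex) (auto simp: R sum.cartesian_product case_prod_unfold inj_on_def)
    then show "\<exists>N. \<forall>m\<ge>N. (\<Sum>k\<in>A. \<Sum>n<m. (cmod (ell2_nth (R k x) n))\<^sup>2) \<le> (norm x)\<^sup>2"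
      using sum_le_norm_ell2 A by simp
  qed
  define \<phi> where "\<phi> x p = ell2_nth (T (R (fst (prod_decode p)) x)) (snd (prod_decode p))" for x p
  have b: "(\<Sum>p\<in>F. (cmod (\<phi> x p))\<^sup>2) \<le> (K * norm x)\<^sup>2" if F: "finite F" for F x
  proof -
    define A where "A = (fst \<circ> prod_decode) ` F"
    define B where "B = (snd \<circ> prod_decode) ` F"
    have AB: "finite A" "finite B" using F by (simp_all add: A_def B_def)
    have "(\<Sum>p\<in>F. (cmod (\<phi> x p))\<^sup>2) \<le> (\<Sum>p\<in>prod_encode ` (A \<times> B). (cmod (\<phi> x p))\<^sup>2)"
    proof (rule sum_mono2)
      show "F \<subseteq> prod_encode ` (A \<times> B)"
      proof
        fix p assume "p \<in> F"
        then show "p \<in> prod_encode ` (A \<times> B)"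
          by (intro image_eqI[of _ _ "prod_decode p"]) (auto simp: A_def B_def mem_Times_iff)
      qed
    qed (use AB in auto)
    also have "\<dots> = (\<Sum>k\<in>A. \<Sum>n\<in>B. (cmod (ell2_nth (T (R k x)) n))\<^sup>2)"
      by (subst sum.reindex) (auto simp: \<phi>_def sum.cartesian_product case_prod_unfold inj_on_def)
    also have "\<dots> \<le> (\<Sum>k\<in>A. K\<^sup>2 * (norm (R k x))\<^sup>2)"
    proof (rule sum_mono)
      fix k
      have "(\<Sum>n\<in>B. (cmod (ell2_nth (T (R k x)) n))\<^sup>2) \<le> (norm (T (R k x)))\<^sup>2" by (rule sum_le_norm_ell2[OF AB(2)])
      also have "\<dots> \<le> (K * norm (R k x))\<^sup>2" by (intro power_mono K) auto
      finally show "(\<Sum>n\<in>B. (cmod (ell2_nth (T (R k x)) n))\<^sup>2) \<le> K\<^sup>2 * (norm (R k x))\<^sup>2"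
        by (simp add: power_mult_distrib)
    qed
    also have "\<dots> \<le> K\<^sup>2 * (norm x)\<^sup>2"
      unfolding sum_distrib_left[symmetric] by (intro mult_left_mono R_sum AB) auto
    finally show ?thesis by (simp add: power_mult_distrib)
  qed
  define \<Phi> where "\<Phi> x = Abs_ell2 (\<phi> x)" for x
  have K0: "K * norm x \<ge> 0" for x :: ell2 using K by simp
  have nth: "ell2_nth (\<Phi> x) p = \<phi> x p" for x p
    unfolding \<Phi>_def using Abs_ell2_bounded(1)[OF b K0] by simp
  have \<Phi>: "\<Phi> \<in> carrier \<B>"
  proof (rule B_intro)
    show "norm (\<Phi> x) \<le> K * norm x" for x
      unfolding \<Phi>_def by (rule Abs_ell2_bounded(2)[OF b K0])
  qed (rule ell2_eqI; simp add: nth ell2_rep_eqs \<phi>_def B_add[OF R(1)] B_add[OF T] B_scaleC[OF R(1)] B_scaleC[OF T])+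
  \<comment> \<open>The shift of the copies: row k goes to row k + 1, and exactly row 0 is
    missed.\<close>
  define f where "f p = prod_encode (Suc (fst (prod_decode p)), snd (prod_decode p))" for p
  have inj: "inj f"
  proof (rule injI)
    fix p q assume "f p = f q"
    then have "prod_decode p = prod_decode q" by (auto simp: f_def prod_encode_eq prod_eq_iff)
    then show "p = q" by (simp add: prod_decode_eq)
  qed
  obtain V1 Q1 where V1: "V1 \<in> carrier \<B>" "Q1 \<in> carrier \<B>" "\<And>x i. ell2_nth (Q1 x) i = ell2_nth x (f i)"
    "\<And>x i. ell2_nth (V1 x) (f i) = ell2_nth x i" "\<And>x j. j \<notin> range f \<Longrightarrow> ell2_nth (V1 x) j = 0"
    by (rule gather_scatter[OF inj]) (rule that)
  obtain V0 Q0 where V0: "V0 \<in> carrier \<B>" "Q0 \<in> carrier \<B>" "\<And>x i. ell2_nth (Q0 x) i = ell2_nth x (prod_encode (0, i))"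
    "\<And>x i. ell2_nth (V0 x) (prod_encode (0, i)) = ell2_nth x i"
    "\<And>x j. j \<notin> range (\<lambda>i. prod_encode (0, i)) \<Longrightarrow> ell2_nth (V0 x) j = 0"
    by (rule gather_scatter[OF inj_row[of 0]]) (rule that)
  have "\<Phi> x = V0 (T (Q0 x)) + V1 (\<Phi> (Q1 x))" for x
  proof (rule ell2_eqI)
    fix p
    obtain k n where p: "p = prod_encode (k, n)" by (metis prod_decode_inverse surj_pair)
    show "ell2_nth (\<Phi> x) p = ell2_nth (V0 (T (Q0 x)) + V1 (\<Phi> (Q1 x))) p"
    proof (cases k)
      case 0
      have "ell2_nth (V1 (\<Phi> (Q1 x))) p = 0" by (rule V1(5)) (auto simp: p 0 f_def)
      moreover have "R 0 x = Q0 x" by (rule ell2_eqI) (simp add: R V0)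
      ultimately show ?thesis by (simp add: ell2_rep_eqs nth \<phi>_def p 0 V0(4))
    next
      case (Suc k')
      have "ell2_nth (V0 (T (Q0 x))) p = 0" by (rule V0(5)) (auto simp: p Suc)
      moreover have "R k x = R k' (Q1 x)" by (rule ell2_eqI) (simp add: R V1(3) f_def Suc)
      moreover have "p = f (prod_encode (k', n))" by (simp add: p f_def Suc)
      then have "ell2_nth (V1 (\<Phi> (Q1 x))) p = ell2_nth (\<Phi> (Q1 x)) (prod_encode (k', n))" by (simp only: V1(4))
      ultimately show ?thesis by (simp add: ell2_rep_eqs nth \<phi>_def p)
    qed
  qed
  moreover have "Q0 (V0 x) = x" "Q1 (V1 x) = x" for x
    by (rule ell2_eqI, simp add: V0 V1)+
  ultimately show thesis using that \<Phi> V0(1,2) V1(1,2) by blast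
qed

section \<open>Reduction to diagonal operators, and comparison of the two commutator
  subgroups\<close>

context symmetric_seq_ideal
begin

text \<open>As 1 lies in \<open>S\<close>, J_S is all of \<B>. Modulo commutators, V0 T Q0 is T and
  V1 \<Phi> Q1 is \<Phi>, so \<Phi> is congruent to T + \<Phi>.\<close>

lemma J_linf_null:
  assumes "S = carrier linf" "T \<in> carrier \<B>" shows "T \<in> B_comm"
proof -
  have one: "(\<lambda>_. 1) \<in> S" using assms(1) by (auto simp: linf_iff)
  have J: "U \<in> J_ideal S" if U: "U \<in> carrier \<B>" for U
  proof -
    have "diag_op (\<lambda>_. 1) x = x" for x by (rule ell2_eqI) (simp add: ell2_nth_diag_op[OF S_linf[OF one]])
    then show ?thesis using J_left[OF diag_in_J[OF one] U] by simp
  qed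
  obtain \<Phi> V0 Q0 V1 Q1 where B: "\<Phi> \<in> carrier \<B>" "V0 \<in> carrier \<B>" "Q0 \<in> carrier \<B>" "V1 \<in> carrier \<B>" "Q1 \<in> carrier \<B>"
    and Q: "\<And>x. Q0 (V0 x) = x" "\<And>x. Q1 (V1 x) = x" and \<Phi>: "\<And>x. \<Phi> x = V0 (T (Q0 x)) + V1 (\<Phi> (Q1 x))"
    using infinite_repetition[OF assms(2)] by metis
  have "(\<lambda>x. V0 (T (Q0 x)) - T (Q0 (V0 x))) \<in> B_comm"
    by (rule B_commutator[OF B(2)]) (rule J_right[OF J[OF assms(2)] B(3)])
  moreover have "(\<lambda>x. V1 (\<Phi> (Q1 x)) - \<Phi> (Q1 (V1 x))) \<in> B_comm"
    by (rule B_commutator[OF B(4)]) (rule J_right[OF J[OF B(1)] B(5)])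
  ultimately have "(\<lambda>x. (V0 (T (Q0 x)) - T x) + (V1 (\<Phi> (Q1 x)) - \<Phi> x)) \<in> B_comm"
    unfolding Q by (rule B_comm_add)
  moreover have "(V0 (T (Q0 x)) - T x) + (V1 (\<Phi> (Q1 x)) - \<Phi> x) = - T x" for x
    using \<Phi>[of x] by (simp add: algebra_simps)
  ultimately have "(\<lambda>x. - T x) \<in> B_comm" by simp
  from B_comm_uminus[OF this] show ?thesis by simp
qed

lemma J_diagonalize:
  assumes "T \<in> J_ideal S" shows "\<exists>\<alpha>\<in>S. (\<lambda>x. T x - diag_op \<alpha> x) \<in> B_comm"
  using S_null_or_linf
proof
  assume "S = carrier linf"
  then have "(\<lambda>x. T x - diag_op (\<lambda>_. 0) x) \<in> B_comm"
    by (rule J_linf_null) (intro B_minus_op J_B assms diag_in_J S_zero)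
  then show ?thesis using S_zero by blast
qed (use J_diagonalize_null assms in blast)

lemma matrix_op_Gamma_comm: "Z \<in> \<Gamma>_comm \<Longrightarrow> matrix_op Z \<in> B_comm"
proof -
  have mz: "matrix_op (\<lambda>_ _. 0) = (\<lambda>x. 0)"
    by (rule matrix_op_eqI) (simp_all add: Gamma_closed_zero B_zero_op ell2_rep_eqs)
  have z: "(\<lambda>x. 0) \<in> B_comm" using subgroup.one_closed[OF subgroup_B_comm] by simp
  have gen: "Z \<in> Gamma_carrier \<and> matrix_op Z \<in> B_comm"
    if "Z \<in> {r \<otimes>\<^bsub>\<Gamma>\<^sup>\<infinity>\<^esub> a \<ominus>\<^bsub>\<Gamma>\<^sup>\<infinity>\<^esub> a \<otimes>\<^bsub>\<Gamma>\<^sup>\<infinity>\<^esub> r |r a. r \<in> carrier \<Gamma>\<^sup>\<infinity> \<and> a \<in> I_ideal S}" for Z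
  proof -
    obtain r a where ra: "r \<in> Gamma_carrier" "a \<in> I_ideal S" "Z = r \<otimes>\<^bsub>\<Gamma>\<^sup>\<infinity>\<^esub> a \<ominus>\<^bsub>\<Gamma>\<^sup>\<infinity>\<^esub> a \<otimes>\<^bsub>\<Gamma>\<^sup>\<infinity>\<^esub> r"
      using \<open>Z \<in> _\<close> by auto
    have aG: "a \<in> Gamma_carrier" using ra(2) I_ideal_Gamma by auto
    note c = Gamma_closed_mult[OF ra(1) aG] Gamma_closed_mult[OF aG ra(1)]
    have Z: "Z = (\<lambda>i j. (r \<otimes>\<^bsub>\<Gamma>\<^sup>\<infinity>\<^esub> a) i j - (a \<otimes>\<^bsub>\<Gamma>\<^sup>\<infinity>\<^esub> r) i j)" using ra(3) Gamma_a_minus[OF c] by simp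
    have "matrix_op Z = (\<lambda>x. matrix_op r (matrix_op a x) - matrix_op a (matrix_op r x))"
      unfolding Z matrix_op_minus[OF c] matrix_op_mult[OF ra(1) aG] matrix_op_mult[OF aG ra(1)] comp_def ..
    then show ?thesis
      using B_commutator[OF matrix_op_in_B[OF ra(1)] matrix_op_I_ideal[OF ra(2)]] Gamma_closed_diff[OF c] Z by simp
  qed
  \<comment> \<open>Membership in \<open>Gamma_carrier\<close> is carried through the induction,
    since additivity of \<open>matrix_op\<close> is stated for such matrices.\<close>
  have "Z \<in> Gamma_carrier \<and> matrix_op Z \<in> B_comm" if "Z \<in> \<Gamma>_comm"
    using that unfolding commutator_subgroup_def[of "\<Gamma>\<^sup>\<infinity>"]
  proof (induction rule: generate.induct)
    case one
    then show ?case using Gamma_closed_zero mz z by (simp add: Gamma_zero)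
  next
    case (incl Z)
    then show ?case by (rule gen)
  next
    case (inv Z)
    from gen[OF this] have Z: "Z \<in> Gamma_carrier" "matrix_op Z \<in> B_comm" by auto
    have "matrix_op (\<lambda>i j. 0 - Z i j) = (\<lambda>x. - matrix_op Z x)"
      using matrix_op_minus[OF Gamma_closed_zero Z(1)] mz by simp
    moreover have "inv\<^bsub>add_monoid \<Gamma>\<^sup>\<infinity>\<^esub> Z = (\<lambda>i j. - Z i j)" using Gamma_a_inv[OF Z(1)] by (simp add: a_inv_def)
    ultimately show ?case using Gamma_closed_uminus[OF Z(1)] B_comm_uminus[OF Z(2)] by simp
  next
    case (eng Y Z)
    then show ?case using matrix_op_plus[of Y Z] Gamma_closed_add[of Y Z] B_comm_add by (simp add: Gamma_plus)
  qed
  then show "Z \<in> \<Gamma>_comm \<Longrightarrow> matrix_op Z \<in> B_comm" by blast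
qed

text \<open>The core of injectivity: A may be replaced by its diagonal already over the matrix ring,
  and for diagonal operators the estimate of averages leads back from \<B> to matrices.\<close>

lemma Gamma_comm_if_B_comm:
  assumes "A \<in> I_ideal S" "matrix_op A \<in> B_comm" shows "A \<in> \<Gamma>_comm"
proof -
  define \<beta> where "\<beta> = (\<lambda>n. A n n)"
  have \<beta>: "\<beta> \<in> S" unfolding \<beta>_def by (rule I_ideal_diagonal[OF assms(1)])
  have A: "A \<in> Gamma_carrier" using assms(1) I_ideal_Gamma by auto
  have D: "(\<lambda>i j. A i j - diag_matrix \<beta> i j) \<in> \<Gamma>_comm"
    unfolding \<beta>_def by (rule I_ideal_minus_diagonal[OF assms(1)])
  have "matrix_op (\<lambda>i j. A i j - diag_matrix \<beta> i j) = (\<lambda>x. matrix_op A x - diag_op \<beta> x)"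
    using matrix_op_minus[OF A diag_matrix_in_Gamma[OF S_linf[OF \<beta>]]] matrix_op_diag_matrix[OF S_linf[OF \<beta>]] by simp
  then have "(\<lambda>x. matrix_op A x - diag_op \<beta> x) \<in> B_comm" using matrix_op_Gamma_comm[OF D] by simp
  from B_comm_diff[OF assms(2) this] have "diag_op \<beta> \<in> B_comm" by simp
  then have "\<beta> \<in> null_seqs S" by (rule null_of_diag_in_B_comm[OF \<beta>])
  from Gamma_comm_add[OF D diag_matrix_null[OF this]] show ?thesis by simp
qed

end

section \<open>The isomorphism\<close>

text \<open>The criterion is phrased with representatives, so that the analysis never meets
  cosets.\<close>

lemma HC0_map_iso:
  fixes R :: "'a ring" and R' :: "'b ring" and I :: "'a set" and I' :: "'b set"
  defines "K \<equiv> commutator_subgroup R I" and "K' \<equiv> commutator_subgroup R' I'"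
  assumes R: "abelian_group R" "abelian_group R'" and K: "subgroup K (add_monoid R)" "subgroup K' (add_monoid R')"
    and I: "I \<subseteq> carrier R" "I' \<subseteq> carrier R'" "\<And>a b. a \<in> I \<Longrightarrow> b \<in> I \<Longrightarrow> a \<oplus>\<^bsub>R\<^esub> b \<in> I"
    and h: "\<And>a. a \<in> carrier R \<Longrightarrow> h a \<in> carrier R'" "\<And>a b. a \<in> carrier R \<Longrightarrow> b \<in> carrier R \<Longrightarrow> h (a \<oplus>\<^bsub>R\<^esub> b) = h a \<oplus>\<^bsub>R'\<^esub> h b"
    and hI: "\<And>a. a \<in> I \<Longrightarrow> h a \<in> I'" and hK: "\<And>k. k \<in> K \<Longrightarrow> h k \<in> K'"
    and inj: "\<And>a b k'. a \<in> I \<Longrightarrow> b \<in> I \<Longrightarrow> k' \<in> K' \<Longrightarrow> h a = k' \<oplus>\<^bsub>R'\<^esub> h b \<Longrightarrow> \<exists>k\<in>K. a = k \<oplus>\<^bsub>R\<^esub> b"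
    and surj: "\<And>t. t \<in> I' \<Longrightarrow> \<exists>k'\<in>K'. \<exists>a\<in>I. t = k' \<oplus>\<^bsub>R'\<^esub> h a"
  shows "HC0_map R' I' h \<in> iso (HC0 R I) (HC0 R' I')"
proof -
  have car: "carrier (HC0 R I) = (\<lambda>a. K +>\<^bsub>R\<^esub> a) ` I" "carrier (HC0 R' I') = (\<lambda>a. K' +>\<^bsub>R'\<^esub> a) ` I'"
    by (auto simp: HC0_def A_FactGroup_def FactGroup_def RCOSETS_def a_r_coset_def r_coset_def K_def K'_def)
  have mul: "X \<otimes>\<^bsub>HC0 R I\<^esub> Y = X <#>\<^bsub>add_monoid R\<^esub> Y" "X' \<otimes>\<^bsub>HC0 R' I'\<^esub> Y' = X' <#>\<^bsub>add_monoid R'\<^esub> Y'" for X Y X' Y'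
    by (auto simp: HC0_def A_FactGroup_def FactGroup_def set_mult_def)
  note cg = abelian_group.a_comm_group[OF R(1)] abelian_group.a_comm_group[OF R(2)]
  note g = abelian_group.a_group[OF R(1)] abelian_group.a_group[OF R(2)]
  have sub: "K \<subseteq> carrier (add_monoid R)" "K' \<subseteq> carrier (add_monoid R')"
    using K subgroup.subset by blast+
  have normal: "K \<lhd> add_monoid R" "K' \<lhd> add_monoid R'"
    using comm_group.subgroup_imp_normal cg K by blast+
  have mulc: "(K +>\<^bsub>R\<^esub> a) <#>\<^bsub>add_monoid R\<^esub> (K +>\<^bsub>R\<^esub> b) = K +>\<^bsub>R\<^esub> (a \<oplus>\<^bsub>R\<^esub> b)" if "a \<in> carrier R" "b \<in> carrier R" for a b
    using normal.rcos_sum[OF normal(1), of a b] that by (simp add: a_r_coset_def)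
  have mulc': "(K' +>\<^bsub>R'\<^esub> a) <#>\<^bsub>add_monoid R'\<^esub> (K' +>\<^bsub>R'\<^esub> b) = K' +>\<^bsub>R'\<^esub> (a \<oplus>\<^bsub>R'\<^esub> b)" if "a \<in> carrier R'" "b \<in> carrier R'" for a b
    using normal.rcos_sum[OF normal(2), of a b] that by (simp add: a_r_coset_def)
  have absorb: "K +>\<^bsub>R\<^esub> (k \<oplus>\<^bsub>R\<^esub> b) = K +>\<^bsub>R\<^esub> b" if "k \<in> K" "b \<in> carrier R" for k b
    using group.coset_mult_assoc[OF g(1) sub(1), of k b] group.coset_join2[OF g(1) _ K(1), of k] that sub(1)
    by (auto simp: a_r_coset_def)
  have absorb': "K' +>\<^bsub>R'\<^esub> (k \<oplus>\<^bsub>R'\<^esub> b) = K' +>\<^bsub>R'\<^esub> b" if "k \<in> K'" "b \<in> carrier R'" for k b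
    using group.coset_mult_assoc[OF g(2) sub(2), of k b] group.coset_join2[OF g(2) _ K(2), of k] that sub(2)
    by (auto simp: a_r_coset_def)
  have map: "HC0_map R' I' h (K +>\<^bsub>R\<^esub> a) = K' +>\<^bsub>R'\<^esub> h a" if "a \<in> I" for a
  proof -
    have a: "a \<in> carrier R" using that I by auto
    \<comment> \<open>Since h maps K into K', a whole coset goes to one coset, and
      \<open>the_elem\<close> is applied to a singleton.\<close>
    have "(\<lambda>a. K' +>\<^bsub>R'\<^esub> h a) ` (K +>\<^bsub>R\<^esub> a) = {K' +>\<^bsub>R'\<^esub> h a}"
    proof (intro equalityI subsetI)
      fix Y assume "Y \<in> (\<lambda>a. K' +>\<^bsub>R'\<^esub> h a) ` (K +>\<^bsub>R\<^esub> a)"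
      then obtain k where k: "k \<in> K" "Y = K' +>\<^bsub>R'\<^esub> h (k \<oplus>\<^bsub>R\<^esub> a)" by (auto simp: a_r_coset_def r_coset_def)
      then show "Y \<in> {K' +>\<^bsub>R'\<^esub> h a}" using absorb'[OF hK[OF k(1)] h(1)[OF a]] h(2)[of k a] a sub(1) by auto
    next
      fix Y assume "Y \<in> {K' +>\<^bsub>R'\<^esub> h a}"
      moreover have "a \<in> K +>\<^bsub>R\<^esub> a"
        using group.rcos_self[OF g(1), of a K] K(1) a by (simp add: a_r_coset_def)
      ultimately show "Y \<in> (\<lambda>a. K' +>\<^bsub>R'\<^esub> h a) ` (K +>\<^bsub>R\<^esub> a)" by blast
    qed
    then show ?thesis by (simp add: HC0_map_def K'_def)
  qed
  have "HC0_map R' I' h \<in> hom (HC0 R I) (HC0 R' I')"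
  proof (rule homI)
    fix X assume "X \<in> carrier (HC0 R I)"
    then show "HC0_map R' I' h X \<in> carrier (HC0 R' I')" unfolding car using map hI by auto
  next
    fix X Y assume "X \<in> carrier (HC0 R I)" "Y \<in> carrier (HC0 R I)"
    then obtain a b where ab: "a \<in> I" "b \<in> I" "X = K +>\<^bsub>R\<^esub> a" "Y = K +>\<^bsub>R\<^esub> b" unfolding car by blast
    have c: "a \<in> carrier R" "b \<in> carrier R" using ab I by auto
    show "HC0_map R' I' h (X \<otimes>\<^bsub>HC0 R I\<^esub> Y) = HC0_map R' I' h X \<otimes>\<^bsub>HC0 R' I'\<^esub> HC0_map R' I' h Y"
      unfolding mul ab(3,4) mulc[OF c] map[OF I(3)[OF ab(1,2)]] map[OF ab(1)] map[OF ab(2)] mulc'[OF h(1)[OF c(1)] h(1)[OF c(2)]] h(2)[OF c] ..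
  qed
  moreover have "bij_betw (HC0_map R' I' h) (carrier (HC0 R I)) (carrier (HC0 R' I'))"
    unfolding bij_betw_def
  proof
    show "inj_on (HC0_map R' I' h) (carrier (HC0 R I))"
    proof (rule inj_onI)
      fix X Y assume "X \<in> carrier (HC0 R I)" "Y \<in> carrier (HC0 R I)" and eq: "HC0_map R' I' h X = HC0_map R' I' h Y"
      then obtain a b where ab: "a \<in> I" "b \<in> I" "X = K +>\<^bsub>R\<^esub> a" "Y = K +>\<^bsub>R\<^esub> b" unfolding car by blast
      have "h a \<in> K' +>\<^bsub>R'\<^esub> h a"
        using group.rcos_self[OF g(2), of "h a" K'] K(2) h(1)[of a] ab(1) I(1) by (auto simp: a_r_coset_def)
      then have "h a \<in> K' +>\<^bsub>R'\<^esub> h b" using eq ab map by simp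
      then obtain k' where "k' \<in> K'" "h a = k' \<oplus>\<^bsub>R'\<^esub> h b" by (auto simp: a_r_coset_def r_coset_def)
      then obtain k where "k \<in> K" "a = k \<oplus>\<^bsub>R\<^esub> b" using inj ab by blast
      then show "X = Y" using absorb[of k b] ab I(1) by auto
    qed
    show "HC0_map R' I' h ` carrier (HC0 R I) = carrier (HC0 R' I')"
    proof
      show "HC0_map R' I' h ` carrier (HC0 R I) \<subseteq> carrier (HC0 R' I')" unfolding car using map hI by auto
      show "carrier (HC0 R' I') \<subseteq> HC0_map R' I' h ` carrier (HC0 R I)"
      proof
        fix X assume "X \<in> carrier (HC0 R' I')"
        then obtain t where t: "t \<in> I'" "X = K' +>\<^bsub>R'\<^esub> t" unfolding car by blast
        obtain k' a where ka: "k' \<in> K'" "a \<in> I" "t = k' \<oplus>\<^bsub>R'\<^esub> h a" using surj[OF t(1)] by blast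
        have "X = HC0_map R' I' h (K +>\<^bsub>R\<^esub> a)"
          unfolding map[OF ka(2)] t(2) ka(3) by (rule absorb'[OF ka(1) h(1)]) (use ka I in auto)
        then show "X \<in> HC0_map R' I' h ` carrier (HC0 R I)" unfolding car using ka(2) by blast
      qed
    qed
  qed
  ultimately show ?thesis by (simp add: iso_def)
qed

theorem corollary6p5p3:
  fixes S :: "(nat \<Rightarrow> complex) set"
  assumes "symmetric_ideal S"
  shows "matrix_op \<in> ring_hom \<Gamma>\<^sup>\<infinity> \<B> \<and>
    inj_on matrix_op (carrier \<Gamma>\<^sup>\<infinity>) \<and>
    matrix_op ` I_ideal S \<subseteq> J_ideal S \<and>
    HC0_map \<B> (J_ideal S) matrix_op \<in> iso (HC0 \<Gamma>\<^sup>\<infinity> (I_ideal S)) (HC0 \<B> (J_ideal S))"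
proof -
  interpret symmetric_seq_ideal S by unfold_locales (rule assms)
  have "HC0_map \<B> (J_ideal S) matrix_op \<in> iso (HC0 \<Gamma>\<^sup>\<infinity> (I_ideal S)) (HC0 \<B> (J_ideal S))"
  proof (rule HC0_map_iso)
    show "abelian_group \<Gamma>\<^sup>\<infinity>" by (rule abelian_group_Gamma)
    show "abelian_group \<B>" using ring_bounded_ops by (rule ring.is_abelian_group)
    show "subgroup \<Gamma>_comm (add_monoid \<Gamma>\<^sup>\<infinity>)" by (rule subgroup_Gamma_comm)
    show "subgroup B_comm (add_monoid \<B>)" by (rule subgroup_B_comm)
    show "\<exists>k\<in>\<Gamma>_comm. A = k \<oplus>\<^bsub>\<Gamma>\<^sup>\<infinity>\<^esub> B"
      if AB: "A \<in> I_ideal S" "B \<in> I_ideal S" and Z: "Z \<in> B_comm" "matrix_op A = Z \<oplus>\<^bsub>\<B>\<^esub> matrix_op B" for A B Z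
    proof -
      have "matrix_op (\<lambda>i j. A i j - B i j) = (\<lambda>x. matrix_op A x - matrix_op B x)"
        using AB I_ideal_Gamma by (intro matrix_op_minus) auto
      also have "\<dots> = Z" by (simp add: Z(2) fun_eq_iff)
      finally have "(\<lambda>i j. A i j - B i j) \<in> \<Gamma>_comm"
        using Gamma_comm_if_B_comm[OF I_ideal_diff[OF AB]] Z(1) by simp
      then show ?thesis by (intro bexI[of _ "\<lambda>i j. A i j - B i j"]) (simp_all add: Gamma_plus)
    qed
    show "\<exists>Z\<in>B_comm. \<exists>A\<in>I_ideal S. T = Z \<oplus>\<^bsub>\<B>\<^esub> matrix_op A" if T: "T \<in> J_ideal S" for T
    proof -
      \<comment> \<open>Surjectivity: the diagonal operator congruent to T is the image of a
        diagonal matrix in I_S.\<close>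
      obtain \<alpha> where \<alpha>: "\<alpha> \<in> S" "(\<lambda>x. T x - diag_op \<alpha> x) \<in> B_comm" using J_diagonalize[OF T] by blast
      then show ?thesis
        by (intro bexI[OF _ \<alpha>(2)] bexI[OF _ diag_matrix_in_I_ideal[OF \<alpha>(1)]])
          (simp add: matrix_op_diag_matrix[OF S_linf])
    qed
  qed (use I_ideal_Gamma J_subset_B I_ideal_add matrix_op_in_B matrix_op_I_ideal matrix_op_Gamma_comm in
      \<open>auto simp: Gamma_plus matrix_op_plus\<close>)
  then show ?thesis using matrix_op_ring_hom inj_on_matrix_op matrix_op_I_ideal by auto
qed

end
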